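(* Let $\mu_{ss}^n$ denote the invariant probability measure of the process with generator $\mathcal L_n$ and let $\Phi_{ss}$ be the unique weak solution of the stationary problem $\mathbb L^\gamma\Phi_{ss}=0$ on $[0,1]$, $\Phi_{ss}(0)=\Phi_\ell$, $\Phi_{ss}(1)=\Phi_r$. Then for every $G\in C([0,1])$ and every $\delta>0$, $$\lim_{n\to\infty}\mu^n_{ss}\Big(\Big|\langle\pi^n,G\rangle-\int_0^1G(u)\Phi_{ss}(u)\,du\Big|>\delta\Big)=0.$$
   Context: Fix $\gamma\in(1,2)$ and $\Phi_\ell,\Phi_r\in\mathbb R$. For $n\ge2$ let $\Lambda_n=\{1,\dots,n-1\}$, $\Omega_n=\mathbb R^{\Lambda_n}$, $p(z)=c_\gamma\mathbf 1_{z\ne0}|z|^{-(1+\gamma)}$ with $c_\gamma=\big(\sum_{z\in\mathbb Z\setminus\{0\}}|z|^{-1-\gamma}\big)^{-1}$. $\mathcal L_n=n^\gamma(\mathcal L^\ell+\mathcal L^r+\mathcal L^{\rm bulk})$, where $\mathcal L^{\rm bulk}=\frac12\sum_{x,y\in\Lambda_n}p(y-x)\big[(\varphi(x)-\varphi(y))(\partial_{\varphi(y)}-\partial_{\varphi(x)})+(\partial_{\varphi(y)}-\partial_{\varphi(x)})^2\big]$, $\mathcal L^\ell=\partial^2_{\varphi(1)}+(\Phi_\ell-\varphi(1))\partial_{\varphi(1)}$, $\mathcal L^r=\partial^2_{\varphi(n-1)}+(\Phi_r-\varphi(n-1))\partial_{\varphi(n-1)}$; the corresponding Markov process on $\Omega_n$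 has a unique invariant probability measure. Empirical measure: $\pi^n(\varphi,du)=\frac1{|\Lambda_n|}\sum_{x\in\Lambda_n}\varphi(x)\delta_{x/n}(du)$, $\langle\pi^n,G\rangle=\int G\,d\pi^n$. Weak solution: $\mathbb L^\gamma F(u)=c_\gamma\lim_{\varepsilon\to0}\int_0^1\mathbf 1_{|u-v|\ge\varepsilon}\frac{F(v)-F(u)}{|v-u|^{1+\gamma}}dv$; $\|F\|^2_{\gamma/2}=\frac{c_\gamma}2\iint_{[0,1]^2}\frac{(F(v)-F(u))^2}{|u-v|^{1+\gamma}}du\,dv$; $\mathcal H^{\gamma/2}=\{G\in L^2([0,1]):\|G\|_{\gamma/2}<\infty\}$, elements identified with continuous representatives. $\Phi_{ss}$ is a weak solution if $\Phi_{ss}\in\mathcal H^{\gamma/2}$, $\Phi_{ss}(0)=\Phi_\ell$, $\Phi_{ss}(1)=\Phi_r$, and $\int_0^1\Phi_{ss}\,\mathbb L^\gamma G\,du=0$ for all $G\in C_c^\infty((0,1))$. *)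

theory Defs
  imports "HOL-Probability.Probability"
begin

section \<open>Configurations, jump kernel and generator\<close>

text \<open>
  The space \<open>\<Omega>\<^sub>n\<close> consists of the functions on \<open>nat\<close> that are \<open>undefined\<close> off \<open>\<Lambda>\<^sub>n\<close>. All topological
  notions on it refer to the product topology on \<open>nat \<Rightarrow> real\<close>, which restricts to the usual
  topology of \<open>\<real>\<close>-valued vectors indexed by \<open>\<Lambda>\<^sub>n\<close>.
\<close>

type_synonym config = "nat \<Rightarrow> real"

definition sites :: "nat \<Rightarrow> nat set" where
  "sites n = {1..n - 1}"

definition conf_space :: "nat \<Rightarrow> config set" where
  "conf_space n = (\<Pi>\<^sub>E x\<in>sites n. UNIV)"

definition conf_algebra :: "nat \<Rightarrow> config measure" where
  "conf_algebra n = (\<Pi>\<^sub>M x\<in>sites n. borel)"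

definition c_norm :: "real \<Rightarrow> real" where
  "c_norm \<gamma> = inverse (\<Sum>\<^sub>\<infinity>z\<in>UNIV - {0::int}. \<bar>real_of_int z\<bar> powr (- 1 - \<gamma>))"

definition jump :: "real \<Rightarrow> int \<Rightarrow> real" where
  "jump \<gamma> z = (if z = 0 then 0 else c_norm \<gamma> * \<bar>real_of_int z\<bar> powr (- (1 + \<gamma>)))"

definition pd :: "nat \<Rightarrow> (config \<Rightarrow> real) \<Rightarrow> config \<Rightarrow> real" where
  "pd x f \<phi> = deriv (\<lambda>s. f (\<phi>(x := s))) (\<phi> x)"

definition pd_diff :: "nat \<Rightarrow> nat \<Rightarrow> (config \<Rightarrow> real) \<Rightarrow> config \<Rightarrow> real" where
  "pd_diff x y f \<phi> = pd y f \<phi> - pd x f \<phi>"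

definition gen_bulk :: "real \<Rightarrow> nat \<Rightarrow> (config \<Rightarrow> real) \<Rightarrow> config \<Rightarrow> real" where
  "gen_bulk \<gamma> n f \<phi> =
     1 / 2 * (\<Sum>x\<in>sites n. \<Sum>y\<in>sites n. jump \<gamma> (int y - int x) *
       ((\<phi> x - \<phi> y) * pd_diff x y f \<phi> + pd_diff x y (pd_diff x y f) \<phi>))"

definition gen_bdry :: "real \<Rightarrow> nat \<Rightarrow> (config \<Rightarrow> real) \<Rightarrow> config \<Rightarrow> real" where
  "gen_bdry \<Theta> x f \<phi> = pd x (pd x f) \<phi> + (\<Theta> - \<phi> x) * pd x f \<phi>"

definition gen :: "real \<Rightarrow> real \<Rightarrow> real \<Rightarrow> nat \<Rightarrow> (config \<Rightarrow> real) \<Rightarrow> config \<Rightarrow> real" where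
  "gen \<gamma> \<Phi>l \<Phi>r n f \<phi> =
     real n powr \<gamma> * (gen_bdry \<Phi>l 1 f \<phi> + gen_bdry \<Phi>r (n - 1) f \<phi> + gen_bulk \<gamma> n f \<phi>)"


section \<open>The process and its invariant measures\<close>

primrec Ck :: "nat \<Rightarrow> nat \<Rightarrow> (config \<Rightarrow> real) \<Rightarrow> bool" where
  "Ck 0 n f \<longleftrightarrow> continuous_on (conf_space n) f"
| "Ck (Suc k) n f \<longleftrightarrow> continuous_on (conf_space n) f \<and>
     (\<forall>x\<in>sites n. (\<forall>\<phi>\<in>conf_space n. (\<lambda>s. f (\<phi>(x := s))) differentiable (at (\<phi> x))) \<and>
                  Ck k n (pd x f))"

text \<open>The space \<open>C\<^sub>c\<^sup>\<infinity>(\<Omega>\<^sub>n)\<close>.\<close>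

definition test_conf :: "nat \<Rightarrow> (config \<Rightarrow> real) set" where
  "test_conf n = {f. (\<forall>k. Ck k n f) \<and>
     (\<exists>R. \<forall>\<phi>\<in>conf_space n. (\<exists>x\<in>sites n. \<bar>\<phi> x\<bar> > R) \<longrightarrow> f \<phi> = 0)}"

text \<open>The space \<open>C\<^sub>0(\<Omega>\<^sub>n)\<close> of continuous functions vanishing at infinity.\<close>

definition C0_conf :: "nat \<Rightarrow> (config \<Rightarrow> real) set" where
  "C0_conf n = {f. continuous_on (conf_space n) f \<and>
     (\<forall>e>0. \<exists>R. \<forall>\<phi>\<in>conf_space n. (\<exists>x\<in>sites n. \<bar>\<phi> x\<bar> > R) \<longrightarrow> \<bar>f \<phi>\<bar> < e)}"

text \<open>
  A Markov process on \<open>\<Omega>\<^sub>n\<close> is given by its transition kernels. It has generator \<open>\<L>\<^sub>n\<close> if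
  the kernels form a Feller semigroup whose infinitesimal generator (the derivative at time \<open>0\<close>
  in the supremum norm) acts as \<open>\<L>\<^sub>n\<close> on \<open>C\<^sub>c\<^sup>\<infinity>(\<Omega>\<^sub>n)\<close>. As \<open>\<L>\<^sub>n\<close> has linear drift and constant
  diffusion coefficients, \<open>C\<^sub>c\<^sup>\<infinity>(\<Omega>\<^sub>n)\<close> is a core, so this determines the process.
\<close>

definition transition_semigroup :: "nat \<Rightarrow> (real \<Rightarrow> config \<Rightarrow> config measure) \<Rightarrow> bool" where
  "transition_semigroup n P \<longleftrightarrow>
     (\<forall>t\<ge>0. P t \<in> conf_algebra n \<rightarrow>\<^sub>M prob_algebra (conf_algebra n)) \<and>
     (\<forall>\<phi>\<in>conf_space n. P 0 \<phi> = return (conf_algebra n) \<phi>) \<and>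
     (\<forall>s\<ge>0. \<forall>t\<ge>0. \<forall>\<phi>\<in>conf_space n. P (s + t) \<phi> = P s \<phi> \<bind> P t)"

definition feller :: "nat \<Rightarrow> (real \<Rightarrow> config \<Rightarrow> config measure) \<Rightarrow> bool" where
  "feller n P \<longleftrightarrow>
     (\<forall>f\<in>C0_conf n.
        (\<forall>t\<ge>0. (\<lambda>\<phi>. \<integral>\<psi>. f \<psi> \<partial>P t \<phi>) \<in> C0_conf n) \<and>
        uniform_limit (conf_space n) (\<lambda>t \<phi>. \<integral>\<psi>. f \<psi> \<partial>P t \<phi>) f (at_right 0))"

definition process_with_generator ::
  "nat \<Rightarrow> ((config \<Rightarrow> real) \<Rightarrow> config \<Rightarrow> real) \<Rightarrow> (real \<Rightarrow> config \<Rightarrow> config measure) \<Rightarrow> bool" where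
  "process_with_generator n L P \<longleftrightarrow>
     transition_semigroup n P \<and> feller n P \<and>
     (\<forall>f\<in>test_conf n.
        uniform_limit (conf_space n) (\<lambda>t \<phi>. ((\<integral>\<psi>. f \<psi> \<partial>P t \<phi>) - f \<phi>) / t) (L f) (at_right 0))"

definition invariant_prob :: "nat \<Rightarrow> (real \<Rightarrow> config \<Rightarrow> config measure) \<Rightarrow> config measure \<Rightarrow> bool" where
  "invariant_prob n P \<mu> \<longleftrightarrow>
     \<mu> \<in> space (prob_algebra (conf_algebra n)) \<and> (\<forall>t\<ge>0. \<mu> \<bind> P t = \<mu>)"

text \<open>
  The pairing \<open>\<langle>\<pi>\<^sup>n, G\<rangle>\<close>. The empirical measure is a signed combination of Dirac masses, so the
  integral of \<open>G\<close> against it is this weighted sum of point values.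
\<close>

definition emp_pairing :: "nat \<Rightarrow> config \<Rightarrow> (real \<Rightarrow> real) \<Rightarrow> real" where
  "emp_pairing n \<phi> G = 1 / real (card (sites n)) * (\<Sum>x\<in>sites n. \<phi> x * G (real x / real n))"


section \<open>Weak solutions of the stationary problem\<close>

definition frac_op :: "real \<Rightarrow> (real \<Rightarrow> real) \<Rightarrow> real \<Rightarrow> real" where
  "frac_op \<gamma> F u = c_norm \<gamma> * Lim (at_right 0)
     (\<lambda>\<epsilon>. LBINT v:{0..1}. indicator {v. \<bar>u - v\<bar> \<ge> \<epsilon>} v * ((F v - F u) / \<bar>v - u\<bar> powr (1 + \<gamma>)))"

definition frac_seminorm_sq :: "real \<Rightarrow> (real \<Rightarrow> real) \<Rightarrow> ennreal" where
  "frac_seminorm_sq \<gamma> F = ennreal (c_norm \<gamma> / 2) *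
     (\<integral>\<^sup>+ (u, v)\<in>{0..1} \<times> {0..1}. ennreal ((F v - F u)\<^sup>2 / \<bar>u - v\<bar> powr (1 + \<gamma>)) \<partial>(lborel \<Otimes>\<^sub>M lborel))"

text \<open>
  Elements of \<open>\<H>\<^bsup>\<gamma>/2\<^esup>\<close> are given by their continuous representatives, which exist because
  \<open>\<gamma> > 1\<close>. Only the values on \<open>[0,1]\<close> matter.
\<close>

definition frac_sobolev :: "real \<Rightarrow> (real \<Rightarrow> real) set" where
  "frac_sobolev \<gamma> = {F. continuous_on {0..1} F \<and>
     set_integrable lborel {0..1} (\<lambda>u. (F u)\<^sup>2) \<and> frac_seminorm_sq \<gamma> F < \<infinity>}"

text \<open>The space \<open>C\<^sub>c\<^sup>\<infinity>((0,1))\<close>, its elements being extended by zero to the real line.\<close>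

definition test_unit :: "(real \<Rightarrow> real) set" where
  "test_unit = {G. (\<forall>k u. (deriv ^^ k) G differentiable (at u)) \<and>
     compact (closure {u. G u \<noteq> 0}) \<and> closure {u. G u \<noteq> 0} \<subseteq> {0<..<1}}"

definition weak_solution :: "real \<Rightarrow> real \<Rightarrow> real \<Rightarrow> (real \<Rightarrow> real) \<Rightarrow> bool" where
  "weak_solution \<gamma> \<Phi>l \<Phi>r \<Phi> \<longleftrightarrow>
     \<Phi> \<in> frac_sobolev \<gamma> \<and> \<Phi> 0 = \<Phi>l \<and> \<Phi> 1 = \<Phi>r \<and>
     (\<forall>G\<in>test_unit. (LBINT u:{0..1}. \<Phi> u * frac_op \<gamma> G u) = 0)"

end

theory Submission
  imports Defs "HOL-Complex_Analysis.Great_Picard"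
begin

text \<open>
  The generator has the form \<open>\<Sum> A\<^sub>x\<^sub>y (\<partial>\<^sub>x \<partial>\<^sub>y - (\<phi> - m)\<^sub>y \<partial>\<^sub>x)\<close>, where \<open>A\<close> is the matrix of the Dirichlet form with
  the two boundary terms and \<open>m\<close> solves the discrete stationary problem. Testing invariance against
  linear and quadratic functions, cut off at infinity, shows that an invariant measure has mean \<open>m\<close>
  and that its covariance solves the same Lyapunov equation as the identity matrix. Hence the variance
  of the empirical pairing is of order \<open>1/n\<close>, and only the convergence of the deterministic profile \<open>m\<close>
  to \<open>\<Phi>ss\<close> remains. Minimality of \<open>m\<close> bounds its discrete fractional energy; a discrete Morrey
  inequality turns this into equicontinuity, so Arzela--Ascoli applies. Any limit \<open>f\<close> has finite energy
  and the right boundary values and satisfies the weak equation, and \<open>f - \<Phi>ss\<close> is zero because it can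
  be approximated by test functions, uniformly and with bounded energy.
\<close>

section \<open>Flat functions\<close>

text \<open>Invariance speaks only about compactly supported test functions, and no moment of the
  measure is known in advance. The second moment has to come first, from cutoff functions with
  constants uniform in the radius; only then can linear and quadratic functions be tested by
  dominated convergence. The covariance is the identity, whatever the boundary data, because noise
  and linear drift have the same matrix \<open>A\<close>. The condition \<gamma> < 2 gives the
  linear profile finite fractional energy. The condition \<gamma> > 1 matters at two points: the
  minimal energy is of order \<open>n powr (1 - \<gamma>)\<close>, so the boundary penalties vanish
  and Dirichlet data survive in the limit, and the energy controls a Hoelder modulus of exponent
  (\<gamma> - 1) / 2. Uniform convergence does not preserve the singular energy form. It does
  preserve a form with capped kernel, and an energy bound uniform in the cap then suffices to
  enlarge the class of admissible test functions: from smooth to continuous with compact support in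
  (0,1), and from there to the difference of the two solutions itself, which is thereby tested
  against itself.\<close>

definition exp_flat :: "real poly \<Rightarrow> real \<Rightarrow> real" where
  "exp_flat p t = (if t \<le> 0 then 0 else poly p (inverse t) * exp (- inverse t))"

text \<open>Substituting s = 1/t turns d/dt into -s^2 d/ds, and the derivative of p(s) exp(-s) is
  (p' - p)(s) exp(-s). The polynomial factor is there to make the family closed under
  differentiation.\<close>

definition exp_flat_deriv :: "real poly \<Rightarrow> real poly" where
  "exp_flat_deriv p = [:0, 0, 1:] * (p - pderiv p)"

lemma poly_times_exp_minus_tendsto_0:
  "((\<lambda>x::real. poly p x * exp (- x)) \<longlongrightarrow> 0) at_top"
proof -
  have "((\<lambda>x::real. \<Sum>i\<le>degree p. coeff p i * (x ^ i / exp x)) \<longlongrightarrow> (\<Sum>i\<le>degree p. coeff p i * 0)) at_top"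
    by (intro tendsto_intros tendsto_power_div_exp_0)
  moreover have "(\<Sum>i\<le>degree p. coeff p i * (x ^ i / exp x)) = poly p x * exp (- x)" for x :: real
    by (simp add: poly_altdef sum_distrib_right exp_minus divide_inverse mult.assoc)
  ultimately show ?thesis by simp
qed

lemma exp_flat_tendsto_0: "(exp_flat p \<longlongrightarrow> 0) (at 0)"
proof -
  have "((\<lambda>t::real. poly p (inverse t) * exp (- inverse t)) \<longlongrightarrow> 0) (at_right 0)"
    using filterlim_compose[OF poly_times_exp_minus_tendsto_0 filterlim_inverse_at_top_right] by simp
  then have "(exp_flat p \<longlongrightarrow> 0) (at_right 0)"
    by (rule Lim_transform_eventually)
       (auto simp: exp_flat_def eventually_at_filter)
  moreover have "(exp_flat p \<longlongrightarrow> 0) (at_left 0)"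
    by (rule Lim_transform_eventually[OF tendsto_const])
       (auto simp: exp_flat_def eventually_at_filter)
  ultimately show ?thesis by (simp add: filterlim_split_at_real)
qed

lemma exp_flat_has_derivative: "(exp_flat p has_real_derivative exp_flat (exp_flat_deriv p) t) (at t)"
proof (cases t "0::real" rule: linorder_cases)
  case less
  have "((\<lambda>_. 0) has_real_derivative 0) (at t)" by simp
  then show ?thesis
    using less by (subst DERIV_cong_ev[OF refl _ refl, where g = "\<lambda>_. 0"])
      (auto simp: exp_flat_def intro: eventually_mono[OF eventually_nhds_in_open[of "{..<0}"]])
next
  case equal
  \<comment> \<open>Dividing by \<open>h\<close> multiplies the polynomial in 1/h by its variable,
    so the difference quotient at 0 is again a flat function.\<close>
  have "((\<lambda>h. exp_flat (pCons 0 p) h) \<longlongrightarrow> 0) (at 0)" by (rule exp_flat_tendsto_0)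
  moreover have "exp_flat (pCons 0 p) h = (exp_flat p (0 + h) - exp_flat p 0) / h" for h
    by (simp add: exp_flat_def field_simps)
  ultimately show ?thesis
    using equal by (simp add: DERIV_def exp_flat_def)
next
  case greater
  have "((\<lambda>t. poly p (inverse t) * exp (- inverse t)) has_real_derivative
      poly (pderiv p) (inverse t) * (- (inverse t * inverse t)) * exp (- inverse t)
      + exp (- inverse t) * (inverse t * inverse t) * poly p (inverse t)) (at t)"
    using greater by (auto intro!: derivative_eq_intros DERIV_chain2[OF poly_DERIV] simp: power2_eq_square field_simps)
  also have "poly (pderiv p) (inverse t) * (- (inverse t * inverse t)) * exp (- inverse t)
      + exp (- inverse t) * (inverse t * inverse t) * poly p (inverse t) = exp_flat (exp_flat_deriv p) t"
    using greater by (simp add: exp_flat_def exp_flat_deriv_def algebra_simps)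
  finally show ?thesis
    using greater by (subst DERIV_cong_ev[OF refl _ refl, where g = "\<lambda>t. poly p (inverse t) * exp (- inverse t)"])
      (auto simp: exp_flat_def intro: eventually_mono[OF eventually_nhds_in_open[of "{0<..}"]])
qed

lemma continuous_on_exp_flat [continuous_intros]:
  "continuous_on A f \<Longrightarrow> continuous_on A (\<lambda>x. exp_flat p (f x))"
  using continuous_on_compose2[of UNIV "exp_flat p" A f] DERIV_continuous_on[of UNIV "exp_flat p" "exp_flat (exp_flat_deriv p)"]
    exp_flat_has_derivative by auto

lemma exp_flat_1_nonneg: "0 \<le> exp_flat 1 t"
  by (simp add: exp_flat_def)

lemma exp_flat_eq_0: "t \<le> 0 \<Longrightarrow> exp_flat p t = 0"
  by (simp add: exp_flat_def)

text \<open>No formula for the higher derivatives is needed: membership in \<open>S\<close> passes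
  from a function to its derivative. Mollified functions are shown to be smooth in this way.\<close>

lemma smooth_if_in_closed_class:
  fixes g :: "real \<Rightarrow> real"
  assumes "g \<in> S"
    and S: "\<And>h. h \<in> S \<Longrightarrow> \<exists>h'\<in>S. \<forall>u. (h has_real_derivative h' u) (at u)"
  shows "(deriv ^^ k) g differentiable (at u)"
proof -
  have "(deriv ^^ k) g \<in> S"
  proof (induction k)
    case (Suc k)
    then obtain h' where "h' \<in> S" "\<And>u. ((deriv ^^ k) g has_real_derivative h' u) (at u)"
      using S by blast
    then have "deriv ((deriv ^^ k) g) = h'" by (auto intro!: ext DERIV_imp_deriv)
    with \<open>h' \<in> S\<close> show ?case by simp
  qed (use assms in simp)
  with S show ?thesis by (metis real_differentiable_def)
qed

section \<open>Generator and invariant measure\<close>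

text \<open>By invariance the difference quotient of the semigroup has integral zero. It converges
  to \<open>L f\<close> uniformly, so the integral passes to the limit under a probability measure
  without a dominating function.\<close>

lemma generator_integral_zero:
  assumes proc: "process_with_generator n L P"
    and inv: "invariant_prob n P \<mu>"
    and f: "f \<in> test_conf n"
    and [measurable]: "f \<in> borel_measurable (conf_algebra n)"
    and bd: "\<And>\<phi>. \<phi> \<in> conf_space n \<Longrightarrow> \<bar>f \<phi>\<bar> \<le> B"
  shows "integrable \<mu> (L f)" and "(\<integral>\<phi>. L f \<phi> \<partial>\<mu>) = 0"
proof -
  from inv have sets_\<mu> [measurable_cong]: "sets \<mu> = sets (conf_algebra n)" and "prob_space \<mu>"
    by (auto simp: invariant_prob_def space_prob_algebra)
  interpret prob_space \<mu> by fact
  have space_conf: "space (conf_algebra n) = conf_space n"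
    by (auto simp: conf_algebra_def conf_space_def space_PiM)
  have space_\<mu>: "space \<mu> = conf_space n"
    using sets_eq_imp_space_eq[OF sets_\<mu>] space_conf by simp
  have P: "P t \<in> conf_algebra n \<rightarrow>\<^sub>M prob_algebra (conf_algebra n)" if "t \<ge> 0" for t
    using proc that by (simp add: process_with_generator_def transition_semigroup_def)
  have Psub: "P t \<in> conf_algebra n \<rightarrow>\<^sub>M subprob_algebra (conf_algebra n)" if "t \<ge> 0" for t
    using P[OF that] by (rule measurable_prob_algebraD)
  define D where "D t \<phi> = ((\<integral>\<psi>. f \<psi> \<partial>P t \<phi>) - f \<phi>) / t" for t \<phi>
  have lim: "uniform_limit (conf_space n) D (L f) (at_right 0)"
    using proc f by (simp add: process_with_generator_def D_def[abs_def])
  have Pf_meas: "(\<lambda>\<phi>. \<integral>\<psi>. f \<psi> \<partial>P t \<phi>) \<in> borel_measurable (conf_algebra n)" if "t \<ge> 0" for t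
    using measurable_compose[OF Psub[OF that] integral_measurable_subprob_algebra[OF assms(4)]] .
  have D_meas: "D t \<in> borel_measurable \<mu>" if "t > 0" for t
  proof -
    have "(\<lambda>\<phi>. \<integral>\<psi>. f \<psi> \<partial>P t \<phi>) \<in> borel_measurable \<mu>" "f \<in> borel_measurable \<mu>"
      using Pf_meas[of t] that assms(4) by (auto simp: measurable_cong_sets[OF sets_\<mu> refl])
    then show ?thesis unfolding D_def[abs_def]
      by (intro borel_measurable_divide borel_measurable_diff borel_measurable_const)
  qed
  have Pf_bd: "\<bar>\<integral>\<psi>. f \<psi> \<partial>P t \<phi>\<bar> \<le> B" if "t > 0" "\<phi> \<in> conf_space n" for t \<phi>
  proof -
    have *: "prob_space (P t \<phi>)" "sets (P t \<phi>) = sets (conf_algebra n)"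
      using measurable_space[OF P, of t \<phi>] that space_conf by (auto simp: space_prob_algebra)
    then interpret p: prob_space "P t \<phi>" by simp
    have sp: "space (P t \<phi>) = conf_space n"
      using sets_eq_imp_space_eq[OF *(2)] space_conf by simp
    have m: "f \<in> borel_measurable (P t \<phi>)"
      using assms(4) by (subst measurable_cong_sets[OF *(2) refl])
    have i: "integrable (P t \<phi>) f"
      by (rule p.integrable_const_bound[of _ B]) (use bd sp m in auto)
    have "\<bar>\<integral>\<psi>. f \<psi> \<partial>P t \<phi>\<bar> \<le> (\<integral>\<psi>. \<bar>f \<psi>\<bar> \<partial>P t \<phi>)" by (rule integral_abs_bound)
    also have "\<dots> \<le> (\<integral>\<psi>. B \<partial>P t \<phi>)"
      by (rule integral_mono) (use i bd sp in auto)
    finally show ?thesis by (simp add: p.prob_space)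
  qed
  have f_int: "integrable \<mu> f"
    by (rule integrable_const_bound[of _ B]) (use bd space_\<mu> in auto)
  have D_int: "integrable \<mu> (D t)" if "t > 0" for t
  proof (rule integrable_const_bound[of _ "(2 * B) / t"])
    have "norm (D t \<phi>) \<le> 2 * B / t" if "\<phi> \<in> conf_space n" for \<phi>
      using Pf_bd[OF \<open>t > 0\<close> that] bd[OF that] \<open>t > 0\<close>
      by (auto simp: D_def divide_simps abs_mult intro: order_trans[OF abs_triangle_ineq4])
    then show "AE \<phi> in \<mu>. norm (D t \<phi>) \<le> 2 * B / t" using space_\<mu> by auto
  qed (use D_meas that in simp)
  have D_zero: "(\<integral>\<phi>. D t \<phi> \<partial>\<mu>) = 0" if "t > 0" for t
  proof -
    have bind_eq: "\<mu> \<bind> P t = \<mu>" using inv that by (simp add: invariant_prob_def)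
    have "(\<integral>\<phi>. (\<integral>\<psi>. f \<psi> \<partial>P t \<phi>) \<partial>\<mu>) = (\<integral>\<phi>. f \<phi> \<partial>(\<mu> \<bind> P t))"
    proof (rule integral_bind[symmetric, where K = "conf_algebra n" and B' = 1 and B = B])
      show "P t \<in> \<mu> \<rightarrow>\<^sub>M subprob_algebra (conf_algebra n)"
        using Psub[of t] that sets_\<mu> by (simp cong: measurable_cong_sets)
      show "AE x in \<mu>. emeasure (P t x) (space (P t x)) \<le> ennreal 1"
      proof (rule AE_I2)
        fix x assume "x \<in> space \<mu>"
        then have "prob_space (P t x)"
          using measurable_space[OF P, of t x] that space_conf space_\<mu> by (auto simp: space_prob_algebra)
        then show "emeasure (P t x) (space (P t x)) \<le> ennreal 1"
          by (simp add: prob_space.emeasure_space_1)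
      qed
    qed (use space_conf bd assms(4) finite_measure_axioms in auto)
    also note bind_eq
    finally have "(\<integral>\<phi>. (\<integral>\<psi>. f \<psi> \<partial>P t \<phi>) - f \<phi> \<partial>\<mu>) = 0"
    proof (subst Bochner_Integration.integral_diff)
      show "integrable \<mu> (\<lambda>\<phi>. \<integral>\<psi>. f \<psi> \<partial>P t \<phi>)"
        by (rule integrable_const_bound[of _ B])
           (use Pf_bd that space_\<mu> Pf_meas[of t] in \<open>auto simp: measurable_cong_sets[OF sets_\<mu> refl]\<close>)
    qed (use f_int in auto)
    then show ?thesis by (simp add: D_def)
  qed
  \<comment> \<open>\<open>L\<close> is an arbitrary map here; measurability of \<open>L f\<close>
    is inherited from the quotients along the times 1/(k+1).\<close>
  have Lf_meas: "L f \<in> borel_measurable \<mu>"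
  proof (rule borel_measurable_LIMSEQ_real)
    fix \<phi> assume "\<phi> \<in> space \<mu>"
    then have "((\<lambda>t. D t \<phi>) \<longlongrightarrow> L f \<phi>) (at_right 0)"
      using tendsto_uniform_limitI[OF lim] space_\<mu> by simp
    then show "(\<lambda>k. D (inverse (real (Suc k))) \<phi>) \<longlonglongrightarrow> L f \<phi>"
      by (rule filterlim_compose)
         (use filterlim_compose[OF filterlim_inverse_at_right_top
           filterlim_compose[OF filterlim_real_sequentially filterlim_Suc]] in \<open>simp add: o_def\<close>)
  qed (use D_meas in auto)
  have close: "\<exists>t>0. \<forall>\<phi>\<in>conf_space n. \<bar>D t \<phi> - L f \<phi>\<bar> < e" if "e > 0" for e
  proof -
    have "\<forall>\<^sub>F t in at_right 0. \<forall>\<phi>\<in>conf_space n. dist (D t \<phi>) (L f \<phi>) < e"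
      using lim that by (rule uniform_limitD)
    then have "\<forall>\<^sub>F t in at_right 0. (\<forall>\<phi>\<in>conf_space n. dist (D t \<phi>) (L f \<phi>) < e) \<and> 0 < t"
      by (rule eventually_conj) (simp add: eventually_at_right_less)
    from eventually_happens[OF this] show ?thesis
      by (auto simp: dist_real_def)
  qed
  obtain t0 where t0: "t0 > 0" "\<And>\<phi>. \<phi> \<in> conf_space n \<Longrightarrow> \<bar>D t0 \<phi> - L f \<phi>\<bar> < 1"
    using close[of 1] by auto
  show Lf_int: "integrable \<mu> (L f)"
  proof (rule Bochner_Integration.integrable_bound)
    show "integrable \<mu> (\<lambda>\<phi>. \<bar>D t0 \<phi>\<bar> + 1)" using D_int[OF t0(1)] by auto
    have "norm (L f \<phi>) \<le> norm (\<bar>D t0 \<phi>\<bar> + 1)" if "\<phi> \<in> conf_space n" for \<phi>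
      using t0(2)[OF that] by auto
    then show "AE \<phi> in \<mu>. norm (L f \<phi>) \<le> norm (\<bar>D t0 \<phi>\<bar> + 1)" using space_\<mu> by auto
  qed (rule Lf_meas)
  have "\<bar>\<integral>\<phi>. L f \<phi> \<partial>\<mu>\<bar> \<le> e" if "e > 0" for e
  proof -
    obtain t where t: "t > 0" "\<And>\<phi>. \<phi> \<in> conf_space n \<Longrightarrow> \<bar>D t \<phi> - L f \<phi>\<bar> < e"
      using close[OF \<open>e > 0\<close>] by auto
    have "\<bar>\<integral>\<phi>. L f \<phi> \<partial>\<mu>\<bar> = \<bar>\<integral>\<phi>. D t \<phi> - L f \<phi> \<partial>\<mu>\<bar>"
      using D_zero[OF t(1)] D_int[OF t(1)] Lf_int by simp
    also have "\<dots> \<le> (\<integral>\<phi>. \<bar>D t \<phi> - L f \<phi>\<bar> \<partial>\<mu>)" by (rule integral_abs_bound)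
    also have "\<dots> \<le> (\<integral>\<phi>. e \<partial>\<mu>)"
      by (rule integral_mono)
         (use D_int[OF t(1)] Lf_int t(2) space_\<mu> in \<open>auto intro!: less_imp_le\<close>)
    finally show ?thesis by (simp add: prob_space)
  qed
  then show "(\<integral>\<phi>. L f \<phi> \<partial>\<mu>) = 0"
    by (metis abs_le_zero_iff field_le_epsilon add_0)
qed

section \<open>Cutoff functions on the configuration space\<close>

definition sqn :: "nat \<Rightarrow> config \<Rightarrow> real" where
  "sqn n \<phi> = (\<Sum>x\<in>sites n. (\<phi> x)\<^sup>2)"

text \<open>Membership in \<open>test_conf\<close> asks for continuous partial derivatives of every
  order. This class is closed under them (\<open>cutoff_alg_deriv\<close>), which is why
  \<open>cut\<close> admits every polynomial \<open>p\<close>. For \<open>R > 0\<close> the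
  functions from \<open>cut\<close> vanish as soon as
  \<open>sqn n \<phi> \<ge> 2 * R\<close>.\<close>

inductive cutoff_alg :: "nat \<Rightarrow> real \<Rightarrow> (config \<Rightarrow> real) \<Rightarrow> bool" for n R where
  const: "cutoff_alg n R (\<lambda>\<phi>. c)"
| coord: "x \<in> sites n \<Longrightarrow> cutoff_alg n R (\<lambda>\<phi>. \<phi> x)"
| cut: "cutoff_alg n R (\<lambda>\<phi>. exp_flat p (2 - sqn n \<phi> / R))"
| add: "cutoff_alg n R f \<Longrightarrow> cutoff_alg n R g \<Longrightarrow> cutoff_alg n R (\<lambda>\<phi>. f \<phi> + g \<phi>)"
| mult: "cutoff_alg n R f \<Longrightarrow> cutoff_alg n R g \<Longrightarrow> cutoff_alg n R (\<lambda>\<phi>. f \<phi> * g \<phi>)"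

lemma finite_sites [simp]: "finite (sites n)"
  by (simp add: sites_def)

lemma cutoff_alg_sum:
  "finite A \<Longrightarrow> (\<And>x. x \<in> A \<Longrightarrow> cutoff_alg n R (f x)) \<Longrightarrow> cutoff_alg n R (\<lambda>\<phi>. \<Sum>x\<in>A. f x \<phi>)"
  by (induction A rule: finite_induct) (auto intro: cutoff_alg.intros)

lemma sqn_has_derivative:
  assumes "x \<in> sites n"
  shows "((\<lambda>s. sqn n (\<phi>(x := s))) has_real_derivative 2 * \<phi> x) (at (\<phi> x))"
proof -
  have "sqn n (\<phi>(x := s)) = s\<^sup>2 + (\<Sum>y\<in>sites n - {x}. (\<phi> y)\<^sup>2)" for s
    unfolding sqn_def by (subst sum.remove[OF _ assms]) auto
  then show ?thesis by (auto intro!: derivative_eq_intros)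
qed

lemma cutoff_alg_deriv:
  assumes "cutoff_alg n R f" and x: "x \<in> sites n"
  shows "\<exists>f'. cutoff_alg n R f' \<and> (\<forall>\<phi>. ((\<lambda>s. f (\<phi>(x := s))) has_real_derivative f' \<phi>) (at (\<phi> x)))"
  using assms(1)
proof induction
  case (const c)
  show ?case by (intro exI[of _ "\<lambda>_. 0"]) (auto intro: cutoff_alg.const)
next
  case (coord y)
  show ?case
    by (intro exI[of _ "\<lambda>_. if y = x then 1 else 0"]) (auto intro: cutoff_alg.const)
next
  case (cut p)
  have "((\<lambda>s. exp_flat p (2 - sqn n (\<phi>(x := s)) / R)) has_real_derivative
      exp_flat (exp_flat_deriv p) (2 - sqn n \<phi> / R) * ((- 2 / R) * \<phi> x)) (at (\<phi> x))" for \<phi>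
  proof -
    have "((\<lambda>s. 2 - sqn n (\<phi>(x := s)) / R) has_real_derivative (- 2 / R) * \<phi> x) (at (\<phi> x))"
      using DERIV_diff[OF DERIV_const DERIV_cdivide[OF sqn_has_derivative[OF x]]] by simp
    from DERIV_chain2[OF exp_flat_has_derivative this] show ?thesis by simp
  qed
  moreover have "cutoff_alg n R (\<lambda>\<phi>. exp_flat (exp_flat_deriv p) (2 - sqn n \<phi> / R) * ((- 2 / R) * \<phi> x))"
    by (intro cutoff_alg.intros x)
  ultimately show ?case by blast
next
  case (add f g)
  then obtain f' g' where *: "cutoff_alg n R f'" "cutoff_alg n R g'"
    "\<And>\<phi>. ((\<lambda>s. f (\<phi>(x := s))) has_real_derivative f' \<phi>) (at (\<phi> x))"
    "\<And>\<phi>. ((\<lambda>s. g (\<phi>(x := s))) has_real_derivative g' \<phi>) (at (\<phi> x))" by blast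
  have "((\<lambda>s. f (\<phi>(x := s)) + g (\<phi>(x := s))) has_real_derivative f' \<phi> + g' \<phi>) (at (\<phi> x))" for \<phi>
    using DERIV_add[OF *(3)[of \<phi>] *(4)[of \<phi>]] .
  then show ?case using cutoff_alg.add[OF *(1,2)] by blast
next
  case (mult f g)
  then obtain f' g' where *: "cutoff_alg n R f'" "cutoff_alg n R g'"
    "\<And>\<phi>. ((\<lambda>s. f (\<phi>(x := s))) has_real_derivative f' \<phi>) (at (\<phi> x))"
    "\<And>\<phi>. ((\<lambda>s. g (\<phi>(x := s))) has_real_derivative g' \<phi>) (at (\<phi> x))" by blast
  have "((\<lambda>s. f (\<phi>(x := s)) * g (\<phi>(x := s))) has_real_derivative f' \<phi> * g \<phi> + g' \<phi> * f \<phi>) (at (\<phi> x))" for \<phi>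
    using DERIV_mult[OF *(3)[of \<phi>] *(4)[of \<phi>]] by simp
  moreover have "cutoff_alg n R (\<lambda>\<phi>. f' \<phi> * g \<phi> + g' \<phi> * f \<phi>)"
    by (intro cutoff_alg.add cutoff_alg.mult * mult.hyps)
  ultimately show ?case by blast
qed

lemma cutoff_alg_continuous: "cutoff_alg n R f \<Longrightarrow> continuous_on UNIV f"
proof (induction rule: cutoff_alg.induct)
  case (cut p)
  show ?case unfolding sqn_def divide_inverse
    by (intro continuous_intros continuous_on_product_coordinates)
qed (auto intro!: continuous_intros continuous_on_product_coordinates)

lemma cutoff_alg_measurable: "cutoff_alg n R f \<Longrightarrow> f \<in> borel_measurable (conf_algebra n)"
proof (induction rule: cutoff_alg.induct)
  case (coord x)
  then show ?case unfolding conf_algebra_def by measurable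
next
  case (cut p)
  have "exp_flat p \<in> borel_measurable borel"
    by (intro borel_measurable_continuous_onI continuous_intros)
  moreover have "(\<lambda>\<phi>. 2 - sqn n \<phi> / R) \<in> borel_measurable (conf_algebra n)"
    unfolding conf_algebra_def sqn_def by measurable
  ultimately show ?case by (rule measurable_compose_rev)
qed auto

lemma cutoff_alg_Ck: "cutoff_alg n R f \<Longrightarrow> Ck k n f"
proof (induction k arbitrary: f)
  case 0
  then show ?case using cutoff_alg_continuous continuous_on_subset by (metis Ck.simps(1) top_greatest)
next
  case (Suc k)
  have "Ck k n (pd x f)" "\<forall>\<phi>. (\<lambda>s. f (\<phi>(x := s))) differentiable (at (\<phi> x))" if x: "x \<in> sites n" for x
  proof -
    obtain f' where f': "cutoff_alg n R f'"
      "\<And>\<phi>. ((\<lambda>s. f (\<phi>(x := s))) has_real_derivative f' \<phi>) (at (\<phi> x))"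
      using cutoff_alg_deriv[OF Suc.prems x] by blast
    then have "pd x f = f'" by (auto simp: pd_def intro!: ext DERIV_imp_deriv)
    then show "Ck k n (pd x f)" using Suc.IH f'(1) by simp
    show "\<forall>\<phi>. (\<lambda>s. f (\<phi>(x := s))) differentiable (at (\<phi> x))"
      using f'(2) real_differentiable_def by blast
  qed
  then show ?case
    using continuous_on_subset[OF cutoff_alg_continuous[OF Suc.prems], of "conf_space n"] by auto
qed

lemma cutoff_alg_test_conf:
  assumes "cutoff_alg n R f" "R > 0"
    and "\<And>\<phi>. sqn n \<phi> \<ge> 2 * R \<Longrightarrow> f \<phi> = 0"
  shows "f \<in> test_conf n"
proof -
  have "f \<phi> = 0" if "x \<in> sites n" "\<bar>\<phi> x\<bar> > sqrt (2 * R)" for x \<phi>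
  proof (rule assms(3))
    have "2 * R = (sqrt (2 * R))\<^sup>2" using assms(2) by simp
    also have "\<dots> \<le> (\<phi> x)\<^sup>2" using that assms(2)
      by (metis abs_ge_zero abs_of_nonneg less_imp_le power2_abs power_mono real_sqrt_ge_zero zero_le_mult_iff zero_le_numeral)
    also have "\<dots> \<le> sqn n \<phi>"
      unfolding sqn_def using that by (intro member_le_sum) auto
    finally show "2 * R \<le> sqn n \<phi>" .
  qed
  then show ?thesis using cutoff_alg_Ck[OF assms(1)] by (auto simp: test_conf_def)
qed

section \<open>The jump kernel, its Dirichlet form and the generator on gradients and
  Hessians\<close>

text \<open>An infinite sum that does not converge has the default value 0, and then
  \<open>c_norm\<close> would be 0 too; positivity of \<open>c_norm\<close> rests on this
  lemma.\<close>

lemma jump_sum_summable: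
  assumes "\<gamma> > 1"
  shows "(\<lambda>z::int. \<bar>real_of_int z\<bar> powr (- 1 - \<gamma>)) summable_on (UNIV - {0})"
proof -
  have s: "summable (\<lambda>k. norm (real (Suc k) powr (- 1 - \<gamma>)))"
    using assms by (subst summable_Suc_iff) (simp add: summable_real_powr_iff)
  then have N: "(\<lambda>k. real (Suc k) powr (- 1 - \<gamma>)) summable_on UNIV"
    by (rule norm_summable_imp_summable_on)
  have "(\<lambda>z::int. \<bar>real_of_int z\<bar> powr (- 1 - \<gamma>)) summable_on ((\<lambda>k. int (Suc k)) ` UNIV)"
    by (subst summable_on_reindex) (use N in \<open>auto simp: inj_on_def o_def add.commute\<close>)
  moreover have "(\<lambda>z::int. \<bar>real_of_int z\<bar> powr (- 1 - \<gamma>)) summable_on ((\<lambda>k. - int (Suc k)) ` UNIV)"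
    by (subst summable_on_reindex) (use N in \<open>auto simp: inj_on_def o_def add.commute\<close>)
  ultimately have "(\<lambda>z::int. \<bar>real_of_int z\<bar> powr (- 1 - \<gamma>)) summable_on
      ((\<lambda>k. int (Suc k)) ` UNIV \<union> (\<lambda>k. - int (Suc k)) ` UNIV)"
    by (rule summable_on_union)
  moreover have "(\<lambda>k. int (Suc k)) ` UNIV \<union> (\<lambda>k. - int (Suc k)) ` UNIV = UNIV - {0}"
  proof -
    have "z \<in> (\<lambda>k. int (Suc k)) ` UNIV \<union> (\<lambda>k. - int (Suc k)) ` UNIV" if "z \<noteq> 0" for z :: int
    proof (cases "z > 0")
      case True
      then have "z = int (Suc (nat (z - 1)))" by simp
      then show ?thesis by blast
    next
      case False
      then have "z = - int (Suc (nat (- z - 1)))" using that by simp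
      then show ?thesis by blast
    qed
    then show ?thesis by auto
  qed
  ultimately show ?thesis by simp
qed

lemma c_norm_pos:
  assumes "\<gamma> > 1"
  shows "c_norm \<gamma> > 0"
proof -
  have "(\<Sum>\<^sub>\<infinity>z\<in>{1::int}. \<bar>real_of_int z\<bar> powr (- 1 - \<gamma>)) \<le> (\<Sum>\<^sub>\<infinity>z\<in>UNIV - {0::int}. \<bar>real_of_int z\<bar> powr (- 1 - \<gamma>))"
    by (rule infsum_mono2) (use jump_sum_summable[OF assms] in auto)
  then show ?thesis by (simp add: c_norm_def)
qed

lemma jump_pos: "\<gamma> > 1 \<Longrightarrow> z \<noteq> 0 \<Longrightarrow> jump \<gamma> z > 0"
  by (simp add: jump_def c_norm_pos)

lemma jump_nonneg: "\<gamma> > 1 \<Longrightarrow> jump \<gamma> z \<ge> 0"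
  using jump_pos[of \<gamma> z] by (cases "z = 0") (auto simp: jump_def)

text \<open>The bilinear form of the matrix \<open>A\<close> of the overview. It occurs in two
  roles, as the second-order part of the generator (\<open>jet_gen_mult\<close>) and as its linear
  drift (\<open>jet_gen_linear\<close>); that one form plays both is the reason for the identity
  covariance.\<close>

definition dform :: "real \<Rightarrow> nat \<Rightarrow> (nat \<Rightarrow> real) \<Rightarrow> (nat \<Rightarrow> real) \<Rightarrow> real" where
  "dform \<gamma> n a b = a 1 * b 1 + a (n - 1) * b (n - 1) +
     1 / 2 * (\<Sum>x\<in>sites n. \<Sum>y\<in>sites n. jump \<gamma> (int y - int x) * ((a y - a x) * (b y - b x)))"

text \<open>\<open>gen\<close> without the factor \<open>n powr \<gamma>\<close>, as a function of the gradient \<open>d\<close> and the Hessian \<open>h\<close>.\<close>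

definition jet_gen :: "real \<Rightarrow> real \<Rightarrow> real \<Rightarrow> nat \<Rightarrow> config \<Rightarrow> (nat \<Rightarrow> real) \<Rightarrow> (nat \<Rightarrow> nat \<Rightarrow> real) \<Rightarrow> real" where
  "jet_gen \<gamma> \<Phi>l \<Phi>r n \<phi> d h =
     (h 1 1 + (\<Phi>l - \<phi> 1) * d 1) + (h (n - 1) (n - 1) + (\<Phi>r - \<phi> (n - 1)) * d (n - 1)) +
     1 / 2 * (\<Sum>x\<in>sites n. \<Sum>y\<in>sites n. jump \<gamma> (int y - int x) *
       ((\<phi> x - \<phi> y) * (d y - d x) + (h y y - h y x - h x y + h x x)))"

text \<open>\<open>deriv\<close> carries no information without differentiability. Gradient and
  Hessian are therefore kept as explicit witnesses that can be combined by product and chain rule,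
  and the generator becomes algebra in \<open>jet_gen\<close>.\<close>

definition jet :: "nat \<Rightarrow> (config \<Rightarrow> real) \<Rightarrow> (nat \<Rightarrow> config \<Rightarrow> real) \<Rightarrow> (nat \<Rightarrow> nat \<Rightarrow> config \<Rightarrow> real) \<Rightarrow> bool" where
  "jet n f d h \<longleftrightarrow>
     (\<forall>x\<in>sites n. \<forall>\<phi>. ((\<lambda>s. f (\<phi>(x := s))) has_real_derivative d x \<phi>) (at (\<phi> x))) \<and>
     (\<forall>x\<in>sites n. \<forall>y\<in>sites n. \<forall>\<phi>. ((\<lambda>s. d y (\<phi>(x := s))) has_real_derivative h x y \<phi>) (at (\<phi> x)))"

lemma pd_eqI: "(\<And>\<phi>. ((\<lambda>s. f (\<phi>(x := s))) has_real_derivative d \<phi>) (at (\<phi> x))) \<Longrightarrow> pd x f = d"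
  by (auto simp: pd_def intro!: ext DERIV_imp_deriv)

lemma gen_jet:
  assumes j: "jet n f d h" and n: "n \<ge> 2"
  shows "gen \<gamma> \<Phi>l \<Phi>r n f \<phi> = real n powr \<gamma> * jet_gen \<gamma> \<Phi>l \<Phi>r n \<phi> (\<lambda>x. d x \<phi>) (\<lambda>x y. h x y \<phi>)"
proof -
  have ends: "1 \<in> sites n" "n - 1 \<in> sites n" using n by (auto simp: sites_def)
  have d: "pd x f = d x" if "x \<in> sites n" for x
    using j that by (intro pd_eqI) (auto simp: jet_def)
  have dd: "pd x (d y) = h x y" if "x \<in> sites n" "y \<in> sites n" for x y
    using j that by (intro pd_eqI) (auto simp: jet_def)
  have pdd: "pd_diff x y (pd_diff x y f) \<phi> = h y y \<phi> - h y x \<phi> - h x y \<phi> + h x x \<phi>"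
    if "x \<in> sites n" "y \<in> sites n" for x y
  proof -
    have eq: "pd_diff x y f = (\<lambda>\<phi>. d y \<phi> - d x \<phi>)"
      using d that by (auto simp: pd_diff_def fun_eq_iff)
    have "pd z (\<lambda>\<phi>. d y \<phi> - d x \<phi>) = (\<lambda>\<phi>. h z y \<phi> - h z x \<phi>)" if "z \<in> sites n" for z
      using j that \<open>x \<in> sites n\<close> \<open>y \<in> sites n\<close> by (intro pd_eqI DERIV_diff) (auto simp: jet_def)
    then show ?thesis using that by (simp add: eq pd_diff_def[of x y "\<lambda>\<phi>. d y \<phi> - d x \<phi>"])
  qed
  have "pd_diff x y f \<phi> = d y \<phi> - d x \<phi>" if "x \<in> sites n" "y \<in> sites n" for x y
    using d that by (simp add: pd_diff_def)
  with pdd have "gen_bulk \<gamma> n f \<phi> = 1 / 2 * (\<Sum>x\<in>sites n. \<Sum>y\<in>sites n. jump \<gamma> (int y - int x) *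
       ((\<phi> x - \<phi> y) * (d y \<phi> - d x \<phi>) + (h y y \<phi> - h y x \<phi> - h x y \<phi> + h x x \<phi>)))"
    unfolding gen_bulk_def by (intro arg_cong[where f = "\<lambda>z. 1 / 2 * z"] sum.cong refl) simp
  then show ?thesis
    by (simp only: gen_def jet_gen_def gen_bdry_def d[OF ends(1)] d[OF ends(2)] dd[OF ends(1) ends(1)] dd[OF ends(2) ends(2)])
qed

lemma jet_mult:
  assumes "jet n f d h" "jet n g d' h'"
  shows "jet n (\<lambda>\<phi>. f \<phi> * g \<phi>) (\<lambda>x \<phi>. f \<phi> * d' x \<phi> + g \<phi> * d x \<phi>)
    (\<lambda>x y \<phi>. f \<phi> * h' x y \<phi> + g \<phi> * h x y \<phi> + (d x \<phi> * d' y \<phi> + d' x \<phi> * d y \<phi>))"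
proof -
  have D: "((\<lambda>s. f (\<phi>(x := s))) has_real_derivative d x \<phi>) (at (\<phi> x))"
      "((\<lambda>s. g (\<phi>(x := s))) has_real_derivative d' x \<phi>) (at (\<phi> x))" if "x \<in> sites n" for x \<phi>
    using assms that by (auto simp: jet_def)
  have H: "((\<lambda>s. d y (\<phi>(x := s))) has_real_derivative h x y \<phi>) (at (\<phi> x))"
      "((\<lambda>s. d' y (\<phi>(x := s))) has_real_derivative h' x y \<phi>) (at (\<phi> x))" if "x \<in> sites n" "y \<in> sites n" for x y \<phi>
    using assms that by (auto simp: jet_def)
  show ?thesis
    unfolding jet_def
  proof (intro conjI ballI allI)
    fix x \<phi> assume x: "x \<in> sites n"
    show "((\<lambda>s. f (\<phi>(x := s)) * g (\<phi>(x := s))) has_real_derivative f \<phi> * d' x \<phi> + g \<phi> * d x \<phi>) (at (\<phi> x))"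
      using DERIV_mult[OF D[OF x, of \<phi>]] by (simp add: algebra_simps)
    fix y assume y: "y \<in> sites n"
    show "((\<lambda>s. f (\<phi>(x := s)) * d' y (\<phi>(x := s)) + g (\<phi>(x := s)) * d y (\<phi>(x := s))) has_real_derivative
        f \<phi> * h' x y \<phi> + g \<phi> * h x y \<phi> + (d x \<phi> * d' y \<phi> + d' x \<phi> * d y \<phi>)) (at (\<phi> x))"
      using DERIV_add[OF DERIV_mult[OF D(1)[OF x, of \<phi>] H(2)[OF x y, of \<phi>]]
          DERIV_mult[OF D(2)[OF x, of \<phi>] H(1)[OF x y, of \<phi>]]]
      by (simp add: algebra_simps)
  qed
qed

lemma jet_compose:
  fixes H H1 H2 :: "real \<Rightarrow> real"
  assumes "jet n f d h"
    and H1: "\<And>s. (H has_real_derivative H1 s) (at s)"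
    and H2: "\<And>s. (H1 has_real_derivative H2 s) (at s)"
  shows "jet n (\<lambda>\<phi>. H (f \<phi>)) (\<lambda>x \<phi>. H1 (f \<phi>) * d x \<phi>)
    (\<lambda>x y \<phi>. H1 (f \<phi>) * h x y \<phi> + H2 (f \<phi>) * (d x \<phi> * d y \<phi>))"
proof -
  have D: "((\<lambda>s. f (\<phi>(x := s))) has_real_derivative d x \<phi>) (at (\<phi> x))" if "x \<in> sites n" for x \<phi>
    using assms(1) that by (auto simp: jet_def)
  have H: "((\<lambda>s. d y (\<phi>(x := s))) has_real_derivative h x y \<phi>) (at (\<phi> x))"
    if "x \<in> sites n" "y \<in> sites n" for x y \<phi>
    using assms(1) that by (auto simp: jet_def)
  show ?thesis
    unfolding jet_def
  proof (intro conjI ballI allI)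
    fix x \<phi> assume x: "x \<in> sites n"
    show "((\<lambda>s. H (f (\<phi>(x := s)))) has_real_derivative H1 (f \<phi>) * d x \<phi>) (at (\<phi> x))"
      using DERIV_chain2[OF H1 D[OF x, of \<phi>]] by simp
    fix y assume y: "y \<in> sites n"
    show "((\<lambda>s. H1 (f (\<phi>(x := s))) * d y (\<phi>(x := s))) has_real_derivative
        H1 (f \<phi>) * h x y \<phi> + H2 (f \<phi>) * (d x \<phi> * d y \<phi>)) (at (\<phi> x))"
      using DERIV_mult[OF DERIV_chain2[OF H2 D[OF x, of \<phi>]] H[OF x y, of \<phi>]]
      by (simp add: algebra_simps)
  qed
qed

lemma jet_linear:
  "jet n (\<lambda>\<phi>. \<Sum>x\<in>sites n. k x * \<phi> x) (\<lambda>x \<phi>. k x) (\<lambda>x y \<phi>. 0)"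
proof -
  have "((\<lambda>s. \<Sum>y\<in>sites n. k y * (\<phi>(x := s)) y) has_real_derivative k x) (at (\<phi> x))"
    if "x \<in> sites n" for x and \<phi> :: config
  proof -
    have "(\<Sum>y\<in>sites n. k y * (\<phi>(x := s)) y) = k x * s + (\<Sum>y\<in>sites n - {x}. k y * \<phi> y)" for s
      by (subst sum.remove[OF _ that]) auto
    then show ?thesis by (auto intro!: derivative_eq_intros)
  qed
  then show ?thesis by (simp add: jet_def)
qed

lemma jet_sqn: "jet n (sqn n) (\<lambda>x \<phi>. 2 * \<phi> x) (\<lambda>x y \<phi>. if x = y then 2 else 0)"
  unfolding jet_def
proof (intro conjI ballI allI)
  fix x y \<phi> assume "x \<in> sites n"
  show "((\<lambda>s. 2 * (\<phi>(x := s)) y) has_real_derivative (if x = y then 2 else 0)) (at (\<phi> x))"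
    by (cases "x = y") (auto intro!: derivative_eq_intros)
qed (use sqn_has_derivative in auto)

text \<open>The product rule of a second-order operator, with \<open>a\<close> and \<open>b\<close>
  the values of the two factors; the cross term is the carre du champ.\<close>

lemma jet_gen_mult:
  "jet_gen \<gamma> \<Phi>l \<Phi>r n \<phi> (\<lambda>x. a * d' x + b * d x)
     (\<lambda>x y. a * h' x y + b * h x y + (d x * d' y + d' x * d y)) =
   a * jet_gen \<gamma> \<Phi>l \<Phi>r n \<phi> d' h' + b * jet_gen \<gamma> \<Phi>l \<Phi>r n \<phi> d h + 2 * dform \<gamma> n d d'"
proof -
  let ?p = "\<lambda>x y. jump \<gamma> (int y - int x)"
  have "(\<Sum>x\<in>sites n. \<Sum>y\<in>sites n. ?p x y *
       ((\<phi> x - \<phi> y) * ((a * d' y + b * d y) - (a * d' x + b * d x)) +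
       ((a * h' y y + b * h y y + (d y * d' y + d' y * d y)) - (a * h' y x + b * h y x + (d y * d' x + d' y * d x))
       - (a * h' x y + b * h x y + (d x * d' y + d' x * d y)) + (a * h' x x + b * h x x + (d x * d' x + d' x * d x)))))
     = (\<Sum>x\<in>sites n. \<Sum>y\<in>sites n.
        a * (?p x y * ((\<phi> x - \<phi> y) * (d' y - d' x) + (h' y y - h' y x - h' x y + h' x x)))
       + b * (?p x y * ((\<phi> x - \<phi> y) * (d y - d x) + (h y y - h y x - h x y + h x x)))
       + 2 * (?p x y * ((d y - d x) * (d' y - d' x))))"
    by (intro sum.cong refl) (simp add: algebra_simps)
  also have "\<dots> = a * (\<Sum>x\<in>sites n. \<Sum>y\<in>sites n. ?p x y * ((\<phi> x - \<phi> y) * (d' y - d' x) + (h' y y - h' y x - h' x y + h' x x)))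
       + b * (\<Sum>x\<in>sites n. \<Sum>y\<in>sites n. ?p x y * ((\<phi> x - \<phi> y) * (d y - d x) + (h y y - h y x - h x y + h x x)))
       + 2 * (\<Sum>x\<in>sites n. \<Sum>y\<in>sites n. ?p x y * ((d y - d x) * (d' y - d' x)))"
    by (simp only: sum.distrib sum_distrib_left)
  finally show ?thesis
    unfolding jet_gen_def dform_def by (simp add: algebra_simps)
qed

text \<open>The chain rule of a second-order operator, with \<open>a\<close> and \<open>b\<close>
  the first and second derivative of the outer function.\<close>

lemma jet_gen_compose:
  "jet_gen \<gamma> \<Phi>l \<Phi>r n \<phi> (\<lambda>x. a * d x) (\<lambda>x y. a * h x y + b * (d x * d y)) =
   a * jet_gen \<gamma> \<Phi>l \<Phi>r n \<phi> d h + b * dform \<gamma> n d d"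
proof -
  let ?p = "\<lambda>x y. jump \<gamma> (int y - int x)"
  have "(\<Sum>x\<in>sites n. \<Sum>y\<in>sites n. ?p x y *
       ((\<phi> x - \<phi> y) * (a * d y - a * d x) +
       ((a * h y y + b * (d y * d y)) - (a * h y x + b * (d y * d x))
       - (a * h x y + b * (d x * d y)) + (a * h x x + b * (d x * d x)))))
     = (\<Sum>x\<in>sites n. \<Sum>y\<in>sites n.
        a * (?p x y * ((\<phi> x - \<phi> y) * (d y - d x) + (h y y - h y x - h x y + h x x)))
       + b * (?p x y * ((d y - d x) * (d y - d x))))"
    by (intro sum.cong refl) (simp add: algebra_simps)
  also have "\<dots> = a * (\<Sum>x\<in>sites n. \<Sum>y\<in>sites n. ?p x y * ((\<phi> x - \<phi> y) * (d y - d x) + (h y y - h y x - h x y + h x x)))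
       + b * (\<Sum>x\<in>sites n. \<Sum>y\<in>sites n. ?p x y * ((d y - d x) * (d y - d x)))"
    by (simp only: sum.distrib sum_distrib_left)
  finally show ?thesis
    unfolding jet_gen_def dform_def by (simp add: algebra_simps)
qed

text \<open>Linear functions have no Hessian and see only the drift, which is thereby identified as
  boundary source minus \<open>A\<close> applied to \<phi>.\<close>

lemma jet_gen_linear:
  "jet_gen \<gamma> \<Phi>l \<Phi>r n \<phi> k (\<lambda>x y. 0) = \<Phi>l * k 1 + \<Phi>r * k (n - 1) - dform \<gamma> n k \<phi>"
proof -
  let ?p = "\<lambda>x y. jump \<gamma> (int y - int x)"
  have "(\<Sum>x\<in>sites n. \<Sum>y\<in>sites n. ?p x y * ((\<phi> x - \<phi> y) * (k y - k x))) =
    - (\<Sum>x\<in>sites n. \<Sum>y\<in>sites n. ?p x y * ((k y - k x) * (\<phi> y - \<phi> x)))"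
    by (simp flip: sum_negf) (intro sum.cong refl, simp add: algebra_simps)
  then show ?thesis unfolding jet_gen_def dform_def by (simp add: algebra_simps)
qed

text \<open>The last summand is twice the trace of \<open>A\<close>; it is constant in \<phi> by
  \<open>jet_gen_const_eq\<close>.\<close>

lemma jet_gen_sqn:
  "jet_gen \<gamma> \<Phi>l \<Phi>r n \<phi> (\<lambda>x. 2 * \<phi> x) (\<lambda>x y. if x = y then 2 else 0) =
   2 * (\<Phi>l * \<phi> 1 + \<Phi>r * \<phi> (n - 1) - dform \<gamma> n \<phi> \<phi>)
   + jet_gen \<gamma> \<Phi>l \<Phi>r n \<phi> (\<lambda>x. 0) (\<lambda>x y. if x = y then 2 else 0)"
proof -
  let ?p = "\<lambda>x y. jump \<gamma> (int y - int x)" and ?h = "\<lambda>x y :: nat. if x = y then 2 else (0::real)"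
  have "(\<Sum>x\<in>sites n. \<Sum>y\<in>sites n. ?p x y * ((\<phi> x - \<phi> y) * (2 * \<phi> y - 2 * \<phi> x) + (?h y y - ?h y x - ?h x y + ?h x x)))
     = (\<Sum>x\<in>sites n. \<Sum>y\<in>sites n. (- 2) * (?p x y * ((\<phi> y - \<phi> x) * (\<phi> y - \<phi> x)))
        + ?p x y * ((\<phi> x - \<phi> y) * (0 - 0) + (?h y y - ?h y x - ?h x y + ?h x x)))"
    by (intro sum.cong refl) (auto simp: algebra_simps)
  also have "\<dots> = (- 2) * (\<Sum>x\<in>sites n. \<Sum>y\<in>sites n. ?p x y * ((\<phi> y - \<phi> x) * (\<phi> y - \<phi> x)))
       + (\<Sum>x\<in>sites n. \<Sum>y\<in>sites n. ?p x y * ((\<phi> x - \<phi> y) * (0 - 0) + (?h y y - ?h y x - ?h x y + ?h x x)))"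
    by (simp only: sum.distrib sum_distrib_left)
  finally show ?thesis unfolding jet_gen_def dform_def by (simp add: algebra_simps)
qed

lemma jet_gen_const_eq: "jet_gen \<gamma> \<Phi>l \<Phi>r n \<phi> (\<lambda>x. 0) h = jet_gen \<gamma> \<Phi>l \<Phi>r n \<psi> (\<lambda>x. 0) h"
  by (simp add: jet_gen_def)

text \<open>The constant depends on \<open>n\<close>. This is harmless, because the bound only
  serves to dominate integrands for one fixed \<open>n\<close>.\<close>

lemma dform_bound:
  assumes "n \<ge> 2" "\<gamma> > 1"
  obtains K where "K > 0" "\<And>a b A B. (\<And>x. x \<in> sites n \<Longrightarrow> \<bar>a x\<bar> \<le> A) \<Longrightarrow> (\<And>x. x \<in> sites n \<Longrightarrow> \<bar>b x\<bar> \<le> B) \<Longrightarrow>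
     \<bar>dform \<gamma> n a b\<bar> \<le> K * (A * B)"
proof
  let ?p = "\<lambda>x y. jump \<gamma> (int y - int x)"
  let ?K = "2 + 1 / 2 * (\<Sum>x\<in>sites n. \<Sum>y\<in>sites n. ?p x y * 4)"
  have "(\<Sum>x\<in>sites n. \<Sum>y\<in>sites n. ?p x y * 4) \<ge> 0"
    by (intro sum_nonneg) (use jump_nonneg[OF assms(2)] in auto)
  then show "?K > 0" by simp
  fix a b :: "nat \<Rightarrow> real" and A B
  assume a: "\<And>x. x \<in> sites n \<Longrightarrow> \<bar>a x\<bar> \<le> A" and b: "\<And>x. x \<in> sites n \<Longrightarrow> \<bar>b x\<bar> \<le> B"
  have ends: "1 \<in> sites n" "n - 1 \<in> sites n" using assms by (auto simp: sites_def)
  have AB: "A \<ge> 0" "B \<ge> 0" using a[OF ends(1)] b[OF ends(1)] by auto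
  have ab: "\<bar>a x * b x\<bar> \<le> A * B" if "x \<in> sites n" for x
    unfolding abs_mult using a[OF that] b[OF that] AB by (intro mult_mono) auto
  have "\<bar>?p x y * ((a y - a x) * (b y - b x))\<bar> \<le> ?p x y * 4 * (A * B)" if "x \<in> sites n" "y \<in> sites n" for x y
  proof -
    have "\<bar>(a y - a x) * (b y - b x)\<bar> \<le> (2 * A) * (2 * B)"
      unfolding abs_mult using a[OF that(1)] b[OF that(1)] a[OF that(2)] b[OF that(2)] AB
      by (intro mult_mono) auto
    then have "?p x y * \<bar>(a y - a x) * (b y - b x)\<bar> \<le> ?p x y * ((2 * A) * (2 * B))"
      by (rule mult_left_mono) (rule jump_nonneg[OF assms(2)])
    then show ?thesis
      using jump_nonneg[OF assms(2), of "int y - int x"] by (simp add: abs_mult mult_ac)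
  qed
  then have "\<bar>\<Sum>x\<in>sites n. \<Sum>y\<in>sites n. ?p x y * ((a y - a x) * (b y - b x))\<bar> \<le>
     (\<Sum>x\<in>sites n. \<Sum>y\<in>sites n. ?p x y * 4 * (A * B))"
    by (intro order_trans[OF sum_abs] sum_mono) (auto intro!: order_trans[OF sum_abs] sum_mono)
  also have "\<dots> = (\<Sum>x\<in>sites n. \<Sum>y\<in>sites n. ?p x y * 4) * (A * B)" by (simp only: sum_distrib_right)
  finally have "\<bar>\<Sum>x\<in>sites n. \<Sum>y\<in>sites n. ?p x y * ((a y - a x) * (b y - b x))\<bar>
    \<le> (\<Sum>x\<in>sites n. \<Sum>y\<in>sites n. ?p x y * 4) * (A * B)" .
  then show "\<bar>dform \<gamma> n a b\<bar> \<le> ?K * (A * B)"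
    unfolding dform_def using ab[OF ends(1)] ab[OF ends(2)]
    by (simp add: distrib_right abs_if split: if_splits)
qed

lemma dform_term_le:
  assumes "\<gamma> > 1" "x \<in> sites n" "y \<in> sites n"
  shows "1 / 2 * (jump \<gamma> (int y - int x) * (a y - a x)\<^sup>2) \<le> dform \<gamma> n a a"
proof -
  let ?p = "\<lambda>x y. jump \<gamma> (int y - int x)"
  have "?p x y * (a y - a x)\<^sup>2 \<le> (\<Sum>y\<in>sites n. ?p x y * (a y - a x)\<^sup>2)"
    by (rule member_le_sum[where f = "\<lambda>y. ?p x y * (a y - a x)\<^sup>2"]) (use assms jump_nonneg in auto)
  also have "\<dots> \<le> (\<Sum>x\<in>sites n. \<Sum>y\<in>sites n. ?p x y * (a y - a x)\<^sup>2)"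
    by (rule member_le_sum[where f = "\<lambda>x. \<Sum>y\<in>sites n. ?p x y * (a y - a x)\<^sup>2"])
       (use assms in \<open>auto intro!: sum_nonneg mult_nonneg_nonneg jump_nonneg simp del: zero_le_mult_iff\<close>)
  finally show ?thesis
    unfolding dform_def power2_eq_square by (simp add: add_increasing)
qed

lemma dform_end_le:
  assumes "\<gamma> > 1"
  shows "(a 1)\<^sup>2 \<le> dform \<gamma> n a a" "(a (n - 1))\<^sup>2 \<le> dform \<gamma> n a a" "0 \<le> dform \<gamma> n a a"
proof -
  have "(\<Sum>x\<in>sites n. \<Sum>y\<in>sites n. jump \<gamma> (int y - int x) * ((a y - a x) * (a y - a x))) \<ge> 0"
    by (intro sum_nonneg mult_nonneg_nonneg[OF jump_nonneg[OF assms]]) simp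
  then show "(a 1)\<^sup>2 \<le> dform \<gamma> n a a" "(a (n - 1))\<^sup>2 \<le> dform \<gamma> n a a" "0 \<le> dform \<gamma> n a a"
    by (auto simp: dform_def power2_eq_square intro!: add_nonneg_nonneg add_increasing2)
qed

text \<open>The boundary term controls site 1, and every other site is joined to site 1 by a single
  bond of positive rate because jumps of all lengths occur. The constant depends on
  \<open>n\<close>.\<close>

lemma dform_coercive:
  assumes "\<gamma> > 1" "n \<ge> 2"
  obtains c where "c > 0" "\<And>a. c * (\<Sum>x\<in>sites n. (a x)\<^sup>2) \<le> dform \<gamma> n a a"
proof -
  have ends: "1 \<in> sites n" using assms by (auto simp: sites_def)
  have "\<exists>c. c > 0 \<and> (\<forall>a. (a x)\<^sup>2 \<le> c * dform \<gamma> n a a)" if x: "x \<in> sites n" for x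
  proof (cases "x = 1")
    case True
    then show ?thesis using dform_end_le(1)[OF assms(1)] by (intro exI[of _ 1]) auto
  next
    case False
    define p where "p = jump \<gamma> (int x - int 1)"
    have p: "p > 0" unfolding p_def using False by (intro jump_pos assms) auto
    \<comment> \<open>The constant comes from \<open>(a x)\<^sup>2 \<le> 2 * (a 1)\<^sup>2 + 2 * (a
      x - a 1)\<^sup>2\<close>; the second square costs \<open>2 / p\<close> times the form.\<close>
    have "(a x)\<^sup>2 \<le> (2 + 4 / p) * dform \<gamma> n a a" for a
    proof -
      have "(a x - a 1)\<^sup>2 \<le> 2 / p * dform \<gamma> n a a"
      proof -
        have "1 / 2 * (p * (a x - a 1)\<^sup>2) \<le> dform \<gamma> n a a"
          unfolding p_def by (rule dform_term_le[OF assms(1) ends x])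
        then show ?thesis using p by (simp add: field_simps)
      qed
      moreover have "(a x)\<^sup>2 \<le> 2 * (a 1)\<^sup>2 + 2 * (a x - a 1)\<^sup>2"
        using zero_le_power2[of "a x - 2 * a 1"] by (simp add: power2_eq_square algebra_simps)
      ultimately show ?thesis
        using dform_end_le(1)[OF assms(1), of a n] by (simp add: algebra_simps)
    qed
    then show ?thesis using p by (intro exI[of _ "2 + 4 / p"]) (auto intro: add_pos_pos)
  qed
  then obtain c where c: "\<And>x. x \<in> sites n \<Longrightarrow> c x > 0 \<and> (\<forall>a. (a x)\<^sup>2 \<le> c x * dform \<gamma> n a a)"
    by metis
  let ?C = "\<Sum>x\<in>sites n. c x"
  have C: "?C > 0" using c ends by (intro sum_pos) auto
  have "(\<Sum>x\<in>sites n. (a x)\<^sup>2) \<le> ?C * dform \<gamma> n a a" for a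
    unfolding sum_distrib_right using c by (intro sum_mono) auto
  then have "inverse ?C * (\<Sum>x\<in>sites n. (a x)\<^sup>2) \<le> dform \<gamma> n a a" for a
    using C by (simp add: field_simps)
  then show ?thesis using C by (intro that[of "inverse ?C"]) auto
qed

section \<open>Moments of the invariant measure\<close>

lemma exp_flat_bounded:
  obtains B where "B > 0" "\<And>t. t \<le> 2 \<Longrightarrow> \<bar>exp_flat p t\<bar> \<le> B"
proof -
  have "compact (exp_flat p ` {0..2})"
    by (intro compact_continuous_image continuous_intros) auto
  then obtain B where B: "\<And>t. t \<in> {0..2} \<Longrightarrow> \<bar>exp_flat p t\<bar> \<le> B"
    using compact_imp_bounded bounded_iff by (metis image_eqI real_norm_def)
  have "\<bar>exp_flat p t\<bar> \<le> \<bar>B\<bar> + 1" if "t \<le> 2" for t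
    using B[of t] that by (cases "t \<ge> 0") (auto simp: exp_flat_eq_0)
  then show ?thesis by (intro that[of "\<bar>B\<bar> + 1"]) auto
qed

lemma sqn_nonneg: "0 \<le> sqn n \<phi>"
  by (simp add: sqn_def sum_nonneg)

lemma abs_coord_le_sqrt_sqn: "x \<in> sites n \<Longrightarrow> \<bar>\<phi> x\<bar> \<le> sqrt (sqn n \<phi>)"
  unfolding sqn_def by (intro real_le_rsqrt) (auto intro: member_le_sum)

lemma cutoff_alg_bounded:
  assumes "cutoff_alg n R f" "R > 0"
  shows "\<exists>B. \<forall>\<phi>. sqn n \<phi> \<le> 2 * R \<longrightarrow> \<bar>f \<phi>\<bar> \<le> B"
  using assms(1)
proof induction
  case (coord x)
  then show ?case
    using abs_coord_le_sqrt_sqn[OF coord] by (intro exI[of _ "sqrt (2 * R)"]) (meson order_trans real_sqrt_le_mono)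
next
  case (cut p)
  obtain B where "\<And>t. t \<le> 2 \<Longrightarrow> \<bar>exp_flat p t\<bar> \<le> B" using exp_flat_bounded by blast
  then show ?case using assms(2) by (intro exI[of _ B]) (simp add: sqn_nonneg)
next
  case (add f g)
  then obtain A B where "\<forall>\<phi>. sqn n \<phi> \<le> 2 * R \<longrightarrow> \<bar>f \<phi>\<bar> \<le> A" "\<forall>\<phi>. sqn n \<phi> \<le> 2 * R \<longrightarrow> \<bar>g \<phi>\<bar> \<le> B" by blast
  then have "\<bar>f \<phi> + g \<phi>\<bar> \<le> A + B" if "sqn n \<phi> \<le> 2 * R" for \<phi>
    using that by (intro order_trans[OF abs_triangle_ineq] add_mono) auto
  then show ?case by blast
next
  case (mult f g)
  then obtain A B where "\<forall>\<phi>. sqn n \<phi> \<le> 2 * R \<longrightarrow> \<bar>f \<phi>\<bar> \<le> A" "\<forall>\<phi>. sqn n \<phi> \<le> 2 * R \<longrightarrow> \<bar>g \<phi>\<bar> \<le> B" by blast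
  then have "\<bar>f \<phi> * g \<phi>\<bar> \<le> A * B" if "sqn n \<phi> \<le> 2 * R" for \<phi>
  proof -
    have fg: "\<bar>f \<phi>\<bar> \<le> A" "\<bar>g \<phi>\<bar> \<le> B"
      using that \<open>\<forall>\<phi>. sqn n \<phi> \<le> 2 * R \<longrightarrow> \<bar>f \<phi>\<bar> \<le> A\<close> \<open>\<forall>\<phi>. sqn n \<phi> \<le> 2 * R \<longrightarrow> \<bar>g \<phi>\<bar> \<le> B\<close> by auto
    show ?thesis unfolding abs_mult
      by (rule mult_mono[OF fg order_trans[OF abs_ge_zero fg(1)] abs_ge_zero])
  qed
  then show ?case by blast
qed auto

lemma dform_sum_right:
  "finite S \<Longrightarrow> dform \<gamma> n k (\<lambda>x. \<Sum>z\<in>S. c z * b z x) = (\<Sum>z\<in>S. c z * dform \<gamma> n k (b z))"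
proof (induction S rule: finite_induct)
  case (insert w S)
  have "dform \<gamma> n k (\<lambda>x. c w * b w x + g x) = c w * dform \<gamma> n k (b w) + dform \<gamma> n k g" for g
  proof -
    let ?p = "\<lambda>x y. jump \<gamma> (int y - int x)"
    have "(\<Sum>x\<in>sites n. \<Sum>y\<in>sites n. ?p x y * ((k y - k x) * ((c w * b w y + g y) - (c w * b w x + g x))))
      = (\<Sum>x\<in>sites n. \<Sum>y\<in>sites n. c w * (?p x y * ((k y - k x) * (b w y - b w x)))
          + ?p x y * ((k y - k x) * (g y - g x)))"
      by (intro sum.cong refl) (simp add: algebra_simps)
    also have "\<dots> = c w * (\<Sum>x\<in>sites n. \<Sum>y\<in>sites n. ?p x y * ((k y - k x) * (b w y - b w x)))
        + (\<Sum>x\<in>sites n. \<Sum>y\<in>sites n. ?p x y * ((k y - k x) * (g y - g x)))"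
      by (simp only: sum.distrib sum_distrib_left)
    finally show ?thesis unfolding dform_def by (simp add: algebra_simps)
  qed
  with insert show ?case by simp
qed (simp add: dform_def)

lemma dform_commute: "dform \<gamma> n a b = dform \<gamma> n b a"
  unfolding dform_def by (simp add: mult.commute)

lemma dform_scale_right: "dform \<gamma> n k (\<lambda>x. c * b x) = c * dform \<gamma> n k b"
  using dform_sum_right[of "{()}" \<gamma> n k "\<lambda>_. c" "\<lambda>_. b"] by simp

lemma dform_cong:
  assumes "n \<ge> 2" "\<And>x. x \<in> sites n \<Longrightarrow> a x = a' x" "\<And>x. x \<in> sites n \<Longrightarrow> b x = b' x"
  shows "dform \<gamma> n a b = dform \<gamma> n a' b'"
proof -
  have ends: "1 \<in> sites n" "n - 1 \<in> sites n" using assms(1) by (auto simp: sites_def)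
  show ?thesis
    unfolding dform_def using assms(2,3)[OF ends(1)] assms(2,3)[OF ends(2)]
    by (simp add: assms(2,3) cong: sum.cong)
qed

lemma dform_expand:
  assumes "n \<ge> 2"
  shows "dform \<gamma> n k a = (\<Sum>z\<in>sites n. a z * dform \<gamma> n k (\<lambda>x. of_bool (x = z)))"
proof -
  have "dform \<gamma> n k a = dform \<gamma> n k (\<lambda>x. \<Sum>z\<in>sites n. a z * of_bool (x = z))"
    by (intro dform_cong assms refl) (simp add: of_bool_def if_distrib[where f = "\<lambda>t. _ * t"] sum.delta' cong: if_cong)
  also have "\<dots> = (\<Sum>z\<in>sites n. a z * dform \<gamma> n k (\<lambda>x. of_bool (x = z)))"
    by (rule dform_sum_right) simp
  finally show ?thesis .
qed

text \<open>With \<open>A\<close> the matrix of \<open>dform\<close>, the hypothesis on \<open>N\<close> is the Lyapunov equation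
  \<open>N A + A N = 0\<close>; taking the trace against \<open>N\<close> gives \<open>tr (N A N) = 0\<close>.\<close>

lemma lyapunov_unique:
  assumes "\<gamma> > 1" "n \<ge> 2"
    and sym: "\<And>x y. N x y = N y x"
    and L: "\<And>h k. dform \<gamma> n k (\<lambda>z. \<Sum>x\<in>sites n. h x * N x z) + dform \<gamma> n h (\<lambda>z. \<Sum>x\<in>sites n. k x * N x z) = 0"
    and x: "x \<in> sites n" and y: "y \<in> sites n"
  shows "N x y = 0"
proof -
  let ?e = "\<lambda>j x. of_bool (x = j) :: real"
  obtain c where c: "c > 0" "\<And>a. c * (\<Sum>x\<in>sites n. (a x)\<^sup>2) \<le> dform \<gamma> n a a"
    using dform_coercive[OF assms(1,2)] by blast
  \<comment> \<open>The equation is tested with row \<open>j\<close> of \<open>N\<close> against the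
    unit vector at \<open>j\<close>; summing over \<open>j\<close> produces the trace.\<close>
  have 1: "dform \<gamma> n (N j) (N j) + dform \<gamma> n (?e j) (\<lambda>z. \<Sum>x\<in>sites n. N j x * N x z) = 0"
    if "j \<in> sites n" for j
  proof -
    have "(\<Sum>x\<in>sites n. ?e j x * N x z) = N j z" for z
      using that by (simp add: of_bool_def if_distrib[where f = "\<lambda>t. t * _"] cong: if_cong)
    then show ?thesis using L[of "N j" "?e j"] by simp
  qed
  have "(\<Sum>j\<in>sites n. dform \<gamma> n (?e j) (\<lambda>z. \<Sum>x\<in>sites n. N j x * N x z))
      = (\<Sum>j\<in>sites n. \<Sum>x\<in>sites n. N j x * dform \<gamma> n (?e j) (N x))"
    by (simp add: dform_sum_right)
  also have "\<dots> = (\<Sum>x\<in>sites n. \<Sum>j\<in>sites n. N x j * dform \<gamma> n (N x) (?e j))"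
    by (subst sum.swap, intro sum.cong refl) (metis sym dform_commute)
  also have "\<dots> = (\<Sum>x\<in>sites n. dform \<gamma> n (N x) (N x))"
    by (intro sum.cong refl dform_expand[symmetric] assms)
  finally have 2: "(\<Sum>j\<in>sites n. dform \<gamma> n (?e j) (\<lambda>z. \<Sum>x\<in>sites n. N j x * N x z)) =
      (\<Sum>x\<in>sites n. dform \<gamma> n (N x) (N x))" .
  have "(\<Sum>j\<in>sites n. dform \<gamma> n (N j) (N j) + dform \<gamma> n (?e j) (\<lambda>z. \<Sum>x\<in>sites n. N j x * N x z)) = 0"
    using 1 by (intro sum.neutral) auto
  then have "2 * (\<Sum>x\<in>sites n. dform \<gamma> n (N x) (N x)) = 0"
    unfolding sum.distrib 2 by simp
  then have "dform \<gamma> n (N x) (N x) = 0"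
    using dform_end_le(3)[OF assms(1)] x by (simp add: sum_nonneg_eq_0_iff)
  then have "(\<Sum>y\<in>sites n. (N x y)\<^sup>2) \<le> 0"
    using c(2)[of "N x"] c(1) by (simp add: mult_le_0_iff)
  moreover have "(N x y)\<^sup>2 \<le> (\<Sum>y\<in>sites n. (N x y)\<^sup>2)"
    using y by (intro member_le_sum) auto
  ultimately show ?thesis by (metis order_trans power2_less_eq_zero_iff)
qed

locale invariant_chain =
  fixes \<gamma> \<Phi>l \<Phi>r :: real and n :: nat and P :: "real \<Rightarrow> config \<Rightarrow> config measure" and \<mu> :: "config measure"
  assumes \<gamma>: "\<gamma> > 1" and n: "n \<ge> 2"
    and proc: "process_with_generator n (gen \<gamma> \<Phi>l \<Phi>r n) P"
    and inv: "invariant_prob n P \<mu>"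
begin

lemma sets_\<mu> [measurable_cong]: "sets \<mu> = sets (conf_algebra n)"
  and prob_space_\<mu>: "prob_space \<mu>"
  using inv by (auto simp: invariant_prob_def space_prob_algebra)

sublocale prob_space \<mu>
  by (rule prob_space_\<mu>)

lemma space_\<mu>: "space \<mu> = conf_space n"
  using sets_eq_imp_space_eq[OF sets_\<mu>]
  by (auto simp: conf_algebra_def conf_space_def space_PiM)

lemma ends: "1 \<in> sites n" "n - 1 \<in> sites n"
  using n by (auto simp: sites_def)

lemma coord_measurable [measurable]: "x \<in> sites n \<Longrightarrow> (\<lambda>\<phi>. \<phi> x) \<in> borel_measurable \<mu>"
  using cutoff_alg_measurable[OF cutoff_alg.coord, of x n]
  by (simp add: measurable_cong_sets[OF sets_\<mu> refl])

lemma sqn_measurable [measurable]: "sqn n \<in> borel_measurable \<mu>"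
  unfolding sqn_def[abs_def] by measurable

lemma jet_gen_integral_zero:
  assumes alg: "cutoff_alg n R f" and j: "jet n f d h" and "R > 0" "\<And>\<phi>. sqn n \<phi> \<ge> 2 * R \<Longrightarrow> f \<phi> = 0"
  shows "integrable \<mu> (\<lambda>\<phi>. jet_gen \<gamma> \<Phi>l \<Phi>r n \<phi> (\<lambda>x. d x \<phi>) (\<lambda>x y. h x y \<phi>))"
    and "(\<integral>\<phi>. jet_gen \<gamma> \<Phi>l \<Phi>r n \<phi> (\<lambda>x. d x \<phi>) (\<lambda>x y. h x y \<phi>) \<partial>\<mu>) = 0"
proof -
  obtain B where B: "\<And>\<phi>. sqn n \<phi> \<le> 2 * R \<Longrightarrow> \<bar>f \<phi>\<bar> \<le> B"
    using cutoff_alg_bounded[OF alg \<open>R > 0\<close>] by blast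
  have bd: "\<bar>f \<phi>\<bar> \<le> \<bar>B\<bar>" for \<phi>
    using B[of \<phi>] assms(4)[of \<phi>] by (cases "sqn n \<phi> \<le> 2 * R") auto
  note * = generator_integral_zero[OF proc inv cutoff_alg_test_conf[OF alg assms(3,4)] cutoff_alg_measurable[OF alg] bd]
  have np: "real n powr \<gamma> \<noteq> 0" using n by simp
  show "integrable \<mu> (\<lambda>\<phi>. jet_gen \<gamma> \<Phi>l \<Phi>r n \<phi> (\<lambda>x. d x \<phi>) (\<lambda>x y. h x y \<phi>))"
    using *(1) np by (simp add: gen_jet[OF j n] cong: Bochner_Integration.integrable_cong)
  show "(\<integral>\<phi>. jet_gen \<gamma> \<Phi>l \<Phi>r n \<phi> (\<lambda>x. d x \<phi>) (\<lambda>x y. h x y \<phi>) \<partial>\<mu>) = 0"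
    using *(2) np by (simp add: gen_jet[OF j n])
qed

text \<open>The generator without its time scale, applied to \<open>sqn n\<close>.\<close>

abbreviation "Lq \<phi> \<equiv> jet_gen \<gamma> \<Phi>l \<Phi>r n \<phi> (\<lambda>x. 2 * \<phi> x) (\<lambda>x y. if x = y then 2 else 0)"

text \<open>The cutoff and the profiles of its first two derivatives. As a function of
  \<open>sqn n\<close>, the cutoff \<open>E0 R\<close> has first derivative
  \<open>- E1 R / R\<close> and second derivative \<open>E2 R / R\<^sup>2\<close>; these signs and
  powers of \<open>R\<close> recur below.\<close>

definition "E0 R \<phi> = exp_flat 1 (2 - sqn n \<phi> / R)"
definition "E1 R \<phi> = exp_flat (exp_flat_deriv 1) (2 - sqn n \<phi> / R)"
definition "E2 R \<phi> = exp_flat (exp_flat_deriv (exp_flat_deriv 1)) (2 - sqn n \<phi> / R)"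

lemma E_eq_0:
  assumes "R > 0" "sqn n \<phi> \<ge> 2 * R"
  shows "E0 R \<phi> = 0" "E1 R \<phi> = 0" "E2 R \<phi> = 0"
  using assms by (auto simp: E0_def E1_def E2_def exp_flat_eq_0 field_simps)

lemma E_bounded:
  obtains B where "B > 0" "\<And>R \<phi>. R > 0 \<Longrightarrow> \<bar>E0 R \<phi>\<bar> \<le> B \<and> \<bar>E1 R \<phi>\<bar> \<le> B \<and> \<bar>E2 R \<phi>\<bar> \<le> B"
proof -
  obtain B0 where B0: "B0 > 0" "\<And>t. t \<le> 2 \<Longrightarrow> \<bar>exp_flat 1 t\<bar> \<le> B0" using exp_flat_bounded by blast
  obtain B1 where B1: "B1 > 0" "\<And>t. t \<le> 2 \<Longrightarrow> \<bar>exp_flat (exp_flat_deriv 1) t\<bar> \<le> B1" using exp_flat_bounded by blast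
  obtain B2 where B2: "B2 > 0" "\<And>t. t \<le> 2 \<Longrightarrow> \<bar>exp_flat (exp_flat_deriv (exp_flat_deriv 1)) t\<bar> \<le> B2" using exp_flat_bounded by blast
  have "\<bar>E0 R \<phi>\<bar> \<le> B0 + B1 + B2 \<and> \<bar>E1 R \<phi>\<bar> \<le> B0 + B1 + B2 \<and> \<bar>E2 R \<phi>\<bar> \<le> B0 + B1 + B2" if "R > 0" for R \<phi>
  proof -
    have "2 - sqn n \<phi> / R \<le> 2" using that by (simp add: sqn_nonneg)
    from B0(2)[OF this] B1(2)[OF this] B2(2)[OF this] show ?thesis
      using B0(1) B1(1) B2(1) by (auto simp: E0_def E1_def E2_def)
  qed
  then show ?thesis using B0(1) B1(1) B2(1) by (intro that[of "B0 + B1 + B2"]) auto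
qed

lemma E_measurable [measurable]:
  "E0 R \<in> borel_measurable \<mu>" "E1 R \<in> borel_measurable \<mu>"
  using cutoff_alg_measurable[OF cutoff_alg.cut[where n = n and R = R]]
  by (auto simp: E0_def[abs_def] E1_def[abs_def] measurable_cong_sets[OF sets_\<mu> refl])

lemma jet_cut:
  "jet n (E0 R) (\<lambda>x \<phi>. (- E1 R \<phi> / R) * (2 * \<phi> x))
    (\<lambda>x y \<phi>. (- E1 R \<phi> / R) * (if x = y then 2 else 0) + (E2 R \<phi> / R\<^sup>2) * ((2 * \<phi> x) * (2 * \<phi> y)))"
proof -
  have D: "((\<lambda>s. exp_flat p (2 - s / R)) has_real_derivative exp_flat (exp_flat_deriv p) (2 - s / R) * (- 1 / R)) (at s)" for p s
  proof -
    have "((\<lambda>s. 2 - s / R) has_real_derivative - 1 / R) (at s)"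
      using DERIV_diff[OF DERIV_const DERIV_cdivide[OF DERIV_ident]] by simp
    from DERIV_chain2[OF exp_flat_has_derivative this] show ?thesis .
  qed
  have D1: "((\<lambda>s. exp_flat 1 (2 - s / R)) has_real_derivative - exp_flat (exp_flat_deriv 1) (2 - s / R) / R) (at s)" for s
    using D[of 1 s] by simp
  have D2: "((\<lambda>s. - exp_flat (exp_flat_deriv 1) (2 - s / R) / R) has_real_derivative
      exp_flat (exp_flat_deriv (exp_flat_deriv 1)) (2 - s / R) / R\<^sup>2) (at s)" for s
    using DERIV_cdivide[OF DERIV_minus[OF D[of "exp_flat_deriv 1" s]], of R] by (simp add: power2_eq_square)
  show ?thesis
    using jet_compose[OF jet_sqn D1 D2] by (simp add: E0_def[abs_def] E1_def[abs_def] E2_def[abs_def])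
qed

lemma jet_gen_cut:
  "jet_gen \<gamma> \<Phi>l \<Phi>r n \<phi> (\<lambda>x. (- E1 R \<phi> / R) * (2 * \<phi> x))
    (\<lambda>x y. (- E1 R \<phi> / R) * (if x = y then 2 else 0) + (E2 R \<phi> / R\<^sup>2) * ((2 * \<phi> x) * (2 * \<phi> y)))
   = (- E1 R \<phi> / R) * Lq \<phi> + (E2 R \<phi> / R\<^sup>2) * (4 * dform \<gamma> n \<phi> \<phi>)"
proof -
  have "dform \<gamma> n (\<lambda>x. 2 * \<phi> x) (\<lambda>x. 2 * \<phi> x) = 4 * dform \<gamma> n \<phi> \<phi>"
    by (simp add: dform_scale_right dform_commute[of \<gamma> n "\<lambda>x. 2 * \<phi> x"])
  then show ?thesis by (simp only: jet_gen_compose)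
qed

lemma Lq_bounds:
  obtains c C where "c > 0" "C > 0" "\<And>\<phi>. Lq \<phi> \<le> C - c * sqn n \<phi>" "\<And>\<phi>. \<bar>Lq \<phi>\<bar> \<le> C * (1 + sqn n \<phi>)"
    "\<And>\<phi>. \<bar>dform \<gamma> n \<phi> \<phi>\<bar> \<le> C * sqn n \<phi>"
proof -
  obtain c where c: "c > 0" "\<And>a. c * (\<Sum>x\<in>sites n. (a x)\<^sup>2) \<le> dform \<gamma> n a a"
    using dform_coercive[OF \<gamma> n] by blast
  obtain K where K: "K > 0" "\<And>a b A B. (\<And>x. x \<in> sites n \<Longrightarrow> \<bar>a x\<bar> \<le> A) \<Longrightarrow> (\<And>x. x \<in> sites n \<Longrightarrow> \<bar>b x\<bar> \<le> B) \<Longrightarrow>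
     \<bar>dform \<gamma> n a b\<bar> \<le> K * (A * B)" using dform_bound[OF n \<gamma>] by blast
  define c0 where "c0 = jet_gen \<gamma> \<Phi>l \<Phi>r n (\<lambda>_. 0) (\<lambda>x. 0) (\<lambda>x y. if x = y then 2 else 0)"
  have Lq: "Lq \<phi> = 2 * (\<Phi>l * \<phi> 1 + \<Phi>r * \<phi> (n - 1) - dform \<gamma> n \<phi> \<phi>) + c0" for \<phi>
    unfolding c0_def jet_gen_sqn by (simp add: jet_gen_const_eq[of _ _ _ _ \<phi> _ "\<lambda>_. 0"])
  have G: "\<bar>dform \<gamma> n \<phi> \<phi>\<bar> \<le> K * sqn n \<phi>" for \<phi>
    using K(2)[of \<phi> "sqrt (sqn n \<phi>)" \<phi> "sqrt (sqn n \<phi>)"] by (simp add: abs_coord_le_sqrt_sqn sqn_nonneg)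
  have coord: "(\<phi> x)\<^sup>2 \<le> sqn n \<phi>" if "x \<in> sites n" for x \<phi>
    unfolding sqn_def using that by (intro member_le_sum) auto
  define C1 where "C1 = 2 / c * (\<Phi>l\<^sup>2 + \<Phi>r\<^sup>2) + \<bar>c0\<bar>"
  define C2 where "C2 = \<Phi>l\<^sup>2 + \<Phi>r\<^sup>2 + \<bar>c0\<bar> + 2 + 2 * K"
  have young: "2 * (a * b) \<le> (c / 2) * b\<^sup>2 + 2 / c * a\<^sup>2" for a b :: real
  proof -
    have "0 \<le> (c / 2) * (b - 2 / c * a)\<^sup>2" using c(1) by simp
    also have "\<dots> = (c / 2) * b\<^sup>2 + 2 / c * a\<^sup>2 - 2 * (a * b)"
      using c(1) by (simp add: power2_eq_square field_simps)
    finally show ?thesis by simp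
  qed
  have upper: "Lq \<phi> \<le> C1 - c * sqn n \<phi>" for \<phi>
  proof -
    have "(c / 2) * (\<phi> 1)\<^sup>2 \<le> (c / 2) * sqn n \<phi>" "(c / 2) * (\<phi> (n - 1))\<^sup>2 \<le> (c / 2) * sqn n \<phi>"
      using coord[OF ends(1)] coord[OF ends(2)] c(1) by (auto intro!: mult_left_mono)
    then show ?thesis
      using young[of \<Phi>l "\<phi> 1"] young[of \<Phi>r "\<phi> (n - 1)"] c(2)[of \<phi>]
      unfolding Lq C1_def sqn_def[symmetric] by (simp only: distrib_left right_diff_distrib)
  qed
  have "\<bar>Lq \<phi>\<bar> \<le> C2 * (1 + sqn n \<phi>)" for \<phi>
  proof -
    have ab: "\<bar>2 * (a * b)\<bar> \<le> a\<^sup>2 + b\<^sup>2" for a b :: real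
      using zero_le_power2[of "a - b"] zero_le_power2[of "a + b"] by (simp add: power2_eq_square algebra_simps abs_if)
    have "\<bar>Lq \<phi>\<bar> \<le> (\<Phi>l\<^sup>2 + \<Phi>r\<^sup>2 + \<bar>c0\<bar>) + (2 + 2 * K) * sqn n \<phi>"
      using ab[of \<Phi>l "\<phi> 1"] ab[of \<Phi>r "\<phi> (n - 1)"] coord[OF ends(1), of \<phi>] coord[OF ends(2), of \<phi>] G[of \<phi>]
      unfolding Lq by (simp only: distrib_left distrib_right right_diff_distrib)
    also have "\<dots> \<le> C2 + C2 * sqn n \<phi>"
    proof (rule add_mono[OF _ mult_right_mono[OF _ sqn_nonneg]])
      show "\<Phi>l\<^sup>2 + \<Phi>r\<^sup>2 + \<bar>c0\<bar> \<le> C2" "2 + 2 * K \<le> C2" unfolding C2_def using K(1) by auto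
    qed
    finally show ?thesis by (simp add: algebra_simps)
  qed
  moreover have "C1 + C2 + K > 0" "C1 \<ge> 0" "C2 \<ge> 0" unfolding C1_def C2_def using c(1) K(1) by (auto intro!: add_nonneg_pos)
  ultimately show ?thesis
  proof (intro that[of c "C1 + C2 + K"])
    fix \<phi>
    show "Lq \<phi> \<le> C1 + C2 + K - c * sqn n \<phi>" using upper[of \<phi>] \<open>C2 \<ge> 0\<close> K(1) by simp
    show "\<bar>Lq \<phi>\<bar> \<le> (C1 + C2 + K) * (1 + sqn n \<phi>)"
      by (rule order_trans[OF \<open>\<bar>Lq \<phi>\<bar> \<le> C2 * (1 + sqn n \<phi>)\<close>])
         (use sqn_nonneg[of n \<phi>] K(1) \<open>C1 \<ge> 0\<close> in \<open>auto intro!: mult_right_mono\<close>)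
    show "\<bar>dform \<gamma> n \<phi> \<phi>\<bar> \<le> (C1 + C2 + K) * sqn n \<phi>"
      by (rule order_trans[OF G])
         (use sqn_nonneg[of n \<phi>] K(1) \<open>C1 \<ge> 0\<close> \<open>C2 \<ge> 0\<close> in \<open>auto intro!: mult_right_mono\<close>)
  qed (use c in auto)
qed


text \<open>\<open>- R * E0 R\<close> is a Lyapunov function: coercivity of \<open>dform\<close> makes its image under the generator at
  most \<open>C - c * E1 R * sqn n\<close> with constants not depending on \<open>R\<close>.\<close>

lemma sqn_integrable: "integrable \<mu> (sqn n)"
proof -
  obtain c C where c: "c > 0" and C: "C > 0" and up: "\<And>\<phi>. Lq \<phi> \<le> C - c * sqn n \<phi>"
    and D: "\<And>\<phi>. \<bar>dform \<gamma> n \<phi> \<phi>\<bar> \<le> C * sqn n \<phi>"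
    using Lq_bounds by metis
  obtain B where B: "B > 0" "\<And>R \<phi>. R > 0 \<Longrightarrow> \<bar>E0 R \<phi>\<bar> \<le> B \<and> \<bar>E1 R \<phi>\<bar> \<le> B \<and> \<bar>E2 R \<phi>\<bar> \<le> B"
    using E_bounded by blast
  have E1_nonneg: "E1 R \<phi> \<ge> 0" for R \<phi>
    by (simp add: E1_def exp_flat_def exp_flat_deriv_def)
  let ?K = "B * C + B * (8 * C)"
  have int: "integrable \<mu> (\<lambda>\<phi>. E1 R \<phi> * sqn n \<phi>) \<and> c * (\<integral>\<phi>. E1 R \<phi> * sqn n \<phi> \<partial>\<mu>) \<le> ?K" if R: "R > 0" for R
  proof
    let ?T = "\<lambda>\<phi>. (- E1 R \<phi> / R) * Lq \<phi> + (E2 R \<phi> / R\<^sup>2) * (4 * dform \<gamma> n \<phi> \<phi>)"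
    have alg: "cutoff_alg n R (E0 R)" unfolding E0_def[abs_def] by (rule cutoff_alg.cut)
    have T: "integrable \<mu> ?T" "(\<integral>\<phi>. ?T \<phi> \<partial>\<mu>) = 0"
      using jet_gen_integral_zero[OF alg jet_cut R E_eq_0(1)[OF R]] unfolding jet_gen_cut by auto
    show i: "integrable \<mu> (\<lambda>\<phi>. E1 R \<phi> * sqn n \<phi>)"
    proof (rule integrable_const_bound[of _ "B * (2 * R)"])
      have "norm (E1 R \<phi> * sqn n \<phi>) \<le> B * (2 * R)" for \<phi>
      proof (cases "sqn n \<phi> \<ge> 2 * R")
        case True
        then show ?thesis using E_eq_0[OF R True] B(1) R by simp
      next
        case False
        then show ?thesis using B(2)[OF R, of \<phi>] sqn_nonneg[of n \<phi>]
          unfolding real_norm_def abs_mult by (intro mult_mono) auto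
      qed
      then show "AE \<phi> in \<mu>. norm (E1 R \<phi> * sqn n \<phi>) \<le> B * (2 * R)" by simp
    qed measurable
    have "c * (E1 R \<phi> * sqn n \<phi>) \<le> R * ?T \<phi> + ?K" for \<phi>
    proof -
      have "E1 R \<phi> * Lq \<phi> \<le> E1 R \<phi> * (C - c * sqn n \<phi>)"
        by (rule mult_left_mono[OF up E1_nonneg])
      moreover have "E1 R \<phi> * C \<le> B * C"
        using B(2)[OF R, of \<phi>] C by (intro mult_right_mono) auto
      \<comment> \<open>On the support of \<open>E2 R\<close> one has
        \<open>sqn n \<phi> \<le> 2 * R\<close>, so the quadratic growth of the form is absorbed by
        the factor 1/R.\<close>
      moreover have "\<bar>(E2 R \<phi> / R) * (4 * dform \<gamma> n \<phi> \<phi>)\<bar> \<le> B * (8 * C)"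
      proof (cases "sqn n \<phi> \<ge> 2 * R")
        case True
        then show ?thesis using E_eq_0[OF R True] B(1) C by simp
      next
        case False
        have "\<bar>4 * dform \<gamma> n \<phi> \<phi>\<bar> \<le> 4 * (C * (2 * R))"
        proof -
          have "C * sqn n \<phi> \<le> C * (2 * R)" using C False by (intro mult_left_mono) auto
          then show ?thesis using D[of \<phi>] unfolding abs_mult by linarith
        qed
        then have "\<bar>E2 R \<phi>\<bar> * \<bar>4 * dform \<gamma> n \<phi> \<phi>\<bar> \<le> B * (4 * (C * (2 * R)))"
          using B(2)[OF R, of \<phi>] B(1) by (intro mult_mono) auto
        then show ?thesis using R by (simp add: abs_mult field_simps)
      qed
      moreover have "R * ?T \<phi> = - (E1 R \<phi> * Lq \<phi>) + (E2 R \<phi> / R) * (4 * dform \<gamma> n \<phi> \<phi>)"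
        using R by (simp add: field_simps power2_eq_square)
      moreover have "c * (E1 R \<phi> * sqn n \<phi>) = E1 R \<phi> * (c * sqn n \<phi>)" by simp
      ultimately show ?thesis unfolding right_diff_distrib by linarith
    qed
    then have "(\<integral>\<phi>. c * (E1 R \<phi> * sqn n \<phi>) \<partial>\<mu>) \<le> (\<integral>\<phi>. R * ?T \<phi> + ?K \<partial>\<mu>)"
      using i T(1) by (intro integral_mono) auto
    also have "\<dots> = ?K"
      using T by (subst Bochner_Integration.integral_add) (auto simp: prob_space)
    finally show "c * (\<integral>\<phi>. E1 R \<phi> * sqn n \<phi> \<partial>\<mu>) \<le> ?K" by simp
  qed
  \<comment> \<open>The limit of \<open>E1 R\<close> as \<open>R\<close> grows: the argument of the
    profile tends to 2.\<close>
  define e where "e = exp_flat (exp_flat_deriv 1) 2"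
  have e: "e > 0" by (simp add: e_def exp_flat_def exp_flat_deriv_def)
  have lim: "(\<lambda>k. E1 (real (Suc k)) \<phi> * sqn n \<phi>) \<longlonglongrightarrow> e * sqn n \<phi>" for \<phi>
  proof -
    have "(\<lambda>k. 2 - sqn n \<phi> / real (Suc k)) \<longlonglongrightarrow> 2 - 0"
      by (intro tendsto_intros) (rule LIMSEQ_Suc[OF lim_const_over_n])
    moreover have "isCont (exp_flat (exp_flat_deriv 1)) 2"
      using exp_flat_has_derivative by (rule DERIV_isCont)
    ultimately have "(\<lambda>k. E1 (real (Suc k)) \<phi>) \<longlonglongrightarrow> e"
      unfolding E1_def e_def by (intro isCont_tendsto_compose[of 2 "exp_flat (exp_flat_deriv 1)"]) simp_all
    then show ?thesis by (intro tendsto_intros)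
  qed
  \<comment> \<open>Fatou's lemma along the radii k + 1 turns the bound uniform in \<open>R\<close>
    into integrability.\<close>
  have "(\<integral>\<^sup>+\<phi>. ennreal (e * sqn n \<phi>) \<partial>\<mu>) = (\<integral>\<^sup>+\<phi>. liminf (\<lambda>k. ennreal (E1 (real (Suc k)) \<phi> * sqn n \<phi>)) \<partial>\<mu>)"
    using lim by (intro nn_integral_cong lim_imp_Liminf[symmetric] tendsto_ennrealI) auto
  also have "\<dots> \<le> liminf (\<lambda>k. \<integral>\<^sup>+\<phi>. ennreal (E1 (real (Suc k)) \<phi> * sqn n \<phi>) \<partial>\<mu>)"
    by (rule nn_integral_liminf) measurable
  also have "\<dots> \<le> liminf (\<lambda>k::nat. ennreal (?K / c))"
  proof (intro Liminf_mono always_eventually allI)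
    fix k
    have "(\<integral>\<^sup>+\<phi>. ennreal (E1 (real (Suc k)) \<phi> * sqn n \<phi>) \<partial>\<mu>) = ennreal (\<integral>\<phi>. E1 (real (Suc k)) \<phi> * sqn n \<phi> \<partial>\<mu>)"
      using int[of "real (Suc k)"] E1_nonneg sqn_nonneg by (intro nn_integral_eq_integral) auto
    also have "\<dots> \<le> ennreal (?K / c)"
      using int[of "real (Suc k)"] c by (intro ennreal_leI) (auto simp: field_simps)
    finally show "(\<integral>\<^sup>+\<phi>. ennreal (E1 (real (Suc k)) \<phi> * sqn n \<phi>) \<partial>\<mu>) \<le> ennreal (?K / c)" .
  qed
  also have "\<dots> < \<infinity>" by (simp add: Liminf_const)
  finally have "integrable \<mu> (\<lambda>\<phi>. e * sqn n \<phi>)"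
    using e sqn_nonneg by (intro integrableI_nonneg) auto
  then show ?thesis using e by simp
qed

text \<open>Extends the stationarity identity from compact support to quadratic growth. The cut-off
  identity for \<open>V * E0 R\<close> is dominated by a multiple of \<open>1 + sqn n\<close>, which
  \<open>sqn_integrable\<close> makes integrable. The gradient may grow only linearly, so that the
  cross term with the gradient of the cutoff stays of quadratic order.\<close>

lemma moment_identity:
  assumes alg: "\<And>R. cutoff_alg n R V" and j: "jet n V d h" and A: "A \<ge> 0"
    and V: "\<And>\<phi>. \<bar>V \<phi>\<bar> \<le> A * (1 + sqn n \<phi>)"
    and d: "\<And>\<phi> x. x \<in> sites n \<Longrightarrow> \<bar>d x \<phi>\<bar> \<le> A * (1 + sqrt (sqn n \<phi>))"
    and L: "\<And>\<phi>. \<bar>jet_gen \<gamma> \<Phi>l \<Phi>r n \<phi> (\<lambda>x. d x \<phi>) (\<lambda>x y. h x y \<phi>)\<bar> \<le> A * (1 + sqn n \<phi>)"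
  shows "(\<integral>\<phi>. jet_gen \<gamma> \<Phi>l \<Phi>r n \<phi> (\<lambda>x. d x \<phi>) (\<lambda>x y. h x y \<phi>) \<partial>\<mu>) = 0"
proof -
  let ?LV = "\<lambda>\<phi>. jet_gen \<gamma> \<Phi>l \<Phi>r n \<phi> (\<lambda>x. d x \<phi>) (\<lambda>x y. h x y \<phi>)"
  obtain C where C: "C > 0" and Lq: "\<And>\<phi>. \<bar>Lq \<phi>\<bar> \<le> C * (1 + sqn n \<phi>)"
    and D: "\<And>\<phi>. \<bar>dform \<gamma> n \<phi> \<phi>\<bar> \<le> C * sqn n \<phi>"
    using Lq_bounds by metis
  obtain K where K: "K > 0" "\<And>a b A B. (\<And>x. x \<in> sites n \<Longrightarrow> \<bar>a x\<bar> \<le> A) \<Longrightarrow> (\<And>x. x \<in> sites n \<Longrightarrow> \<bar>b x\<bar> \<le> B) \<Longrightarrow>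
     \<bar>dform \<gamma> n a b\<bar> \<le> K * (A * B)" using dform_bound[OF n \<gamma>] by blast
  obtain B where B: "B > 0" "\<And>R \<phi>. R > 0 \<Longrightarrow> \<bar>E0 R \<phi>\<bar> \<le> B \<and> \<bar>E1 R \<phi>\<bar> \<le> B \<and> \<bar>E2 R \<phi>\<bar> \<le> B"
    using E_bounded by blast
  let ?G = "\<lambda>\<phi>. dform \<gamma> n (\<lambda>x. d x \<phi>) (\<lambda>x. 2 * \<phi> x)"
  have G: "\<bar>?G \<phi>\<bar> \<le> K * (A * (4 * (1 + sqn n \<phi>)))" for \<phi>
  proof -
    let ?s = "sqrt (sqn n \<phi>)"
    have s: "?s \<ge> 0" "?s * ?s = sqn n \<phi>" using sqn_nonneg[of n \<phi>] by auto
    have "\<bar>?G \<phi>\<bar> \<le> K * (A * (1 + ?s) * (2 * ?s))"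
      using d abs_coord_le_sqrt_sqn[of _ n \<phi>] by (intro K(2)) (auto simp: abs_mult)
    also have "\<dots> = K * (A * ((1 + ?s) * (2 * ?s)))" by (simp add: mult_ac)
    also have "\<dots> \<le> K * (A * (4 * (1 + sqn n \<phi>)))"
    proof (intro mult_left_mono)
      show "(1 + ?s) * (2 * ?s) \<le> 4 * (1 + sqn n \<phi>)"
        using zero_le_power2[of "?s - 1"] s by (simp add: power2_eq_square algebra_simps)
    qed (use K(1) A in auto)
    finally show ?thesis .
  qed
  \<comment> \<open>The generator applied to \<open>V * E0 R\<close> by the product rule. As
    \<open>R\<close> grows, the terms with a derivative of the cutoff disappear and only the middle
    one remains.\<close>
  define S where "S R \<phi> = V \<phi> * ((- E1 R \<phi> / R) * Lq \<phi> + (E2 R \<phi> / R\<^sup>2) * (4 * dform \<gamma> n \<phi> \<phi>))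
     + E0 R \<phi> * ?LV \<phi> + 2 * ((- E1 R \<phi> / R) * ?G \<phi>)" for R \<phi>
  have S: "integrable \<mu> (S R)" "(\<integral>\<phi>. S R \<phi> \<partial>\<mu>) = 0" if R: "R > 0" for R
  proof -
    have "cutoff_alg n R (E0 R)" unfolding E0_def[abs_def] by (rule cutoff_alg.cut)
    then have alg': "cutoff_alg n R (\<lambda>\<phi>. V \<phi> * E0 R \<phi>)" using alg by (intro cutoff_alg.mult)
    have "V \<phi> * E0 R \<phi> = 0" if "sqn n \<phi> \<ge> 2 * R" for \<phi> using E_eq_0[OF R that] by simp
    note * = jet_gen_integral_zero[OF alg' jet_mult[OF j jet_cut] R this]
    have eq: "jet_gen \<gamma> \<Phi>l \<Phi>r n \<phi> (\<lambda>x. V \<phi> * ((- E1 R \<phi> / R) * (2 * \<phi> x)) + E0 R \<phi> * d x \<phi>)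
      (\<lambda>x y. V \<phi> * ((- E1 R \<phi> / R) * (if x = y then 2 else 0) + (E2 R \<phi> / R\<^sup>2) * ((2 * \<phi> x) * (2 * \<phi> y)))
         + E0 R \<phi> * h x y \<phi> + (d x \<phi> * ((- E1 R \<phi> / R) * (2 * \<phi> y)) + ((- E1 R \<phi> / R) * (2 * \<phi> x)) * d y \<phi>)) = S R \<phi>" for \<phi>
      unfolding S_def jet_gen_mult jet_gen_cut by (simp only: dform_scale_right[of _ _ _ "- E1 R \<phi> / R"])
    show "integrable \<mu> (S R)" "(\<integral>\<phi>. S R \<phi> \<partial>\<mu>) = 0" using * unfolding eq by auto
  qed
  let ?W = "A * (B * (C * 3)) + A * (B * (C * 8)) + B * A + 2 * (B * (K * (A * 4)))"
  have bound: "\<bar>S R \<phi>\<bar> \<le> ?W * (1 + sqn n \<phi>)" if R: "R \<ge> 1" for R \<phi>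
  proof (cases "sqn n \<phi> \<ge> 2 * R")
    case True
    have "S R \<phi> = 0" using E_eq_0[OF _ True] R by (simp add: S_def)
    moreover have "?W \<ge> 0" using A B(1) C K(1) by simp
    ultimately show ?thesis using sqn_nonneg[of n \<phi>] by simp
  next
    case False
    define q where "q = sqn n \<phi>"
    have q: "0 \<le> q" "q < 2 * R" using False sqn_nonneg[of n \<phi>] by (auto simp: q_def)
    have E: "\<bar>E0 R \<phi>\<bar> \<le> B" "\<bar>E1 R \<phi>\<bar> \<le> B" "\<bar>E2 R \<phi>\<bar> \<le> B" using B(2)[of R \<phi>] R by auto
    \<comment> \<open>The 3 comes from \<open>q < 2 * R\<close> and \<open>R \<ge> 1\<close>, which
      give \<open>(1 + q) / R \<le> 3\<close>. The constants of \<open>1\<close> to \<open>4\<close>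
      add up to \<open>?W\<close>.\<close>
    have 1: "\<bar>V \<phi> * ((- E1 R \<phi> / R) * Lq \<phi>)\<bar> \<le> A * (B * (C * 3)) * (1 + q)"
    proof -
      have "\<bar>Lq \<phi> / R\<bar> \<le> C * (1 + q) / R"
        using Lq[of \<phi>] R by (simp add: q_def divide_right_mono)
      also have "\<dots> \<le> C * 3" using q R C mult_left_mono[of "1 + q" "3 * R" C] by (simp add: field_simps)
      finally have "\<bar>E1 R \<phi>\<bar> * \<bar>Lq \<phi> / R\<bar> \<le> B * (C * 3)" using E B(1) by (intro mult_mono) auto
      then have "\<bar>V \<phi>\<bar> * (\<bar>E1 R \<phi>\<bar> * \<bar>Lq \<phi> / R\<bar>) \<le> (A * (1 + q)) * (B * (C * 3))"
        using V[of \<phi>] A q by (intro mult_mono[of "\<bar>V \<phi>\<bar>"]) (auto simp: q_def)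
      then show ?thesis by (simp add: abs_mult mult_ac)
    qed
    have 2: "\<bar>V \<phi> * ((E2 R \<phi> / R\<^sup>2) * (4 * dform \<gamma> n \<phi> \<phi>))\<bar> \<le> A * (B * (C * 8)) * (1 + q)"
    proof -
      have "\<bar>4 * dform \<gamma> n \<phi> \<phi> / R\<^sup>2\<bar> \<le> 4 * (C * q) / R\<^sup>2"
        using D[of \<phi>] by (simp add: q_def abs_mult divide_right_mono)
      also have "\<dots> \<le> 4 * (C * (2 * R)) / R\<^sup>2" using q C by (intro divide_right_mono) auto
      also have "\<dots> = C * 8 / R" using R by (simp add: power2_eq_square field_simps)
      also have "\<dots> \<le> C * 8" using R C by (simp add: field_simps)
      finally have "\<bar>E2 R \<phi>\<bar> * \<bar>4 * dform \<gamma> n \<phi> \<phi> / R\<^sup>2\<bar> \<le> B * (C * 8)" using E B(1) by (intro mult_mono) auto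
      then have "\<bar>V \<phi>\<bar> * (\<bar>E2 R \<phi>\<bar> * \<bar>4 * dform \<gamma> n \<phi> \<phi> / R\<^sup>2\<bar>) \<le> (A * (1 + q)) * (B * (C * 8))"
        using V[of \<phi>] A q by (intro mult_mono[of "\<bar>V \<phi>\<bar>"]) (auto simp: q_def)
      then show ?thesis by (simp add: abs_mult mult_ac)
    qed
    have 3: "\<bar>E0 R \<phi> * ?LV \<phi>\<bar> \<le> B * A * (1 + q)"
    proof -
      have "\<bar>E0 R \<phi>\<bar> * \<bar>?LV \<phi>\<bar> \<le> B * (A * (1 + q))"
        using E L[of \<phi>] B(1) by (intro mult_mono) (auto simp: q_def)
      then show ?thesis by (simp add: abs_mult mult_ac)
    qed
    have 4: "\<bar>2 * ((- E1 R \<phi> / R) * ?G \<phi>)\<bar> \<le> 2 * (B * (K * (A * 4))) * (1 + q)"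
    proof -
      have "\<bar>E1 R \<phi> / R\<bar> \<le> \<bar>E1 R \<phi>\<bar>"
        using R mult_left_mono[of 1 R "\<bar>E1 R \<phi>\<bar>"] by (simp add: field_simps)
      then have "\<bar>E1 R \<phi> / R\<bar> * \<bar>?G \<phi>\<bar> \<le> B * (K * (A * (4 * (1 + q))))"
        using G[of \<phi>] B(1) E(2) by (intro mult_mono) (auto simp: q_def)
      moreover have "\<bar>2 * ((- E1 R \<phi> / R) * ?G \<phi>)\<bar> = 2 * (\<bar>E1 R \<phi> / R\<bar> * \<bar>?G \<phi>\<bar>)"
        by (simp add: abs_mult)
      moreover have "2 * (B * (K * (A * 4))) * (1 + q) = 2 * (B * (K * (A * (4 * (1 + q)))))" by simp
      ultimately show ?thesis by linarith
    qed
    have "S R \<phi> = V \<phi> * ((- E1 R \<phi> / R) * Lq \<phi>) + V \<phi> * ((E2 R \<phi> / R\<^sup>2) * (4 * dform \<gamma> n \<phi> \<phi>))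
      + E0 R \<phi> * ?LV \<phi> + 2 * ((- E1 R \<phi> / R) * ?G \<phi>)"
      by (simp only: S_def distrib_left)
    then show ?thesis
      unfolding q_def[symmetric] distrib_right using 1 2 3 4 by linarith
  qed
  \<comment> \<open>The cutoff is not normalised: it tends to this positive value instead of 1, and
    the factor is divided out at the end.\<close>
  define e where "e = exp_flat 1 2"
  have e: "e > 0" by (simp add: e_def exp_flat_def)
  have to2: "(\<lambda>k. 2 - sqn n \<phi> / real (Suc k)) \<longlonglongrightarrow> 2" for \<phi>
    using tendsto_diff[OF tendsto_const LIMSEQ_Suc[OF lim_const_over_n]] by force
  have cont: "isCont (exp_flat p) t" for p t
    using exp_flat_has_derivative by (rule DERIV_isCont)
  have lim: "(\<lambda>k. S (real (Suc k)) \<phi>) \<longlonglongrightarrow> e * ?LV \<phi>" for \<phi>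
  proof -
    note t = isCont_tendsto_compose[OF cont to2]
    have 0: "(\<lambda>k. 1 / real (Suc k)) \<longlonglongrightarrow> 0" by (rule LIMSEQ_Suc[OF lim_const_over_n])
    have E1: "(\<lambda>k. - E1 (real (Suc k)) \<phi> / real (Suc k)) \<longlonglongrightarrow> 0"
      using tendsto_mult[OF tendsto_minus[OF t[of "exp_flat_deriv 1" \<phi>]] 0] by (simp add: E1_def)
    have E2: "(\<lambda>k. E2 (real (Suc k)) \<phi> / (real (Suc k))\<^sup>2) \<longlonglongrightarrow> 0"
      using tendsto_mult[OF t[of "exp_flat_deriv (exp_flat_deriv 1)" \<phi>] tendsto_mult[OF 0 0]]
      by (simp add: E2_def power2_eq_square)
    have E0: "(\<lambda>k. E0 (real (Suc k)) \<phi>) \<longlonglongrightarrow> e" using t[of 1 \<phi>] by (simp add: E0_def e_def)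
    have "(\<lambda>k. S (real (Suc k)) \<phi>) \<longlonglongrightarrow> V \<phi> * (0 * Lq \<phi> + 0 * (4 * dform \<gamma> n \<phi> \<phi>)) + e * ?LV \<phi> + 2 * (0 * ?G \<phi>)"
      unfolding S_def by (intro tendsto_add tendsto_mult tendsto_const E0 E1 E2)
    then show ?thesis by simp
  qed
  have meas: "(\<lambda>\<phi>. e * ?LV \<phi>) \<in> borel_measurable \<mu>"
    by (rule borel_measurable_LIMSEQ_real[OF lim]) (use S(1) in auto)
  have "(\<lambda>k. \<integral>\<phi>. S (real (Suc k)) \<phi> \<partial>\<mu>) \<longlonglongrightarrow> (\<integral>\<phi>. e * ?LV \<phi> \<partial>\<mu>)"
  proof (rule integral_dominated_convergence[where w = "\<lambda>\<phi>. ?W * (1 + sqn n \<phi>)"])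
    show "integrable \<mu> (\<lambda>\<phi>. ?W * (1 + sqn n \<phi>))" using sqn_integrable by auto
    show "AE \<phi> in \<mu>. (\<lambda>k. S (real (Suc k)) \<phi>) \<longlonglongrightarrow> e * ?LV \<phi>" using lim by simp
    show "AE \<phi> in \<mu>. norm (S (real (Suc k)) \<phi>) \<le> ?W * (1 + sqn n \<phi>)" for k
      using bound[of "real (Suc k)"] by simp
  qed (use meas S(1) in auto)
  moreover have "(\<integral>\<phi>. S (real (Suc k)) \<phi> \<partial>\<mu>) = 0" for k by (rule S(2)) simp
  ultimately have "(\<lambda>k. 0) \<longlonglongrightarrow> (\<integral>\<phi>. e * ?LV \<phi> \<partial>\<mu>)" by (simp only:)
  then have "(\<integral>\<phi>. e * ?LV \<phi> \<partial>\<mu>) = 0"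
    using LIMSEQ_unique tendsto_const by blast
  then show ?thesis using e by simp
qed


lemma coord_product_integrable:
  assumes "x \<in> sites n" "y \<in> sites n"
  shows "integrable \<mu> (\<lambda>\<phi>. \<phi> x * \<phi> y)"
proof (rule Bochner_Integration.integrable_bound[OF sqn_integrable])
  have "\<bar>\<phi> x * \<phi> y\<bar> \<le> sqn n \<phi>" for \<phi>
  proof -
    have "\<bar>\<phi> x\<bar> * \<bar>\<phi> y\<bar> \<le> sqrt (sqn n \<phi>) * sqrt (sqn n \<phi>)"
      by (intro mult_mono abs_coord_le_sqrt_sqn assms) (auto simp: sqn_nonneg)
    then show ?thesis by (simp add: abs_mult sqn_nonneg)
  qed
  then show "AE \<phi> in \<mu>. norm (\<phi> x * \<phi> y) \<le> norm (sqn n \<phi>)" by (simp add: sqn_nonneg)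
qed (use assms in measurable)

lemma coord_integrable:
  assumes "x \<in> sites n"
  shows "integrable \<mu> (\<lambda>\<phi>. \<phi> x)"
proof (rule Bochner_Integration.integrable_bound[of _ "\<lambda>\<phi>. 1 + \<phi> x * \<phi> x"])
  show "integrable \<mu> (\<lambda>\<phi>. 1 + \<phi> x * \<phi> x)" using coord_product_integrable[OF assms assms] by auto
  have "\<bar>t\<bar> \<le> 1 + t * t" for t :: real
    using zero_le_power2[of "\<bar>t\<bar> - 1"] by (simp add: power2_eq_square algebra_simps)
  then show "AE \<phi> in \<mu>. norm (\<phi> x) \<le> norm (1 + \<phi> x * \<phi> x)" by (simp add: abs_of_nonneg)
qed (use assms in measurable)

section \<open>Mean and covariance of the invariant measure\<close>

definition mean :: "nat \<Rightarrow> real" where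
  "mean x = (\<integral>\<phi>. \<phi> x \<partial>\<mu>)"

definition cov :: "nat \<Rightarrow> nat \<Rightarrow> real" where
  "cov x y = (\<integral>\<phi>. \<phi> x * \<phi> y \<partial>\<mu>) - mean x * mean y"

abbreviation "lin k \<phi> \<equiv> (\<Sum>x\<in>sites n. k x * \<phi> x)"

abbreviation "source k \<equiv> \<Phi>l * k 1 + \<Phi>r * k (n - 1)"

lemma cutoff_alg_lin: "cutoff_alg n R (lin k)"
  by (intro cutoff_alg_sum cutoff_alg.intros) auto

lemma lin_bounds:
  obtains A where "A > 0" "\<And>\<phi>. \<bar>lin k \<phi>\<bar> \<le> A * sqrt (sqn n \<phi>)" "\<And>\<phi>. \<bar>dform \<gamma> n k \<phi>\<bar> \<le> A * sqrt (sqn n \<phi>)"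
    "\<And>x. x \<in> sites n \<Longrightarrow> \<bar>k x\<bar> \<le> A" "\<bar>source k\<bar> \<le> A"
proof -
  obtain K where K: "K > 0" "\<And>a b A B. (\<And>x. x \<in> sites n \<Longrightarrow> \<bar>a x\<bar> \<le> A) \<Longrightarrow> (\<And>x. x \<in> sites n \<Longrightarrow> \<bar>b x\<bar> \<le> B) \<Longrightarrow>
     \<bar>dform \<gamma> n a b\<bar> \<le> K * (A * B)" using dform_bound[OF n \<gamma>] by blast
  define M where "M = (\<Sum>x\<in>sites n. \<bar>k x\<bar>)"
  have M: "\<bar>k x\<bar> \<le> M" if "x \<in> sites n" for x unfolding M_def using that by (intro member_le_sum) auto
  have M0: "M \<ge> 0" unfolding M_def by (intro sum_nonneg) auto
  let ?A = "M + K * M + \<bar>source k\<bar> + 1"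
  have lin: "\<bar>lin k \<phi>\<bar> \<le> M * sqrt (sqn n \<phi>)" for \<phi>
    unfolding M_def sum_distrib_right using abs_coord_le_sqrt_sqn
    by (intro order_trans[OF sum_abs] sum_mono) (auto simp: abs_mult intro!: mult_left_mono)
  have D: "\<bar>dform \<gamma> n k \<phi>\<bar> \<le> (K * M) * sqrt (sqn n \<phi>)" for \<phi>
    using K(2)[of k M \<phi> "sqrt (sqn n \<phi>)"] M abs_coord_le_sqrt_sqn by (simp add: mult_ac)
  show ?thesis
  proof (rule that)
    show "?A > 0" using M0 K(1) by (auto intro!: add_nonneg_pos)
    show "\<bar>lin k \<phi>\<bar> \<le> ?A * sqrt (sqn n \<phi>)" for \<phi>
      by (rule order_trans[OF lin mult_right_mono]) (use M0 K(1) sqn_nonneg in auto)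
    show "\<bar>dform \<gamma> n k \<phi>\<bar> \<le> ?A * sqrt (sqn n \<phi>)" for \<phi>
      by (rule order_trans[OF D mult_right_mono]) (use M0 K(1) sqn_nonneg in auto)
    have KM: "K * M \<ge> 0" using K(1) M0 by simp
    show "\<bar>k x\<bar> \<le> ?A" if "x \<in> sites n" for x
      using M[OF that] KM by linarith
    show "\<bar>source k\<bar> \<le> ?A" using M0 KM by linarith
  qed
qed

lemma sqrt_le_one_plus: "0 \<le> t \<Longrightarrow> sqrt t \<le> 1 + t"
  using zero_le_power2[of "sqrt t - 1"] by (simp add: power2_eq_square algebra_simps)

lemma dform_expectation: "integrable \<mu> (dform \<gamma> n k)" "(\<integral>\<phi>. dform \<gamma> n k \<phi> \<partial>\<mu>) = dform \<gamma> n k mean"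
proof -
  have eq: "dform \<gamma> n k = (\<lambda>\<phi>. \<Sum>z\<in>sites n. \<phi> z * dform \<gamma> n k (\<lambda>x. of_bool (x = z)))"
    by (rule ext) (rule dform_expand[OF n])
  show "integrable \<mu> (dform \<gamma> n k)"
    by (subst eq) (intro Bochner_Integration.integrable_sum integrable_mult_left coord_integrable)
  show "(\<integral>\<phi>. dform \<gamma> n k \<phi> \<partial>\<mu>) = dform \<gamma> n k mean"
    by (subst eq, subst Bochner_Integration.integral_sum)
       (auto intro!: coord_integrable integrable_mult_left simp: dform_expand[OF n, of _ k mean] mean_def)
qed

text \<open>Stationarity of the linear function \<open>lin k\<close>. As \<open>k\<close> is
  arbitrary, this is the discrete stationary problem in weak form, later recorded as
  \<open>discrete_harmonic\<close>.\<close>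

lemma mean_equation: "dform \<gamma> n k mean = source k"
proof -
  obtain A where A: "A > 0" "\<And>\<phi>. \<bar>lin k \<phi>\<bar> \<le> A * sqrt (sqn n \<phi>)" "\<And>\<phi>. \<bar>dform \<gamma> n k \<phi>\<bar> \<le> A * sqrt (sqn n \<phi>)"
    "\<And>x. x \<in> sites n \<Longrightarrow> \<bar>k x\<bar> \<le> A" "\<bar>source k\<bar> \<le> A" by (rule lin_bounds[of k]) blast
  have s: "A * sqrt (sqn n \<phi>) \<le> A * (1 + sqn n \<phi>)" for \<phi>
    using A(1) sqrt_le_one_plus[OF sqn_nonneg] by (intro mult_left_mono) auto
  have "(\<integral>\<phi>. jet_gen \<gamma> \<Phi>l \<Phi>r n \<phi> (\<lambda>x. k x) (\<lambda>x y. 0) \<partial>\<mu>) = 0"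
  proof (rule moment_identity[OF cutoff_alg_lin jet_linear, of "2 * A"])
    fix \<phi> :: config
    have q: "A \<le> A * (1 + sqn n \<phi>)" using A(1) sqn_nonneg[of n \<phi>] by simp
    show "\<bar>lin k \<phi>\<bar> \<le> 2 * A * (1 + sqn n \<phi>)"
      using A(2)[of \<phi>] s[of \<phi>] A(1) q by linarith
    show "\<bar>jet_gen \<gamma> \<Phi>l \<Phi>r n \<phi> k (\<lambda>x y. 0)\<bar> \<le> 2 * A * (1 + sqn n \<phi>)"
      unfolding jet_gen_linear using A(3)[of \<phi>] A(5) s[of \<phi>] q by linarith
    fix x assume "x \<in> sites n"
    then have "\<bar>k x\<bar> \<le> A * 1" using A(4) by simp
    also have "A * 1 \<le> 2 * A * (1 + sqrt (sqn n \<phi>))" using A(1) sqn_nonneg[of n \<phi>] by (simp add: algebra_simps)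
    finally show "\<bar>k x\<bar> \<le> 2 * A * (1 + sqrt (sqn n \<phi>))" .
  qed (use A in auto)
  then show ?thesis
    unfolding jet_gen_linear using dform_expectation by (simp add: prob_space)
qed

text \<open>By \<open>mean_equation\<close> the second factor is \<open>dform\<close> of
  \<open>k\<close> against \<open>mean\<close> minus \<phi>. It is centred, so the expectation of
  the product involves covariances only.\<close>

lemma lin_times_dform_expectation:
  "integrable \<mu> (\<lambda>\<phi>. lin h \<phi> * (source k - dform \<gamma> n k \<phi>))"
  "(\<integral>\<phi>. lin h \<phi> * (source k - dform \<gamma> n k \<phi>) \<partial>\<mu>) = - dform \<gamma> n k (\<lambda>z. \<Sum>x\<in>sites n. h x * cov x z)"
proof -
  let ?e = "\<lambda>z. dform \<gamma> n k (\<lambda>x. of_bool (x = z))"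
  have eq: "lin h \<phi> * (source k - dform \<gamma> n k \<phi>) =
     (\<Sum>x\<in>sites n. \<Sum>z\<in>sites n. h x * ?e z * (mean z * \<phi> x - \<phi> x * \<phi> z))" for \<phi>
  proof -
    have "source k - dform \<gamma> n k \<phi> = (\<Sum>z\<in>sites n. (mean z - \<phi> z) * ?e z)"
      unfolding mean_equation[of k, symmetric] dform_expand[OF n, of _ k mean] dform_expand[OF n, of _ k \<phi>]
      by (simp add: sum_subtractf left_diff_distrib)
    then show ?thesis
      by (simp only: sum_product) (intro sum.cong refl, simp add: algebra_simps)
  qed
  have int: "integrable \<mu> (\<lambda>\<phi>. h x * ?e z * (mean z * \<phi> x - \<phi> x * \<phi> z))" if "x \<in> sites n" "z \<in> sites n" for x z
    using that coord_integrable coord_product_integrable by auto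
  show "integrable \<mu> (\<lambda>\<phi>. lin h \<phi> * (source k - dform \<gamma> n k \<phi>))"
    unfolding eq using int by (intro Bochner_Integration.integrable_sum) auto
  have "(\<integral>\<phi>. lin h \<phi> * (source k - dform \<gamma> n k \<phi>) \<partial>\<mu>) =
      (\<Sum>x\<in>sites n. \<Sum>z\<in>sites n. (\<integral>\<phi>. h x * ?e z * (mean z * \<phi> x - \<phi> x * \<phi> z) \<partial>\<mu>))"
    unfolding eq using int
    by (subst Bochner_Integration.integral_sum, intro Bochner_Integration.integrable_sum, simp,
        intro sum.cong refl, subst Bochner_Integration.integral_sum) auto
  also have "\<dots> = (\<Sum>x\<in>sites n. \<Sum>z\<in>sites n. - (h x * cov x z * ?e z))"
  proof (intro sum.cong refl)
    fix x z assume xz: "x \<in> sites n" "z \<in> sites n"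
    have "(\<integral>\<phi>. mean z * \<phi> x - \<phi> x * \<phi> z \<partial>\<mu>) = mean z * mean x - (\<integral>\<phi>. \<phi> x * \<phi> z \<partial>\<mu>)"
      using xz coord_integrable coord_product_integrable by (subst Bochner_Integration.integral_diff) (auto simp: mean_def)
    also have "\<dots> = - cov x z" by (simp add: cov_def)
    finally show "(\<integral>\<phi>. h x * ?e z * (mean z * \<phi> x - \<phi> x * \<phi> z) \<partial>\<mu>) = - (h x * cov x z * ?e z)"
      by simp
  qed
  also have "\<dots> = - (\<Sum>z\<in>sites n. (\<Sum>x\<in>sites n. h x * cov x z) * ?e z)"
    by (subst sum.swap) (simp add: sum_negf sum_distrib_right)
  also have "\<dots> = - dform \<gamma> n k (\<lambda>z. \<Sum>x\<in>sites n. h x * cov x z)"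
    by (subst (2) dform_expand[OF n]) simp
  finally show "(\<integral>\<phi>. lin h \<phi> * (source k - dform \<gamma> n k \<phi>) \<partial>\<mu>) = - dform \<gamma> n k (\<lambda>z. \<Sum>x\<in>sites n. h x * cov x z)" .
qed

text \<open>Stationarity of the product \<open>lin h * lin k\<close>. In matrix form this is the
  Lyapunov equation for the covariance, whose right-hand side \<open>2 * A\<close> is the carre du
  champ.\<close>

lemma cov_equation:
  "dform \<gamma> n k (\<lambda>z. \<Sum>x\<in>sites n. h x * cov x z) + dform \<gamma> n h (\<lambda>z. \<Sum>x\<in>sites n. k x * cov x z) = 2 * dform \<gamma> n h k"
proof -
  obtain A where A: "A > 0" "\<And>\<phi>. \<bar>lin k \<phi>\<bar> \<le> A * sqrt (sqn n \<phi>)" "\<And>\<phi>. \<bar>dform \<gamma> n k \<phi>\<bar> \<le> A * sqrt (sqn n \<phi>)"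
    "\<And>x. x \<in> sites n \<Longrightarrow> \<bar>k x\<bar> \<le> A" "\<bar>source k\<bar> \<le> A" by (rule lin_bounds[of k]) blast
  obtain A' where A': "A' > 0" "\<And>\<phi>. \<bar>lin h \<phi>\<bar> \<le> A' * sqrt (sqn n \<phi>)" "\<And>\<phi>. \<bar>dform \<gamma> n h \<phi>\<bar> \<le> A' * sqrt (sqn n \<phi>)"
    "\<And>x. x \<in> sites n \<Longrightarrow> \<bar>h x\<bar> \<le> A'" "\<bar>source h\<bar> \<le> A'" by (rule lin_bounds[of h]) blast
  define W where "W = 4 * (A * A') + \<bar>2 * dform \<gamma> n h k\<bar>"
  have AA: "A * A' > 0" "W \<ge> 4 * (A * A')" "W \<ge> 2 * (A * A')" using A(1) A'(1) by (auto simp: W_def)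
  have L: "jet_gen \<gamma> \<Phi>l \<Phi>r n \<phi> (\<lambda>x. lin h \<phi> * k x + lin k \<phi> * h x)
      (\<lambda>x y. lin h \<phi> * 0 + lin k \<phi> * 0 + (h x * k y + k x * h y)) =
      lin h \<phi> * (source k - dform \<gamma> n k \<phi>) + lin k \<phi> * (source h - dform \<gamma> n h \<phi>) + 2 * dform \<gamma> n h k" for \<phi>
    by (simp only: jet_gen_mult jet_gen_linear)
  have "(\<integral>\<phi>. jet_gen \<gamma> \<Phi>l \<Phi>r n \<phi> (\<lambda>x. lin h \<phi> * k x + lin k \<phi> * h x)
      (\<lambda>x y. lin h \<phi> * 0 + lin k \<phi> * 0 + (h x * k y + k x * h y)) \<partial>\<mu>) = 0"
  proof (rule moment_identity[OF cutoff_alg.mult[OF cutoff_alg_lin cutoff_alg_lin] jet_mult[OF jet_linear jet_linear], of W])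
    fix \<phi> :: config
    define s where "s = sqrt (sqn n \<phi>)"
    have s: "s \<ge> 0" "s * s = sqn n \<phi>" by (auto simp: s_def sqn_nonneg)
    have s1: "2 * s \<le> 1 + sqn n \<phi>" using zero_le_power2[of "s - 1"] s by (simp add: power2_eq_square algebra_simps)
    note b = A(2,3)[of \<phi>, folded s_def] A'(2,3)[of \<phi>, folded s_def]
    have "\<bar>lin h \<phi> * lin k \<phi>\<bar> \<le> (A' * s) * (A * s)"
      unfolding abs_mult using b A(1) A'(1) s by (intro mult_mono) auto
    also have "\<dots> = (A * A') * sqn n \<phi>" by (simp add: s(2)[symmetric])
    also have "\<dots> \<le> W * (1 + sqn n \<phi>)"
      using AA sqn_nonneg[of n \<phi>] by (intro mult_mono) auto
    finally show "\<bar>lin h \<phi> * lin k \<phi>\<bar> \<le> W * (1 + sqn n \<phi>)" .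
    have t: "\<bar>lin u \<phi> * (source v - dform \<gamma> n v \<phi>)\<bar> \<le> (2 * (A * A')) * (1 + sqn n \<phi>)"
      if "\<bar>lin u \<phi>\<bar> \<le> B * s" "\<bar>dform \<gamma> n v \<phi>\<bar> \<le> B' * s" "\<bar>source v\<bar> \<le> B'" "B * B' = A * A'" "B > 0" "B' > 0" for u v B B'
    proof -
      have "\<bar>lin u \<phi> * (source v - dform \<gamma> n v \<phi>)\<bar> \<le> (B * s) * (B' + B' * s)"
        unfolding abs_mult using that s by (intro mult_mono) auto
      also have "\<dots> = (B * B') * (s + s * s)" by (simp add: algebra_simps)
      also have "\<dots> \<le> (A * A') * (2 * (1 + sqn n \<phi>))"
      proof -
        have "s + s * s \<le> 2 * (1 + sqn n \<phi>)" 
        proof -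
          have "a + q \<le> 2 * (1 + q)" if "0 \<le> a" "2 * a \<le> 1 + q" "0 \<le> q" for a q :: real
            using that by simp
          from this[OF s(1) s1 sqn_nonneg] show ?thesis unfolding s(2) .
        qed
        then show ?thesis unfolding that(4) using AA(1) by (intro mult_left_mono) auto
      qed
      finally show ?thesis by (simp add: algebra_simps)
    qed
    have 1: "\<bar>lin h \<phi> * (source k - dform \<gamma> n k \<phi>)\<bar> \<le> (2 * (A * A')) * (1 + sqn n \<phi>)"
      by (rule t[OF b(3) b(2) A(5) mult.commute A'(1) A(1)])
    have 2: "\<bar>lin k \<phi> * (source h - dform \<gamma> n h \<phi>)\<bar> \<le> (2 * (A * A')) * (1 + sqn n \<phi>)"
      by (rule t[OF b(1) b(4) A'(5) refl A(1) A'(1)])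
    have 3: "\<bar>2 * dform \<gamma> n h k\<bar> \<le> \<bar>2 * dform \<gamma> n h k\<bar> * (1 + sqn n \<phi>)"
      using sqn_nonneg[of n \<phi>] by (simp add: algebra_simps)
    have "W * (1 + sqn n \<phi>) = (2 * (A * A')) * (1 + sqn n \<phi>) + (2 * (A * A')) * (1 + sqn n \<phi>) + \<bar>2 * dform \<gamma> n h k\<bar> * (1 + sqn n \<phi>)"
      by (simp add: W_def algebra_simps)
    then show "\<bar>jet_gen \<gamma> \<Phi>l \<Phi>r n \<phi> (\<lambda>x. lin h \<phi> * k x + lin k \<phi> * h x)
      (\<lambda>x y. lin h \<phi> * 0 + lin k \<phi> * 0 + (h x * k y + k x * h y))\<bar> \<le> W * (1 + sqn n \<phi>)"
      unfolding L using 1 2 3 by linarith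
    fix x assume x: "x \<in> sites n"
    have "\<bar>lin h \<phi> * k x\<bar> \<le> (A' * s) * A" "\<bar>lin k \<phi> * h x\<bar> \<le> (A * s) * A'"
      unfolding abs_mult using b A(1) A'(1) s A(4)[OF x] A'(4)[OF x] by (intro mult_mono; simp)+
    then have "\<bar>lin h \<phi> * k x + lin k \<phi> * h x\<bar> \<le> (2 * (A * A')) * s" by (simp add: algebra_simps)
    also have "\<dots> \<le> W * (1 + s)" using AA s by (intro mult_mono) auto
    finally show "\<bar>lin h \<phi> * k x + lin k \<phi> * h x\<bar> \<le> W * (1 + sqrt (sqn n \<phi>))" by (simp add: s_def)
  qed (use AA in auto)
  then have "(\<integral>\<phi>. lin h \<phi> * (source k - dform \<gamma> n k \<phi>) + lin k \<phi> * (source h - dform \<gamma> n h \<phi>) + 2 * dform \<gamma> n h k \<partial>\<mu>) = 0"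
    unfolding L .
  then show ?thesis
    using lin_times_dform_expectation by (simp add: prob_space)
qed

lemma cov_eq: "x \<in> sites n \<Longrightarrow> y \<in> sites n \<Longrightarrow> cov x y = of_bool (x = y)"
proof -
  assume x: "x \<in> sites n" and y: "y \<in> sites n"
  define N where "N x y = cov x y - of_bool (x = y)" for x y
  have N: "dform \<gamma> n k (\<lambda>z. \<Sum>x\<in>sites n. h x * N x z) = dform \<gamma> n k (\<lambda>z. \<Sum>x\<in>sites n. h x * cov x z) - dform \<gamma> n k h" for h k
  proof -
    \<comment> \<open>The difference is written as a sum over \<open>bool\<close> so that
      \<open>dform_sum_right\<close> applies.\<close>
    have "dform \<gamma> n k (\<lambda>z. \<Sum>x\<in>sites n. h x * N x z) = dform \<gamma> n k (\<lambda>z. \<Sum>b\<in>UNIV. (if b then 1 else - 1) * (if b then \<Sum>x\<in>sites n. h x * cov x z else h z))"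
    proof (rule dform_cong[OF n refl])
      fix z assume "z \<in> sites n"
      then show "(\<Sum>x\<in>sites n. h x * N x z) = (\<Sum>b\<in>UNIV. (if b then 1 else - 1) * (if b then \<Sum>x\<in>sites n. h x * cov x z else h z))"
        by (simp add: N_def UNIV_bool right_diff_distrib sum_subtractf of_bool_def if_distrib[where f = "\<lambda>t. _ * t"] cong: if_cong)
    qed
    also have "\<dots> = (\<Sum>b\<in>UNIV. (if b then 1 else - 1) * dform \<gamma> n k (\<lambda>z. if b then \<Sum>x\<in>sites n. h x * cov x z else h z))"
      by (rule dform_sum_right) simp
    finally show ?thesis by (simp add: UNIV_bool)
  qed
  have "N x y = 0"
  proof (rule lyapunov_unique[OF \<gamma> n _ _ x y])
    show "N x y = N y x" for x y by (auto simp: N_def cov_def mult.commute)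
    show "dform \<gamma> n k (\<lambda>z. \<Sum>x\<in>sites n. h x * N x z) + dform \<gamma> n h (\<lambda>z. \<Sum>x\<in>sites n. k x * N x z) = 0" for h k
      using cov_equation[of k h] dform_commute[of \<gamma> n h k] unfolding N by simp
  qed
  then show "cov x y = of_bool (x = y)" by (simp add: N_def)
qed

lemma lin_variance:
  "integrable \<mu> (\<lambda>\<phi>. (lin h \<phi> - lin h mean)\<^sup>2)"
  "(\<integral>\<phi>. (lin h \<phi> - lin h mean)\<^sup>2 \<partial>\<mu>) = (\<Sum>x\<in>sites n. (h x)\<^sup>2)"
proof -
  have eq: "(lin h \<phi> - lin h mean)\<^sup>2 =
      (\<Sum>x\<in>sites n. \<Sum>y\<in>sites n. h x * h y * (\<phi> x * \<phi> y - mean y * \<phi> x - mean x * \<phi> y + mean x * mean y))" for \<phi>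
  proof -
    have "lin h \<phi> - lin h mean = (\<Sum>x\<in>sites n. h x * (\<phi> x - mean x))"
      by (simp add: sum_subtractf right_diff_distrib)
    then show ?thesis
      by (simp only: power2_eq_square sum_product) (intro sum.cong refl, simp add: algebra_simps)
  qed
  have int: "integrable \<mu> (\<lambda>\<phi>. h x * h y * (\<phi> x * \<phi> y - mean y * \<phi> x - mean x * \<phi> y + mean x * mean y))"
    if "x \<in> sites n" "y \<in> sites n" for x y
    using that coord_integrable coord_product_integrable by auto
  show "integrable \<mu> (\<lambda>\<phi>. (lin h \<phi> - lin h mean)\<^sup>2)"
    unfolding eq using int by (intro Bochner_Integration.integrable_sum) auto
  have "(\<integral>\<phi>. (lin h \<phi> - lin h mean)\<^sup>2 \<partial>\<mu>) =
      (\<Sum>x\<in>sites n. \<Sum>y\<in>sites n. (\<integral>\<phi>. h x * h y * (\<phi> x * \<phi> y - mean y * \<phi> x - mean x * \<phi> y + mean x * mean y) \<partial>\<mu>))"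
    unfolding eq using int
    by (subst Bochner_Integration.integral_sum, intro Bochner_Integration.integrable_sum, simp,
        intro sum.cong refl, subst Bochner_Integration.integral_sum) auto
  also have "\<dots> = (\<Sum>x\<in>sites n. \<Sum>y\<in>sites n. h x * h y * of_bool (x = y))"
  proof (intro sum.cong refl)
    fix x y assume xy: "x \<in> sites n" "y \<in> sites n"
    have "(\<integral>\<phi>. \<phi> x * \<phi> y - mean y * \<phi> x - mean x * \<phi> y + mean x * mean y \<partial>\<mu>) = cov x y"
      using xy coord_integrable coord_product_integrable by (simp add: prob_space cov_def flip: mean_def)
    then show "(\<integral>\<phi>. h x * h y * (\<phi> x * \<phi> y - mean y * \<phi> x - mean x * \<phi> y + mean x * mean y) \<partial>\<mu>) = h x * h y * of_bool (x = y)"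
      using cov_eq[OF xy] by simp
  qed
  also have "\<dots> = (\<Sum>x\<in>sites n. (h x)\<^sup>2)"
    by (simp add: of_bool_def if_distrib[where f = "\<lambda>t. _ * t"] power2_eq_square cong: if_cong)
  finally show "(\<integral>\<phi>. (lin h \<phi> - lin h mean)\<^sup>2 \<partial>\<mu>) = (\<Sum>x\<in>sites n. (h x)\<^sup>2)" .
qed

lemma lin_concentration:
  assumes "\<delta> > 0"
  shows "measure \<mu> {\<phi> \<in> space \<mu>. \<bar>lin h \<phi> - lin h mean\<bar> \<ge> \<delta>} \<le> (\<Sum>x\<in>sites n. (h x)\<^sup>2) / \<delta>\<^sup>2"
proof -
  have "{\<phi> \<in> space \<mu>. \<bar>lin h \<phi> - lin h mean\<bar> \<ge> \<delta>} = {\<phi> \<in> space \<mu>. (lin h \<phi> - lin h mean)\<^sup>2 \<ge> \<delta>\<^sup>2}"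
    using assms abs_le_square_iff[of \<delta>] by auto
  then show ?thesis
    using integral_Markov_inequality_measure[OF lin_variance(1)[of h], where c = "\<delta>\<^sup>2" and A = "{}"] assms
    by (simp add: lin_variance(2))
qed

end

section \<open>Discrete energy estimates\<close>

lemma double_sum_square_bound:
  fixes f :: "nat \<Rightarrow> real"
  assumes "finite I" "finite J"
  shows "(\<Sum>x\<in>I. \<Sum>y\<in>J. f x - f y)\<^sup>2 \<le> (\<Sum>x\<in>I. \<Sum>y\<in>J. (f x - f y)\<^sup>2) * (card I * card J)"
  using sum_squared_le_sum_of_squares[of "\<lambda>(x, y). f x - f y" "I \<times> J"] assms
  by (simp add: sum.cartesian_product case_prod_beta' card_cartesian_product)

text \<open>A discrete Gagliardo energy; the diagonal contributes nothing because the square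
  vanishes there.\<close>

definition dist_energy :: "real \<Rightarrow> nat set \<Rightarrow> (nat \<Rightarrow> real) \<Rightarrow> real" where
  "dist_energy s A f = (\<Sum>x\<in>A. \<Sum>y\<in>A. (f x - f y)\<^sup>2 * \<bar>real x - real y\<bar> powr (- s))"

lemma average_diff_bound:
  fixes f :: "nat \<Rightarrow> real"
  assumes s: "s > 0" and JI: "J \<subseteq> I" and J: "J = {c..<c + j}" "j > 0" and I: "I = {a..<a + i}" and ij: "i \<le> 2 * j"
    and E: "dist_energy s I f \<le> E"
  shows "\<bar>(\<Sum>x\<in>J. f x) / j - (\<Sum>x\<in>I. f x) / i\<bar> \<le> sqrt (2 * E) * real i powr ((s - 2) / 2)"
proof -
  have i: "i > 0" using JI J I by auto
  have card: "card I = i" "card J = j" and fin: "finite I" "finite J" using I J by auto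
  have "(\<Sum>x\<in>J. \<Sum>y\<in>I. f x - f y) = real i * (\<Sum>x\<in>J. f x) - real j * (\<Sum>x\<in>I. f x)"
    by (simp add: sum_subtractf card sum_distrib_left)
  then have eq: "(\<Sum>x\<in>J. f x) / j - (\<Sum>x\<in>I. f x) / i = (\<Sum>x\<in>J. \<Sum>y\<in>I. f x - f y) / (real i * real j)"
    using i J(2) by (simp add: field_simps)
  have "(\<Sum>x\<in>J. \<Sum>y\<in>I. (f x - f y)\<^sup>2) \<le> (\<Sum>x\<in>J. \<Sum>y\<in>I. real i powr s * ((f x - f y)\<^sup>2 * \<bar>real x - real y\<bar> powr (- s)))"
  proof (intro sum_mono)
    fix x y assume x: "x \<in> J" and y: "y \<in> I"
    show "(f x - f y)\<^sup>2 \<le> real i powr s * ((f x - f y)\<^sup>2 * \<bar>real x - real y\<bar> powr (- s))"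
    proof (cases "x = y")
      case False
      have "\<bar>real x - real y\<bar> powr s \<le> real i powr s"
        using x y JI I s by (intro powr_mono2) (auto simp: abs_if)
      then have "1 \<le> real i powr s * \<bar>real x - real y\<bar> powr (- s)"
        using False by (simp add: powr_minus field_simps)
      then have "(f x - f y)\<^sup>2 * 1 \<le> (f x - f y)\<^sup>2 * (real i powr s * \<bar>real x - real y\<bar> powr (- s))"
        by (intro mult_left_mono) auto
      then show ?thesis by (simp add: mult_ac)
    qed simp
  qed
  also have "\<dots> = real i powr s * (\<Sum>x\<in>J. \<Sum>y\<in>I. (f x - f y)\<^sup>2 * \<bar>real x - real y\<bar> powr (- s))"
    by (simp add: sum_distrib_left)
  also have "\<dots> \<le> real i powr s * E"
  proof (rule mult_left_mono)
    have "(\<Sum>x\<in>J. \<Sum>y\<in>I. (f x - f y)\<^sup>2 * \<bar>real x - real y\<bar> powr (- s)) \<le> dist_energy s I f"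
      unfolding dist_energy_def by (rule sum_mono2[OF fin(1) JI]) (auto intro!: sum_nonneg)
    then show "(\<Sum>x\<in>J. \<Sum>y\<in>I. (f x - f y)\<^sup>2 * \<bar>real x - real y\<bar> powr (- s)) \<le> E" using E by simp
  qed simp
  finally have S: "(\<Sum>x\<in>J. \<Sum>y\<in>I. (f x - f y)\<^sup>2) \<le> real i powr s * E" .
  have "((\<Sum>x\<in>J. \<Sum>y\<in>I. f x - f y) / (real i * real j))\<^sup>2
      \<le> ((\<Sum>x\<in>J. \<Sum>y\<in>I. (f x - f y)\<^sup>2) * (real j * real i)) / (real i * real j)\<^sup>2"
    unfolding power_divide using double_sum_square_bound[OF fin(2,1), of f] card by (intro divide_right_mono) auto
  also have "\<dots> = (\<Sum>x\<in>J. \<Sum>y\<in>I. (f x - f y)\<^sup>2) / (real i * real j)"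
    using i J(2) by (simp add: power2_eq_square)
  also have "\<dots> \<le> (real i powr s * E) / (real i * real j)"
    using S by (intro divide_right_mono) auto
  also have "\<dots> \<le> (real i powr s * E) / (real i * (real i / 2))"
  proof (intro divide_left_mono mult_left_mono)
    show "0 \<le> real i powr s * E" using S by (rule order_trans[rotated]) (auto intro!: sum_nonneg)
  qed (use ij i J(2) in auto)
  also have "\<dots> = (sqrt (2 * E) * real i powr ((s - 2) / 2))\<^sup>2"
  proof -
    have "0 \<le> dist_energy s I f" unfolding dist_energy_def by (intro sum_nonneg) auto
    then have "E \<ge> 0" using E by simp
    moreover have "(real i powr ((s - 2) / 2))\<^sup>2 = real i powr s / (real i)\<^sup>2"
      using i by (simp add: power2_eq_square flip: powr_add) (simp add: powr_diff power2_eq_square)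
    ultimately show ?thesis by (simp only: power_mult_distrib real_sqrt_pow2[OF mult_nonneg_nonneg[OF zero_le_numeral]]) (simp add: power2_eq_square)
  qed
  finally have "((\<Sum>x\<in>J. \<Sum>y\<in>I. f x - f y) / (real i * real j))\<^sup>2 \<le> (sqrt (2 * E) * real i powr ((s - 2) / 2))\<^sup>2" .
  moreover have "E \<ge> 0"
  proof -
    have "0 \<le> dist_energy s I f" unfolding dist_energy_def by (intro sum_nonneg) auto
    then show ?thesis using E by simp
  qed
  ultimately show ?thesis unfolding eq
    by (subst (asm) abs_le_square_iff[symmetric]) (simp add: abs_mult)
qed

lemma dist_energy_mono:
  "finite B \<Longrightarrow> A \<subseteq> B \<Longrightarrow> dist_energy s A f \<le> dist_energy s B f"
  unfolding dist_energy_def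
  by (rule order_trans[OF sum_mono[OF sum_mono2] sum_mono2]) (auto intro!: sum_nonneg intro: finite_subset)

text \<open>Induction on the length of the interval: one step to a shorter interval around
  \<open>x\<close> costs a single unit, and the inequality assumed for \<open>C\<close> says that
  the resulting geometric series is summed by \<open>C\<close>.\<close>

lemma average_oscillation_bound:
  fixes f :: "nat \<Rightarrow> real"
  assumes s: "s > 2" and x: "x \<in> {a..<a + i}" and E: "dist_energy s {a..<a + i} f \<le> E"
    and C: "C * (3 / 4) powr ((s - 2) / 2) + 1 \<le> C" "C \<ge> 0"
  shows "\<bar>f x - (\<Sum>y\<in>{a..<a + i}. f y) / i\<bar> \<le> C * sqrt (2 * E) * real i powr ((s - 2) / 2)"
  using x E
proof (induction i arbitrary: a rule: less_induct)
  case (less i)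
  have "0 \<le> dist_energy s {a..<a + i} f" unfolding dist_energy_def by (intro sum_nonneg) auto
  then have E0: "E \<ge> 0" using less.prems by simp
  show ?case
  proof (cases "i \<le> 1")
    case True
    then have "i = 1" using less.prems by auto
    then have "x = a" using less.prems(1) by auto
    then show ?thesis using \<open>i = 1\<close> C(2) E0 by simp
  next
    case False
    \<comment> \<open>Half the length, rounded up so that the sub-intervals at the two ends cover
      the whole. The ratio 3/4 in place of 1/2 absorbs the rounding for every
      \<open>i \<ge> 2\<close>.\<close>
    define j where "j = i - i div 2"
    have j: "j > 0" "j < i" "i \<le> 2 * j" "4 * j \<le> 3 * i" using False unfolding j_def by auto
    obtain c where c: "x \<in> {c..<c + j}" "{c..<c + j} \<subseteq> {a..<a + i}"
    proof (cases "x < a + j")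
      case True
      then show ?thesis using that[of a] less.prems j by auto
    next
      case False
      then show ?thesis using that[of "a + i - j"] less.prems j by auto
    qed
    have "dist_energy s {c..<c + j} f \<le> E"
      using dist_energy_mono[OF _ c(2), of s f] less.prems(2) by auto
    then have 1: "\<bar>f x - (\<Sum>y\<in>{c..<c + j}. f y) / j\<bar> \<le> C * sqrt (2 * E) * real j powr ((s - 2) / 2)"
      using less.IH[OF j(2) c(1)] by simp
    have "real j powr ((s - 2) / 2) \<le> (3 / 4 * real i) powr ((s - 2) / 2)"
      using s j by (intro powr_mono2) auto
    also have "\<dots> = (3 / 4) powr ((s - 2) / 2) * real i powr ((s - 2) / 2)"
      by (rule powr_mult)
    finally have "C * sqrt (2 * E) * real j powr ((s - 2) / 2) \<le> C * sqrt (2 * E) * ((3 / 4) powr ((s - 2) / 2) * real i powr ((s - 2) / 2))"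
      using C(2) E0 by (intro mult_left_mono) auto
    moreover have "\<bar>(\<Sum>y\<in>{c..<c + j}. f y) / j - (\<Sum>y\<in>{a..<a + i}. f y) / i\<bar> \<le> sqrt (2 * E) * real i powr ((s - 2) / 2)"
      using average_diff_bound[OF _ c(2) refl j(1) refl j(3) less.prems(2)] s by simp
    ultimately have "\<bar>f x - (\<Sum>y\<in>{a..<a + i}. f y) / i\<bar> \<le>
       (C * (3 / 4) powr ((s - 2) / 2) + 1) * (sqrt (2 * E) * real i powr ((s - 2) / 2))"
      using 1 by (simp add: algebra_simps)
    also have "\<dots> \<le> C * (sqrt (2 * E) * real i powr ((s - 2) / 2))"
      using C E0 by (intro mult_right_mono) auto
    finally show ?thesis by (simp add: mult_ac)
  qed
qed

text \<open>A discrete Morrey inequality: averages of \<open>f\<close> over an interval and over a sub-interval of half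
  its length are close, and telescoping over the scales gives a geometric series as \<open>s > 2\<close>.\<close>

lemma discrete_morrey:
  assumes "s > 2"
  obtains C where "C > 0" "\<And>a b f x y. x \<in> {a..b} \<Longrightarrow> y \<in> {a..b} \<Longrightarrow>
    \<bar>f x - f y\<bar> \<le> C * sqrt (dist_energy s {a..b} f) * \<bar>real x - real y\<bar> powr ((s - 2) / 2)"
proof -
  define \<alpha> where "\<alpha> = (s - 2) / 2"
  \<comment> \<open>The sum of the geometric series with ratio \<open>(3 / 4) powr \<alpha>\<close>;
    it satisfies the condition on \<open>C\<close> in \<open>average_oscillation_bound\<close> with
    equality.\<close>
  define D where "D = 1 / (1 - (3 / 4) powr \<alpha>)"
  have \<alpha>: "\<alpha> > 0" using assms by (simp add: \<alpha>_def)
  have lt: "(3 / 4 :: real) powr \<alpha> < 1"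
    using powr_less_mono2[OF \<alpha>, of "3/4" 1] by simp
  then have D: "D > 0" "D * (3 / 4) powr \<alpha> + 1 \<le> D"
    by (auto simp: D_def field_simps)
  define C where "C = 2 * D * sqrt 2 * 2 powr \<alpha>"
  have main: "\<bar>f x - f y\<bar> \<le> C * sqrt (dist_energy s {a..b} f) * \<bar>real x - real y\<bar> powr \<alpha>"
    if "x \<in> {a..b}" "y \<in> {a..b}" "x < y" for a b f and x y :: nat
  proof -
    define i where "i = Suc (y - x)"
    have iv: "{x..<x + i} \<subseteq> {a..b}" "x \<in> {x..<x + i}" "y \<in> {x..<x + i}" using that by (auto simp: i_def)
    have E: "dist_energy s {x..<x + i} f \<le> dist_energy s {a..b} f"
      by (rule dist_energy_mono) (use iv in auto)
    let ?A = "(\<Sum>y\<in>{x..<x + i}. f y) / i" and ?E = "dist_energy s {a..b} f"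
    have E0: "?E \<ge> 0" unfolding dist_energy_def by (intro sum_nonneg) auto
    have "\<bar>f x - ?A\<bar> \<le> D * sqrt (2 * ?E) * real i powr \<alpha>" "\<bar>f y - ?A\<bar> \<le> D * sqrt (2 * ?E) * real i powr \<alpha>"
      using average_oscillation_bound[OF assms iv(2) E] average_oscillation_bound[OF assms iv(3) E] D
      by (auto simp: \<alpha>_def)
    then have "\<bar>f x - f y\<bar> \<le> 2 * (D * sqrt (2 * ?E) * real i powr \<alpha>)" by linarith
    also have "\<dots> \<le> 2 * (D * sqrt (2 * ?E) * (2 powr \<alpha> * \<bar>real x - real y\<bar> powr \<alpha>))"
    proof (intro mult_left_mono)
      have "real i powr \<alpha> \<le> (2 * \<bar>real x - real y\<bar>) powr \<alpha>"
        using \<alpha> that by (intro powr_mono2) (auto simp: i_def)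
      then show "real i powr \<alpha> \<le> 2 powr \<alpha> * \<bar>real x - real y\<bar> powr \<alpha>" by (simp add: powr_mult)
    qed (use D E0 in auto)
    finally show ?thesis using D E0 by (simp add: C_def real_sqrt_mult mult_ac)
  qed
  have "\<bar>f x - f y\<bar> \<le> C * sqrt (dist_energy s {a..b} f) * \<bar>real x - real y\<bar> powr \<alpha>"
    if "x \<in> {a..b}" "y \<in> {a..b}" for a b f and x y :: nat
    using main[OF that, of f] main[OF that(2,1), of f]
    by (cases x y rule: linorder_cases) (auto simp: abs_minus_commute)
  moreover have "C > 0" using D by (simp add: C_def)
  ultimately show ?thesis using that[of C] by (auto simp: \<alpha>_def)
qed

section \<open>Energy and regularity of the discrete stationary profile\<close>

lemma jump_eq: "jump \<gamma> (int y - int x) = c_norm \<gamma> * \<bar>real x - real y\<bar> powr (- (1 + \<gamma>))"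
proof -
  have "\<bar>real_of_int (int y - int x)\<bar> = \<bar>real x - real y\<bar>" by (simp add: abs_minus_commute)
  then show ?thesis by (auto simp: jump_def)
qed

lemma dform_eq: "dform \<gamma> n a b = a 1 * b 1 + a (n - 1) * b (n - 1) +
   c_norm \<gamma> / 2 * (\<Sum>x\<in>sites n. \<Sum>y\<in>sites n. ((a x - a y) * (b x - b y)) * \<bar>real x - real y\<bar> powr (- (1 + \<gamma>)))"
proof -
  have "(\<Sum>x\<in>sites n. \<Sum>y\<in>sites n. jump \<gamma> (int y - int x) * ((a y - a x) * (b y - b x))) =
    c_norm \<gamma> * (\<Sum>x\<in>sites n. \<Sum>y\<in>sites n. ((a x - a y) * (b x - b y)) * \<bar>real x - real y\<bar> powr (- (1 + \<gamma>)))"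
    unfolding sum_distrib_left jump_eq by (intro sum.cong refl) (simp add: algebra_simps)
  then show ?thesis by (simp add: dform_def)
qed

lemma dform_self: "dform \<gamma> n a a = (a 1)\<^sup>2 + (a (n - 1))\<^sup>2 + c_norm \<gamma> / 2 * dist_energy (1 + \<gamma>) (sites n) a"
  by (simp add: dform_eq dist_energy_def power2_eq_square)

text \<open>Comparison of each term with an increment of \<open>z powr t / t\<close>, by the mean
  value theorem and because \<open>z powr (t - 1)\<close> is decreasing.\<close>

lemma sum_powr_le:
  fixes t :: real
  assumes t: "0 < t" "t < 1"
  shows "(\<Sum>d=1..k. real d powr (t - 1)) \<le> real k powr t / t"
proof (induction k)
  case (Suc k)
  have "t * real (Suc k) powr (t - 1) \<le> real (Suc k) powr t - real k powr t"
  proof (cases "k = 0")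
    case False
    have "\<exists>z::real. real k < z \<and> z < real (Suc k) \<and> real (Suc k) powr t - real k powr t = (real (Suc k) - real k) * (t * z powr (t - 1))"
      by (rule MVT2) (use False in \<open>auto intro!: derivative_eq_intros\<close>)
    then obtain z where z: "real k < z" "z < real (Suc k)" "real (Suc k) powr t - real k powr t = t * z powr (t - 1)"
      by auto
    have "real (Suc k) powr (t - 1) \<le> z powr (t - 1)"
      using z t False by (intro powr_mono2') auto
    then show ?thesis using z(3) t by (simp add: mult_left_mono)
  qed (use t in simp)
  then have "real (Suc k) powr (t - 1) \<le> (real (Suc k) powr t - real k powr t) / t"
    using t by (simp add: field_simps)
  with Suc.IH show ?case by (simp add: diff_divide_distrib)
qed (use t in simp)

text \<open>The exponent 1 - \<gamma> exceeds -1 exactly because \<gamma> < 2. The factor 2 counts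
  the two sides of \<open>x\<close>; the point \<open>x\<close> itself contributes 0, since
  \<open>0 powr a = 0\<close>.\<close>

lemma near_diagonal_sum_bound:
  fixes \<gamma> r :: real
  assumes \<gamma>: "1 < \<gamma>" "\<gamma> < 2" and r: "r \<ge> 0" and "finite A"
  shows "(\<Sum>y\<in>A. if \<bar>real x - real y\<bar> \<le> r then \<bar>real x - real y\<bar> powr (1 - \<gamma>) else 0) \<le> 2 * (r powr (2 - \<gamma>) / (2 - \<gamma>))"
proof -
  define k where "k = nat \<lfloor>r\<rfloor>"
  have k: "real k \<le> r" "d \<le> k" if "real d \<le> r" for d
    using that r unfolding k_def by (auto simp: le_nat_floor)
  have k0: "real k \<le> r" using r unfolding k_def by simp
  let ?f = "\<lambda>y. \<bar>real x - real y\<bar> powr (1 - \<gamma>)"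
  define L where "L = {y\<in>A. y < x \<and> \<bar>real x - real y\<bar> \<le> r}"
  define U where "U = {y\<in>A. x < y \<and> \<bar>real x - real y\<bar> \<le> r}"
  have fin: "finite L" "finite U" using \<open>finite A\<close> by (auto simp: L_def U_def)
  have S: "(\<Sum>d=1..k. real d powr (1 - \<gamma>)) \<le> r powr (2 - \<gamma>) / (2 - \<gamma>)"
  proof -
    have "(\<Sum>d=1..k. real d powr (1 - \<gamma>)) \<le> real k powr (2 - \<gamma>) / (2 - \<gamma>)"
      using sum_powr_le[of "2 - \<gamma>" k] \<gamma> by simp
    also have "\<dots> \<le> r powr (2 - \<gamma>) / (2 - \<gamma>)"
      using k0 \<gamma> by (intro divide_right_mono powr_mono2) auto
    finally show ?thesis .
  qed
  have "(\<Sum>y\<in>L. ?f y) = (\<Sum>d\<in>(\<lambda>y. x - y) ` L. real d powr (1 - \<gamma>))"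
    by (subst sum.reindex) (auto simp: L_def inj_on_def of_nat_diff)
  also have "\<dots> \<le> (\<Sum>d=1..k. real d powr (1 - \<gamma>))"
    by (rule sum_mono2) (use k(2) in \<open>auto simp: L_def of_nat_diff\<close>)
  finally have L: "(\<Sum>y\<in>L. ?f y) \<le> r powr (2 - \<gamma>) / (2 - \<gamma>)" using S by simp
  have "(\<Sum>y\<in>U. ?f y) = (\<Sum>d\<in>(\<lambda>y. y - x) ` U. real d powr (1 - \<gamma>))"
    by (subst sum.reindex) (auto simp: U_def inj_on_def of_nat_diff abs_minus_commute)
  also have "\<dots> \<le> (\<Sum>d=1..k. real d powr (1 - \<gamma>))"
    by (rule sum_mono2) (use k(2) in \<open>auto simp: U_def of_nat_diff abs_minus_commute\<close>)
  finally have U: "(\<Sum>y\<in>U. ?f y) \<le> r powr (2 - \<gamma>) / (2 - \<gamma>)" using S by simp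
  have "(\<Sum>y\<in>A. if \<bar>real x - real y\<bar> \<le> r then ?f y else 0) = (\<Sum>y\<in>L \<union> U. ?f y)"
  proof (rule sum.mono_neutral_cong_right)
    show "\<forall>y\<in>A - (L \<union> U). (if \<bar>real x - real y\<bar> \<le> r then ?f y else 0) = 0"
      by (auto simp: L_def U_def)
  qed (use \<open>finite A\<close> in \<open>auto simp: L_def U_def\<close>)
  also have "\<dots> = (\<Sum>y\<in>L. ?f y) + (\<Sum>y\<in>U. ?f y)"
    by (rule sum.union_disjoint) (use fin in \<open>auto simp: L_def U_def\<close>)
  finally show ?thesis using L U by simp
qed

text \<open>The Euler-Lagrange equation for the bulk energy plus the boundary penalties
  \<open>(m 1 - \<Phi>l)\<^sup>2\<close> and \<open>(m (n - 1) - \<Phi>r)\<^sup>2\<close>.\<close>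

definition discrete_harmonic :: "real \<Rightarrow> real \<Rightarrow> real \<Rightarrow> nat \<Rightarrow> (nat \<Rightarrow> real) \<Rightarrow> bool" where
  "discrete_harmonic \<gamma> \<Phi>l \<Phi>r n m \<longleftrightarrow> (\<forall>k. dform \<gamma> n k m = \<Phi>l * k 1 + \<Phi>r * k (n - 1))"

lemma card_sites: "card (sites n) = n - 1"
  by (simp add: sites_def)

text \<open>A discrete harmonic function minimises the energy including the boundary terms; it is compared
  with the linear profile.\<close>

lemma discrete_harmonic_energy:
  assumes \<gamma>: "1 < \<gamma>" "\<gamma> < 2"
  obtains C where "C > 0" "\<And>n m. n \<ge> 2 \<Longrightarrow> discrete_harmonic \<gamma> \<Phi>l \<Phi>r n m \<Longrightarrow>
     dist_energy (1 + \<gamma>) (sites n) m \<le> C * real n powr (1 - \<gamma>) \<and>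
     (m 1 - \<Phi>l)\<^sup>2 \<le> C * real n powr (1 - \<gamma>) \<and> (m (n - 1) - \<Phi>r)\<^sup>2 \<le> C * real n powr (1 - \<gamma>)"
proof -
  define c where "c = c_norm \<gamma>"
  have c: "c > 0" unfolding c_def using c_norm_pos[OF \<gamma>(1)] .
  define D where "D = (\<Phi>r - \<Phi>l)\<^sup>2"
  define E where "E = 2 * D + c / 2 * (D * (2 / (2 - \<gamma>)))"
  have E0: "E \<ge> 0" using c \<gamma> by (simp add: E_def D_def)
  have main: "(m 1 - \<Phi>l)\<^sup>2 + (m (n - 1) - \<Phi>r)\<^sup>2 + c / 2 * dist_energy (1 + \<gamma>) (sites n) m \<le> E * real n powr (1 - \<gamma>)"
    if n: "n \<ge> 2" and m: "discrete_harmonic \<gamma> \<Phi>l \<Phi>r n m" for n m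
  proof -
    define l where "l x = \<Phi>l + (\<Phi>r - \<Phi>l) * (real x / real n)" for x
    \<comment> \<open>Harmonicity of \<open>m\<close> rewrites the linear boundary terms as
      \<open>2 * dform \<gamma> n f m\<close>. Minimality of \<open>m\<close> then is the
      nonnegativity of the form on \<open>l - m\<close>.\<close>
    have tot: "(f 1 - \<Phi>l)\<^sup>2 + (f (n - 1) - \<Phi>r)\<^sup>2 + c / 2 * dist_energy (1 + \<gamma>) (sites n) f
       = dform \<gamma> n f f - 2 * dform \<gamma> n f m + \<Phi>l\<^sup>2 + \<Phi>r\<^sup>2" for f
      using m by (simp add: discrete_harmonic_def dform_self c_def power2_eq_square algebra_simps)
    have "0 \<le> dform \<gamma> n (\<lambda>x. l x - m x) (\<lambda>x. l x - m x)" by (rule dform_end_le(3)[OF \<gamma>(1)])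
    also have "\<dots> = dform \<gamma> n l l - 2 * dform \<gamma> n l m + dform \<gamma> n m m"
    proof -
      let ?k = "\<lambda>x y. \<bar>real x - real y\<bar> powr (- (1 + \<gamma>))"
      have "(\<Sum>x\<in>sites n. \<Sum>y\<in>sites n. (((l x - m x) - (l y - m y)) * ((l x - m x) - (l y - m y))) * ?k x y) =
        (\<Sum>x\<in>sites n. \<Sum>y\<in>sites n. ((l x - l y) * (l x - l y)) * ?k x y - 2 * (((l x - l y) * (m x - m y)) * ?k x y)
           + ((m x - m y) * (m x - m y)) * ?k x y)"
        by (intro sum.cong refl) (simp add: algebra_simps)
      also have "\<dots> = (\<Sum>x\<in>sites n. \<Sum>y\<in>sites n. ((l x - l y) * (l x - l y)) * ?k x y)
          - 2 * (\<Sum>x\<in>sites n. \<Sum>y\<in>sites n. ((l x - l y) * (m x - m y)) * ?k x y)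
          + (\<Sum>x\<in>sites n. \<Sum>y\<in>sites n. ((m x - m y) * (m x - m y)) * ?k x y)"
        by (simp only: sum.distrib sum_subtractf sum_distrib_left)
      finally have S: "(\<Sum>x\<in>sites n. \<Sum>y\<in>sites n. (((l x - m x) - (l y - m y)) * ((l x - m x) - (l y - m y))) * ?k x y) =
          (\<Sum>x\<in>sites n. \<Sum>y\<in>sites n. ((l x - l y) * (l x - l y)) * ?k x y)
          - 2 * (\<Sum>x\<in>sites n. \<Sum>y\<in>sites n. ((l x - l y) * (m x - m y)) * ?k x y)
          + (\<Sum>x\<in>sites n. \<Sum>y\<in>sites n. ((m x - m y) * (m x - m y)) * ?k x y)" .
      have "(a - b) * (a - b) + (a' - b') * (a' - b') + k * (A - 2 * B + C) =
          (a * a + a' * a' + k * A) - 2 * (a * b + a' * b' + k * B) + (b * b + b' * b' + k * C)" for a b a' b' k A B C :: real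
        by (simp add: algebra_simps)
      then show ?thesis unfolding dform_eq S .
    qed
    finally have "(m 1 - \<Phi>l)\<^sup>2 + (m (n - 1) - \<Phi>r)\<^sup>2 + c / 2 * dist_energy (1 + \<gamma>) (sites n) m
      \<le> (l 1 - \<Phi>l)\<^sup>2 + (l (n - 1) - \<Phi>r)\<^sup>2 + c / 2 * dist_energy (1 + \<gamma>) (sites n) l"
      unfolding tot by simp
    \<comment> \<open>The squared slope turns the kernel into |x - y|^(1 - \<gamma>) / n^2. A row
      sums to order n^(2 - \<gamma>), and there are fewer than n rows.\<close>
    also have "dist_energy (1 + \<gamma>) (sites n) l \<le> D * (2 / (2 - \<gamma>)) * real n powr (1 - \<gamma>)"
    proof -
      have "(l x - l y)\<^sup>2 * \<bar>real x - real y\<bar> powr (- (1 + \<gamma>)) = D / (real n)\<^sup>2 * \<bar>real x - real y\<bar> powr (1 - \<gamma>)" for x y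
      proof (cases "x = y")
        case False
        have "l x - l y = (\<Phi>r - \<Phi>l) * (real x - real y) / real n"
          using n by (simp add: l_def field_simps)
        then have l2: "(l x - l y)\<^sup>2 = D / (real n)\<^sup>2 * (real x - real y)\<^sup>2"
          by (simp add: D_def power_mult_distrib power_divide)
        have "(real x - real y)\<^sup>2 = \<bar>real x - real y\<bar> powr 2" using False by simp
        then have "(real x - real y)\<^sup>2 * \<bar>real x - real y\<bar> powr (- (1 + \<gamma>)) = \<bar>real x - real y\<bar> powr (1 - \<gamma>)"
          by (simp only: powr_add[symmetric]) simp
        then show ?thesis unfolding l2 by (simp only: mult.assoc)
      qed simp
      then have "dist_energy (1 + \<gamma>) (sites n) l = D / (real n)\<^sup>2 * (\<Sum>x\<in>sites n. \<Sum>y\<in>sites n. \<bar>real x - real y\<bar> powr (1 - \<gamma>))"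
        unfolding dist_energy_def by (simp add: sum_distrib_left)
      also have "\<dots> \<le> D / (real n)\<^sup>2 * (real n * (2 * (real n powr (2 - \<gamma>) / (2 - \<gamma>))))"
      proof (rule mult_left_mono)
        have "(\<Sum>y\<in>sites n. \<bar>real x - real y\<bar> powr (1 - \<gamma>)) \<le> 2 * (real n powr (2 - \<gamma>) / (2 - \<gamma>))" if "x \<in> sites n" for x
        proof -
          have "(\<Sum>y\<in>sites n. \<bar>real x - real y\<bar> powr (1 - \<gamma>)) = (\<Sum>y\<in>sites n. if \<bar>real x - real y\<bar> \<le> real n then \<bar>real x - real y\<bar> powr (1 - \<gamma>) else 0)"
            using that by (intro sum.cong refl) (auto simp: sites_def)
          also have "\<dots> \<le> 2 * (real n powr (2 - \<gamma>) / (2 - \<gamma>))"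
            by (rule near_diagonal_sum_bound[OF \<gamma>]) auto
          finally show ?thesis .
        qed
        then have "(\<Sum>x\<in>sites n. \<Sum>y\<in>sites n. \<bar>real x - real y\<bar> powr (1 - \<gamma>)) \<le> (\<Sum>x\<in>sites n. 2 * (real n powr (2 - \<gamma>) / (2 - \<gamma>)))"
          by (rule sum_mono)
        also have "\<dots> \<le> real n * (2 * (real n powr (2 - \<gamma>) / (2 - \<gamma>)))"
          unfolding sum_constant card_sites using \<gamma> by (intro mult_right_mono) auto
        finally show "(\<Sum>x\<in>sites n. \<Sum>y\<in>sites n. \<bar>real x - real y\<bar> powr (1 - \<gamma>)) \<le> real n * (2 * (real n powr (2 - \<gamma>) / (2 - \<gamma>)))" .
      qed (simp add: D_def)
      also have "\<dots> = D * (2 / (2 - \<gamma>)) * (real n powr (2 - \<gamma>) / real n)"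
        using n by (simp add: power2_eq_square mult_ac)
      also have "real n powr (2 - \<gamma>) / real n = real n powr (1 - \<gamma>)"
        using n powr_diff[of "real n" "2 - \<gamma>" 1] by simp
      finally show ?thesis .
    qed
    \<comment> \<open>The sites start at 1 and end at n - 1, so the linear profile misses each
      boundary value by one lattice step; the square is of order n^(-2), below the required
      order.\<close>
    also have "(l 1 - \<Phi>l)\<^sup>2 \<le> D * real n powr (1 - \<gamma>)"
    proof -
      have "(l 1 - \<Phi>l)\<^sup>2 = D * real n powr (-2)" using n by (simp add: l_def D_def powr_minus power_divide field_simps)
      also have "\<dots> \<le> D * real n powr (1 - \<gamma>)" using n \<gamma> by (intro mult_left_mono powr_mono) (auto simp: D_def)
      finally show ?thesis .
    qed
    also have "(l (n - 1) - \<Phi>r)\<^sup>2 \<le> D * real n powr (1 - \<gamma>)"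
    proof -
      have lr: "l (n - 1) - \<Phi>r = - (\<Phi>r - \<Phi>l) / real n" using n by (simp add: l_def of_nat_diff field_simps)
      have "(l (n - 1) - \<Phi>r)\<^sup>2 = D * real n powr (-2)"
        unfolding lr using n by (simp add: D_def powr_minus power_divide divide_inverse power2_commute power_mult_distrib power_inverse)
      also have "\<dots> \<le> D * real n powr (1 - \<gamma>)" using n \<gamma> by (intro mult_left_mono powr_mono) (auto simp: D_def)
      finally show ?thesis .
    qed
    finally show ?thesis using c by (simp add: E_def algebra_simps)
  qed
  show ?thesis
  proof (rule that[of "(1 + 2 / c) * E + 1"])
    show "(1 + 2 / c) * E + 1 > 0" using c E0 by (intro add_nonneg_pos) auto
    fix n m assume n: "n \<ge> 2" "discrete_harmonic \<gamma> \<Phi>l \<Phi>r n m"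
    let ?N = "real n powr (1 - \<gamma>)"
    have e: "dist_energy (1 + \<gamma>) (sites n) m \<ge> 0" unfolding dist_energy_def by (intro sum_nonneg) auto
    have N: "?N \<ge> 0" by simp
    have ce: "c / 2 * dist_energy (1 + \<gamma>) (sites n) m \<ge> 0" using c e by simp
    have 1: "(m 1 - \<Phi>l)\<^sup>2 \<le> E * ?N" "(m (n - 1) - \<Phi>r)\<^sup>2 \<le> E * ?N" "c / 2 * dist_energy (1 + \<gamma>) (sites n) m \<le> E * ?N"
      using main[OF n] ce zero_le_power2[of "m 1 - \<Phi>l"] zero_le_power2[of "m (n - 1) - \<Phi>r"] by linarith+
    have 2: "dist_energy (1 + \<gamma>) (sites n) m \<le> (2 / c * E) * ?N" using 1(3) c by (simp add: field_simps)
    have "2 / c * E \<ge> 0" using c E0 by simp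
    then have "E \<le> (1 + 2 / c) * E + 1" "2 / c * E \<le> (1 + 2 / c) * E + 1"
      using E0 unfolding distrib_right by linarith+
    from mult_right_mono[OF this(1) N] mult_right_mono[OF this(2) N]
    have le: "E * ?N \<le> ((1 + 2 / c) * E + 1) * ?N" "(2 / c * E) * ?N \<le> ((1 + 2 / c) * E + 1) * ?N" .
    show "dist_energy (1 + \<gamma>) (sites n) m \<le> ((1 + 2 / c) * E + 1) * ?N \<and>
      (m 1 - \<Phi>l)\<^sup>2 \<le> ((1 + 2 / c) * E + 1) * ?N \<and> (m (n - 1) - \<Phi>r)\<^sup>2 \<le> ((1 + 2 / c) * E + 1) * ?N"
      using 1(1,2) 2 le by linarith
  qed
qed

text \<open>The energy bound contributes \<open>n powr ((1 - \<gamma>) / 2)\<close>, which is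
  exactly the factor that rescales lattice distances to the power (\<gamma> - 1) / 2. The modulus of
  continuity in macroscopic coordinates is thus uniform in \<open>n\<close>.\<close>

lemma discrete_harmonic_holder:
  assumes \<gamma>: "1 < \<gamma>" "\<gamma> < 2"
  obtains C where "C > 0" "\<And>n m x y. n \<ge> 2 \<Longrightarrow> discrete_harmonic \<gamma> \<Phi>l \<Phi>r n m \<Longrightarrow> x \<in> sites n \<Longrightarrow> y \<in> sites n \<Longrightarrow>
     \<bar>m x - m y\<bar> \<le> C * \<bar>real x / real n - real y / real n\<bar> powr ((\<gamma> - 1) / 2)"
proof -
  obtain E where E: "E > 0" "\<And>n m. n \<ge> 2 \<Longrightarrow> discrete_harmonic \<gamma> \<Phi>l \<Phi>r n m \<Longrightarrow>
     dist_energy (1 + \<gamma>) (sites n) m \<le> E * real n powr (1 - \<gamma>)"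
    using discrete_harmonic_energy[OF \<gamma>, of \<Phi>l \<Phi>r] by metis
  obtain C where C: "C > 0" "\<And>a b f x y. x \<in> {a..b} \<Longrightarrow> y \<in> {a..b} \<Longrightarrow>
    \<bar>f x - f y\<bar> \<le> C * sqrt (dist_energy (1 + \<gamma>) {a..b} f) * \<bar>real x - real y\<bar> powr ((1 + \<gamma> - 2) / 2)"
    using discrete_morrey[of "1 + \<gamma>"] \<gamma> by (metis add_less_cancel_left one_add_one)
  show ?thesis
  proof (rule that[of "C * sqrt E"])
    fix n m x y assume n: "n \<ge> 2" and m: "discrete_harmonic \<gamma> \<Phi>l \<Phi>r n m" and xy: "x \<in> sites n" "y \<in> sites n"
    have "\<bar>m x - m y\<bar> \<le> C * sqrt (dist_energy (1 + \<gamma>) (sites n) m) * \<bar>real x - real y\<bar> powr ((\<gamma> - 1) / 2)"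
      using C(2)[of x 1 "n - 1" y m] xy by (simp add: sites_def)
    also have "\<dots> \<le> C * sqrt (E * real n powr (1 - \<gamma>)) * \<bar>real x - real y\<bar> powr ((\<gamma> - 1) / 2)"
      using E(2)[OF n m] C(1) by (intro mult_right_mono mult_left_mono) auto
    also have "sqrt (E * real n powr (1 - \<gamma>)) = sqrt E * real n powr ((1 - \<gamma>) / 2)"
      using n by (simp add: real_sqrt_mult powr_half_sqrt[symmetric] powr_powr)
    also have "C * (sqrt E * real n powr ((1 - \<gamma>) / 2)) * \<bar>real x - real y\<bar> powr ((\<gamma> - 1) / 2) =
        C * sqrt E * \<bar>real x / real n - real y / real n\<bar> powr ((\<gamma> - 1) / 2)"
    proof -
      have "\<bar>real x / real n - real y / real n\<bar> = \<bar>real x - real y\<bar> / real n"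
        using n by (simp add: diff_divide_distrib[symmetric])
      moreover have "(1 - \<gamma>) / 2 = - ((\<gamma> - 1) / 2)" by (simp add: field_simps)
      then have "real n powr ((1 - \<gamma>) / 2) = 1 / real n powr ((\<gamma> - 1) / 2)"
        by (simp only: powr_minus_divide)
      ultimately show ?thesis by (simp add: powr_divide)
    qed
    finally show "\<bar>m x - m y\<bar> \<le> C * sqrt E * \<bar>real x / real n - real y / real n\<bar> powr ((\<gamma> - 1) / 2)" .
  qed (use C E in auto)
qed

text \<open>Capping the singularity makes every form below an integral of a continuous function;
  statements about the singular kernel become statements about \<open>\<eta> \<rightarrow> 0\<close>.\<close>

definition kern :: "real \<Rightarrow> real \<Rightarrow> real \<Rightarrow> real \<Rightarrow> real" where
  "kern \<gamma> \<eta> u v = max \<bar>u - v\<bar> \<eta> powr (- (1 + \<gamma>))"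

lemma kern_nonneg: "0 \<le> kern \<gamma> \<eta> u v"
  by (simp add: kern_def)

lemma kern_commute: "kern \<gamma> \<eta> u v = kern \<gamma> \<eta> v u"
  by (simp add: kern_def abs_minus_commute)

lemma kern_mono: "\<gamma> > 1 \<Longrightarrow> 0 < \<eta>' \<Longrightarrow> \<eta>' \<le> \<eta> \<Longrightarrow> kern \<gamma> \<eta> u v \<le> kern \<gamma> \<eta>' u v"
  unfolding kern_def by (intro powr_mono2') auto

lemma kern_le: "\<gamma> > 1 \<Longrightarrow> 0 < \<eta> \<Longrightarrow> kern \<gamma> \<eta> u v \<le> \<eta> powr (- (1 + \<gamma>))"
  unfolding kern_def by (intro powr_mono2') auto

lemma kern_le_powr: "\<gamma> > 1 \<Longrightarrow> u \<noteq> v \<Longrightarrow> kern \<gamma> \<eta> u v \<le> \<bar>u - v\<bar> powr (- (1 + \<gamma>))"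
  unfolding kern_def by (intro powr_mono2') auto

lemma continuous_on_kern [continuous_intros]:
  assumes "\<eta> > 0" "continuous_on A f" "continuous_on A g"
  shows "continuous_on A (\<lambda>x. kern \<gamma> \<eta> (f x) (g x))"
  unfolding kern_def using assms by (intro continuous_intros) auto

lemma weighted_cauchy_schwarz:
  fixes a b w :: "'a \<Rightarrow> real"
  assumes "\<And>i. i \<in> I \<Longrightarrow> w i \<ge> 0"
  shows "\<bar>\<Sum>i\<in>I. a i * b i * w i\<bar> \<le> sqrt (\<Sum>i\<in>I. (a i)\<^sup>2 * w i) * sqrt (\<Sum>i\<in>I. (b i)\<^sup>2 * w i)"
proof -
  have "(\<Sum>i\<in>I. (a i * sqrt (w i)) * (b i * sqrt (w i)))\<^sup>2 \<le> (\<Sum>i\<in>I. (a i * sqrt (w i))\<^sup>2) * (\<Sum>i\<in>I. (b i * sqrt (w i))\<^sup>2)"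
    by (rule Cauchy_Schwarz_ineq_sum)
  moreover have "(a i * sqrt (w i)) * (b i * sqrt (w i)) = a i * b i * w i" if "i \<in> I" for i
    using real_sqrt_mult_self[of "w i"] assms[OF that] by (simp add: algebra_simps)
  moreover have "(c i * sqrt (w i))\<^sup>2 = (c i)\<^sup>2 * w i" if "i \<in> I" for i and c :: "'a \<Rightarrow> real"
    using assms[OF that] by (simp add: power_mult_distrib)
  ultimately have "(\<Sum>i\<in>I. a i * b i * w i)\<^sup>2 \<le> (\<Sum>i\<in>I. (a i)\<^sup>2 * w i) * (\<Sum>i\<in>I. (b i)\<^sup>2 * w i)"
    by (simp cong: sum.cong)
  from real_sqrt_le_mono[OF this] show ?thesis by (simp add: real_sqrt_mult)
qed

lemma scaled_powr:
  "n > 0 \<Longrightarrow> \<bar>real x / real n - real y / real n\<bar> powr a = real n powr (- a) * \<bar>real x - real y\<bar> powr a"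
proof -
  assume n: "n > 0"
  then have "\<bar>real x / real n - real y / real n\<bar> = \<bar>real x - real y\<bar> / real n"
    by (simp add: diff_divide_distrib[symmetric])
  then show ?thesis using n by (simp add: powr_divide powr_minus_divide)
qed

text \<open>With the singular kernel the sum vanishes by harmonicity, so the capped sum equals minus
  the part removed near the diagonal. Cauchy-Schwarz bounds that part by the energy of
  \<open>m\<close>, which is bounded after rescaling, and by the energy of a Lipschitz function
  within distance \<eta>, of order \<open>\<eta> powr (2 - \<gamma>)\<close>.\<close>

lemma discrete_weak_form_bound:
  assumes \<gamma>: "1 < \<gamma>" "\<gamma> < 2"
  obtains C where "C > 0" "\<And>n m g \<eta> M. n \<ge> 2 \<Longrightarrow> discrete_harmonic \<gamma> \<Phi>l \<Phi>r n m \<Longrightarrow> 0 < \<eta> \<Longrightarrow> M \<ge> 0 \<Longrightarrow> g 1 = 0 \<Longrightarrow> g (n - 1) = 0 \<Longrightarrow>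
     (\<And>x y. x \<in> sites n \<Longrightarrow> y \<in> sites n \<Longrightarrow> \<bar>g x - g y\<bar> \<le> M * \<bar>real x / real n - real y / real n\<bar>) \<Longrightarrow>
     \<bar>(\<Sum>x\<in>sites n. \<Sum>y\<in>sites n. (m x - m y) * (g x - g y) * kern \<gamma> \<eta> (real x / real n) (real y / real n)) / (real n)\<^sup>2\<bar>
       \<le> C * M * sqrt (\<eta> powr (2 - \<gamma>))"
proof -
  obtain E where E: "E > 0" "\<And>n m. n \<ge> 2 \<Longrightarrow> discrete_harmonic \<gamma> \<Phi>l \<Phi>r n m \<Longrightarrow>
     dist_energy (1 + \<gamma>) (sites n) m \<le> E * real n powr (1 - \<gamma>)"
    using discrete_harmonic_energy[OF \<gamma>, of \<Phi>l \<Phi>r] by metis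
  define F where "F = 2 / (2 - \<gamma>)"
  have F: "F > 0" using \<gamma> by (simp add: F_def)
  show ?thesis
  proof (rule that[of "sqrt E * sqrt F"])
    show "sqrt E * sqrt F > 0" using E F by simp
    fix n m and \<eta> M :: real and g :: "nat \<Rightarrow> real"
    assume n: "n \<ge> 2" and m: "discrete_harmonic \<gamma> \<Phi>l \<Phi>r n m" and \<eta>: "0 < \<eta>" and M: "M \<ge> 0" and g0: "g 1 = 0" "g (n - 1) = 0"
      and g: "\<And>x y. x \<in> sites n \<Longrightarrow> y \<in> sites n \<Longrightarrow> \<bar>g x - g y\<bar> \<le> M * \<bar>real x / real n - real y / real n\<bar>"
    let ?S = "sites n \<times> sites n"
    let ?d = "\<lambda>x y. \<bar>real x / real n - real y / real n\<bar>"
    let ?K = "\<lambda>x y. kern \<gamma> \<eta> (real x / real n) (real y / real n)"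
    \<comment> \<open>The excess of the singular over the capped kernel. The diagonal has to be
      excluded by hand: \<open>0 powr a = 0\<close> there, whereas the capped kernel is
      positive.\<close>
    define w where "w = (\<lambda>(x, y). if x \<noteq> y \<and> ?d x y \<le> \<eta> then ?d x y powr (- (1 + \<gamma>)) - ?K x y else 0)"
    have K0: "?K x y \<ge> 0" for x y by (simp add: kern_def)
    have w0: "w i \<ge> 0" for i
    proof (cases i)
      case (Pair x y)
      have "?K x y \<le> ?d x y powr (- (1 + \<gamma>))" if "x \<noteq> y" "?d x y \<le> \<eta>"
        unfolding kern_def using that n \<gamma> by (intro powr_mono2') auto
      then show ?thesis by (simp add: w_def Pair)
    qed
    have wle: "w (x, y) \<le> (if ?d x y \<le> \<eta> then ?d x y powr (- (1 + \<gamma>)) else 0)" for x y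
      using K0 by (simp add: w_def)
    have harm: "(\<Sum>i\<in>?S. case i of (x, y) \<Rightarrow> (m x - m y) * (g x - g y) * ?d x y powr (- (1 + \<gamma>))) = 0"
    proof -
      have "dform \<gamma> n g m = 0" using m g0 by (simp add: discrete_harmonic_def)
      then have "c_norm \<gamma> / 2 * (\<Sum>x\<in>sites n. \<Sum>y\<in>sites n. ((g x - g y) * (m x - m y)) * \<bar>real x - real y\<bar> powr (- (1 + \<gamma>))) = 0"
        unfolding dform_eq using g0 by simp
      then have "(\<Sum>x\<in>sites n. \<Sum>y\<in>sites n. ((g x - g y) * (m x - m y)) * \<bar>real x - real y\<bar> powr (- (1 + \<gamma>))) = 0"
        using c_norm_pos[OF \<gamma>(1)] by simp
      then have "real n powr (1 + \<gamma>) * (\<Sum>x\<in>sites n. \<Sum>y\<in>sites n. ((g x - g y) * (m x - m y)) * \<bar>real x - real y\<bar> powr (- (1 + \<gamma>))) = 0"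
        by simp
      then show ?thesis
        using n by (simp only: scaled_powr[of n] sum.cartesian_product[symmetric] sum_distrib_left)
          (simp add: mult_ac add.commute scaled_powr[of n])
    qed
    have eq: "(m x - m y) * (g x - g y) * ?K x y = (m x - m y) * (g x - g y) * ?d x y powr (- (1 + \<gamma>)) - (m x - m y) * (g x - g y) * w (x, y)" for x y
    proof (cases "x = y")
      case False
      have "?K x y = ?d x y powr (- (1 + \<gamma>))" if "\<not> ?d x y \<le> \<eta>"
        using that by (simp add: kern_def max_def)
      then show ?thesis using False by (auto simp: w_def algebra_simps)
    qed simp
    have "(\<Sum>x\<in>sites n. \<Sum>y\<in>sites n. (m x - m y) * (g x - g y) * ?K x y) =
      (\<Sum>i\<in>?S. case i of (x, y) \<Rightarrow> (m x - m y) * (g x - g y) * ?d x y powr (- (1 + \<gamma>)))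
        - (\<Sum>i\<in>?S. (case i of (x, y) \<Rightarrow> m x - m y) * (case i of (x, y) \<Rightarrow> g x - g y) * w i)"
      unfolding eq by (simp add: sum.cartesian_product sum_subtractf[symmetric] case_prod_beta')
    then have "\<bar>\<Sum>x\<in>sites n. \<Sum>y\<in>sites n. (m x - m y) * (g x - g y) * ?K x y\<bar> =
      \<bar>\<Sum>i\<in>?S. (case i of (x, y) \<Rightarrow> m x - m y) * (case i of (x, y) \<Rightarrow> g x - g y) * w i\<bar>"
      unfolding harm by simp
    also have "\<dots> \<le> sqrt (\<Sum>i\<in>?S. (case i of (x, y) \<Rightarrow> m x - m y)\<^sup>2 * w i) * sqrt (\<Sum>i\<in>?S. (case i of (x, y) \<Rightarrow> g x - g y)\<^sup>2 * w i)"
      by (rule weighted_cauchy_schwarz[OF w0])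
    also have "\<dots> \<le> sqrt (E * (real n)\<^sup>2) * sqrt (M\<^sup>2 * (F * \<eta> powr (2 - \<gamma>)) * (real n)\<^sup>2)"
    proof (intro mult_mono real_sqrt_le_mono)
      have "(\<Sum>i\<in>?S. (case i of (x, y) \<Rightarrow> m x - m y)\<^sup>2 * w i) \<le> (\<Sum>i\<in>?S. case i of (x, y) \<Rightarrow> real n powr (1 + \<gamma>) * ((m x - m y)\<^sup>2 * \<bar>real x - real y\<bar> powr (- (1 + \<gamma>))))"
      proof (intro sum_mono)
        fix i assume "i \<in> ?S"
        obtain x y where i: "i = (x, y)" by (cases i)
        have "w (x, y) \<le> real n powr (1 + \<gamma>) * \<bar>real x - real y\<bar> powr (- (1 + \<gamma>))"
          using wle[of x y] n scaled_powr[of n x y "- (1 + \<gamma>)"] by (auto split: if_splits simp: add.commute intro: order_trans[OF _ mult_nonneg_nonneg])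
        then have "(m x - m y)\<^sup>2 * w (x, y) \<le> (m x - m y)\<^sup>2 * (real n powr (1 + \<gamma>) * \<bar>real x - real y\<bar> powr (- (1 + \<gamma>)))"
          by (rule mult_left_mono) simp
        then show "(case i of (x, y) \<Rightarrow> m x - m y)\<^sup>2 * w i \<le> (case i of (x, y) \<Rightarrow> real n powr (1 + \<gamma>) * ((m x - m y)\<^sup>2 * \<bar>real x - real y\<bar> powr (- (1 + \<gamma>))))"
          by (simp add: i mult_ac)
      qed
      also have "\<dots> = real n powr (1 + \<gamma>) * dist_energy (1 + \<gamma>) (sites n) m"
        unfolding dist_energy_def by (simp add: sum_distrib_left sum.cartesian_product case_prod_beta')
      also have "\<dots> \<le> real n powr (1 + \<gamma>) * (E * real n powr (1 - \<gamma>))"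
        using E(2)[OF n m] by (intro mult_left_mono) auto
      also have "\<dots> = E * (real n powr (1 + \<gamma>) * real n powr (1 - \<gamma>))" by simp
      also have "\<dots> = E * (real n)\<^sup>2" using n by (simp flip: powr_add)
      finally show "(\<Sum>i\<in>?S. (case i of (x, y) \<Rightarrow> m x - m y)\<^sup>2 * w i) \<le> E * (real n)\<^sup>2" .
    next
      let ?h = "\<lambda>x y. if \<bar>real x - real y\<bar> \<le> \<eta> * real n then \<bar>real x - real y\<bar> powr (1 - \<gamma>) else 0"
      have "(\<Sum>i\<in>?S. (case i of (x, y) \<Rightarrow> g x - g y)\<^sup>2 * w i) \<le> (\<Sum>i\<in>?S. case i of (x, y) \<Rightarrow> (M\<^sup>2 * real n powr (\<gamma> - 1)) * ?h x y)"
      proof (intro sum_mono)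
        fix i assume "i \<in> ?S"
        obtain x y where i: "i = (x, y)" by (cases i)
        have xy: "x \<in> sites n" "y \<in> sites n" using \<open>i \<in> ?S\<close> i by auto
        have "(g x - g y)\<^sup>2 \<le> (M * ?d x y)\<^sup>2" using g[OF xy] by (simp add: abs_le_square_iff[symmetric])
        then have "(g x - g y)\<^sup>2 * w (x, y) \<le> (M * ?d x y)\<^sup>2 * (if ?d x y \<le> \<eta> then ?d x y powr (- (1 + \<gamma>)) else 0)"
          using wle w0 by (intro mult_mono) auto
        also have "\<dots> = (M\<^sup>2 * real n powr (\<gamma> - 1)) * ?h x y"
        proof (cases "x = y")
          case False
          have "?d x y \<le> \<eta> \<longleftrightarrow> \<bar>real x - real y\<bar> \<le> \<eta> * real n"
            using n by (simp add: diff_divide_distrib[symmetric] field_simps)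
          moreover have "(M * ?d x y)\<^sup>2 * ?d x y powr (- (1 + \<gamma>)) = M\<^sup>2 * ?d x y powr (1 - \<gamma>)"
          proof -
            have "(?d x y)\<^sup>2 = ?d x y powr 2" using False n by (simp add: powr_numeral)
            then show ?thesis by (simp only: power_mult_distrib mult.assoc powr_add[symmetric]) simp
          qed
          ultimately show ?thesis using n by (simp add: scaled_powr[of n])
        qed simp
        finally show "(case i of (x, y) \<Rightarrow> g x - g y)\<^sup>2 * w i \<le> (case i of (x, y) \<Rightarrow> (M\<^sup>2 * real n powr (\<gamma> - 1)) * ?h x y)"
          by (simp add: i)
      qed
      also have "\<dots> = (M\<^sup>2 * real n powr (\<gamma> - 1)) * (\<Sum>x\<in>sites n. \<Sum>y\<in>sites n. ?h x y)"
        by (simp add: sum_distrib_left sum.cartesian_product case_prod_beta')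
      also have "\<dots> \<le> (M\<^sup>2 * real n powr (\<gamma> - 1)) * (\<Sum>x\<in>sites n. 2 * ((\<eta> * real n) powr (2 - \<gamma>) / (2 - \<gamma>)))"
        using \<eta> by (intro mult_left_mono sum_mono near_diagonal_sum_bound \<gamma>) auto
      also have "\<dots> \<le> (M\<^sup>2 * real n powr (\<gamma> - 1)) * (real n * (2 * ((\<eta> * real n) powr (2 - \<gamma>) / (2 - \<gamma>))))"
        unfolding sum_constant card_sites using \<gamma> by (intro mult_left_mono mult_right_mono) auto
      also have "\<dots> = M\<^sup>2 * (F * \<eta> powr (2 - \<gamma>)) * (real n powr (\<gamma> - 1) * real n powr 1 * real n powr (2 - \<gamma>))"
        using n \<eta> by (simp add: F_def powr_mult)
      also have "real n powr (\<gamma> - 1) * real n powr 1 * real n powr (2 - \<gamma>) = (real n)\<^sup>2"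
        using n by (simp only: powr_add[symmetric]) simp
      finally show "(\<Sum>i\<in>?S. (case i of (x, y) \<Rightarrow> g x - g y)\<^sup>2 * w i) \<le> M\<^sup>2 * (F * \<eta> powr (2 - \<gamma>)) * (real n)\<^sup>2" .
    qed (use E(1) F in \<open>auto intro!: sum_nonneg simp: w0\<close>)
    also have "\<dots> = sqrt E * sqrt F * M * sqrt (\<eta> powr (2 - \<gamma>)) * (real n)\<^sup>2"
      using M by (simp add: real_sqrt_mult power2_eq_square)
    finally show "\<bar>(\<Sum>x\<in>sites n. \<Sum>y\<in>sites n. (m x - m y) * (g x - g y) * ?K x y) / (real n)\<^sup>2\<bar>
        \<le> sqrt E * sqrt F * M * sqrt (\<eta> powr (2 - \<gamma>))"
      using n by (simp add: field_simps)
  qed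
qed

section \<open>Regularised energy forms\<close>

text \<open>The factor \<open>c_norm \<gamma> / 2\<close> of the seminorm is dropped, because only
  boundedness and vanishing of the form matter.\<close>

definition kform :: "real \<Rightarrow> real \<Rightarrow> (real \<Rightarrow> real) \<Rightarrow> (real \<Rightarrow> real) \<Rightarrow> real" where
  "kform \<gamma> \<eta> f g = integral (cbox (0, 0) (1, 1)) (\<lambda>(u, v). (f u - f v) * (g u - g v) * kern \<gamma> \<eta> u v)"

lemma continuous_on_fst_snd:
  fixes f :: "real \<Rightarrow> real"
  assumes "continuous_on {a..b} f"
  shows "continuous_on (cbox (a, c) (b, d)) (\<lambda>x. f (fst x))" "continuous_on (cbox (c, a) (d, b)) (\<lambda>x. f (snd x))"
  by (rule continuous_on_compose2[OF assms]; auto intro!: continuous_intros simp: cbox_Pair_eq)+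

lemma kform_continuous:
  assumes "continuous_on {0..1} f" "continuous_on {0..1} g" "\<eta> > 0"
  shows "continuous_on (cbox (0, 0) (1, 1)) (\<lambda>(u, v). (f u - f v) * (g u - g v) * kern \<gamma> \<eta> u v)"
  unfolding case_prod_beta'
  by (intro continuous_intros continuous_on_fst_snd assms)

lemmas kform_integrable = integrable_continuous[OF kform_continuous]

lemma kform_nonneg:
  assumes "continuous_on {0..1} f" "\<eta> > 0"
  shows "0 \<le> kform \<gamma> \<eta> f f"
  unfolding kform_def
  by (rule integral_nonneg[OF kform_integrable[OF assms(1,1,2)]]) (auto simp: kern_nonneg)

lemma kform_mono:
  assumes "continuous_on {0..1} f" "\<gamma> > 1" "0 < \<eta>'" "\<eta>' \<le> \<eta>"
  shows "kform \<gamma> \<eta> f f \<le> kform \<gamma> \<eta>' f f"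
  unfolding kform_def
  by (rule integral_le) (use assms in \<open>auto intro!: kform_integrable mult_left_mono kern_mono\<close>)

lemma kform_diff_right:
  assumes "continuous_on {0..1} w" "continuous_on {0..1} f" "continuous_on {0..1} g" "\<eta> > 0"
  shows "kform \<gamma> \<eta> w (\<lambda>u. f u - g u) = kform \<gamma> \<eta> w f - kform \<gamma> \<eta> w g"
proof -
  have "kform \<gamma> \<eta> w f - kform \<gamma> \<eta> w g = integral (cbox (0, 0) (1, 1))
     (\<lambda>z. (case z of (u, v) \<Rightarrow> (w u - w v) * (f u - f v) * kern \<gamma> \<eta> u v) - (case z of (u, v) \<Rightarrow> (w u - w v) * (g u - g v) * kern \<gamma> \<eta> u v))"
    unfolding kform_def
    by (rule integral_diff[symmetric, OF kform_integrable[OF assms(1,2,4)] kform_integrable[OF assms(1,3,4)]])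
  also have "\<dots> = kform \<gamma> \<eta> w (\<lambda>u. f u - g u)"
    unfolding kform_def by (rule integral_cong) (auto simp: algebra_simps)
  finally show ?thesis by simp
qed

lemma kform_commute: "kform \<gamma> \<eta> f g = kform \<gamma> \<eta> g f"
  by (simp add: kform_def mult.commute mult.left_commute)

lemma kform_diff_self_le:
  assumes "continuous_on {0..1} f" "continuous_on {0..1} g" "\<eta> > 0"
  shows "kform \<gamma> \<eta> (\<lambda>u. f u - g u) (\<lambda>u. f u - g u) \<le> 2 * kform \<gamma> \<eta> f f + 2 * kform \<gamma> \<eta> g g"
proof -
  have "kform \<gamma> \<eta> (\<lambda>u. f u - g u) (\<lambda>u. f u - g u) \<le>
    integral (cbox (0, 0) (1, 1)) (\<lambda>z. 2 * (case z of (u, v) \<Rightarrow> (f u - f v) * (f u - f v) * kern \<gamma> \<eta> u v)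
      + 2 * (case z of (u, v) \<Rightarrow> (g u - g v) * (g u - g v) * kern \<gamma> \<eta> u v))"
    unfolding kform_def
  proof (rule integral_le)
    show "(\<lambda>(u, v). (f u - g u - (f v - g v)) * (f u - g u - (f v - g v)) * kern \<gamma> \<eta> u v) integrable_on cbox (0, 0) (1, 1)"
      using assms by (intro kform_integrable continuous_intros)
    show "(\<lambda>z. 2 * (case z of (u, v) \<Rightarrow> (f u - f v) * (f u - f v) * kern \<gamma> \<eta> u v)
      + 2 * (case z of (u, v) \<Rightarrow> (g u - g v) * (g u - g v) * kern \<gamma> \<eta> u v)) integrable_on cbox (0, 0) (1, 1)"
      using assms by (intro integrable_add integrable_on_mult_right kform_integrable)
    have sq: "(a - b) * (a - b) * k \<le> 2 * (a * a * k) + 2 * (b * b * k)" if "k \<ge> 0" for a b k :: real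
      using mult_right_mono[OF zero_le_power2[of "a + b"] that] by (simp add: power2_eq_square algebra_simps)
    have e: "f u - g u - (f v - g v) = (f u - f v) - (g u - g v)" for u v by simp
    from sq[OF kern_nonneg, of "f (fst z) - f (snd z)" "g (fst z) - g (snd z)" \<gamma> \<eta> "fst z" "snd z" for z]
    show "(case z of (u, v) \<Rightarrow> (f u - g u - (f v - g v)) * (f u - g u - (f v - g v)) * kern \<gamma> \<eta> u v)
      \<le> 2 * (case z of (u, v) \<Rightarrow> (f u - f v) * (f u - f v) * kern \<gamma> \<eta> u v)
      + 2 * (case z of (u, v) \<Rightarrow> (g u - g v) * (g u - g v) * kern \<gamma> \<eta> u v)" for z
      by (simp only: case_prod_beta' e)
  qed
  also have "\<dots> = 2 * kform \<gamma> \<eta> f f + 2 * kform \<gamma> \<eta> g g"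
    unfolding kform_def using assms
    by (subst integral_add) (auto intro!: integrable_on_mult_right kform_integrable)
  finally show ?thesis .
qed

text \<open>The bound degenerates as \<eta> tends to 0. It is used at one fixed \<eta>, to pass to
  uniform limits in one argument.\<close>

lemma kform_bound:
  assumes w: "continuous_on {0..1} w" and h: "continuous_on {0..1} h" and "\<eta> > 0" "\<gamma> > 1"
    and M: "\<And>u. u \<in> {0..1} \<Longrightarrow> \<bar>w u\<bar> \<le> M" and D: "\<And>u. u \<in> {0..1} \<Longrightarrow> \<bar>h u\<bar> \<le> D"
  shows "\<bar>kform \<gamma> \<eta> w h\<bar> \<le> 4 * M * D * \<eta> powr (- (1 + \<gamma>))"
proof -
  have MD: "M \<ge> 0" "D \<ge> 0" using M[of 0] D[of 0] by auto
  have "norm (kform \<gamma> \<eta> w h) \<le> (4 * M * D * \<eta> powr (- (1 + \<gamma>))) * measure lborel (cbox (0::real, 0::real) (1, 1))"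
    unfolding kform_def
  proof (rule has_integral_bound[OF _ integrable_integral[OF kform_integrable[OF w h]]])
    fix z :: "real \<times> real" assume z: "z \<in> cbox (0, 0) (1, 1)"
    obtain u v where uv: "z = (u, v)" by (cases z)
    have "\<bar>w u - w v\<bar> \<le> 2 * M" "\<bar>h u - h v\<bar> \<le> 2 * D"
      using M[of u] M[of v] D[of u] D[of v] z uv by (auto simp: cbox_Pair_eq)
    then have "\<bar>w u - w v\<bar> * \<bar>h u - h v\<bar> * kern \<gamma> \<eta> u v \<le> (2 * M) * (2 * D) * \<eta> powr (- (1 + \<gamma>))"
      using MD kern_le[OF assms(4,3)] by (intro mult_mono) (auto simp: kern_nonneg)
    then show "norm (case z of (u, v) \<Rightarrow> (w u - w v) * (h u - h v) * kern \<gamma> \<eta> u v) \<le> 4 * M * D * \<eta> powr (- (1 + \<gamma>))"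
      by (simp add: uv abs_mult kern_nonneg)
  qed (use assms MD in auto)
  then show ?thesis by (simp add: content_Pair)
qed

text \<open>Young's inequality for the positive semidefinite form \<open>kform \<gamma> \<eta>' - kform \<gamma> \<eta>\<close>.\<close>

lemma kform_young:
  assumes f: "continuous_on {0..1} f" and g: "continuous_on {0..1} g"
    and \<eta>: "\<gamma> > 1" "0 < \<eta>'" "\<eta>' \<le> \<eta>" and "t > 0"
  shows "2 * \<bar>kform \<gamma> \<eta>' f g - kform \<gamma> \<eta> f g\<bar> \<le>
    t * (kform \<gamma> \<eta>' f f - kform \<gamma> \<eta> f f) + (kform \<gamma> \<eta>' g g - kform \<gamma> \<eta> g g) / t"
proof -
  let ?Q = "cbox (0::real, 0::real) (1, 1)"
  let ?I = "\<lambda>a b \<eta> z. case z of (u, v) \<Rightarrow> (a u - a v) * (b u - b v) * kern \<gamma> \<eta> u v"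
  have int: "?I a b e integrable_on ?Q" if "e > 0" "a \<in> {f, g}" "b \<in> {f, g}" for a b e
    using that f g by (auto intro!: kform_integrable)
  have \<eta>0: "\<eta> > 0" using \<eta> by simp
  have eq: "kform \<gamma> \<eta>' a b - kform \<gamma> \<eta> a b = integral ?Q (\<lambda>z. ?I a b \<eta>' z - ?I a b \<eta> z)" if "a \<in> {f, g}" "b \<in> {f, g}" for a b
    unfolding kform_def by (rule integral_diff[symmetric]) (use int that \<eta>(2) \<eta>0 in blast)+
  have "s * (2 * (kform \<gamma> \<eta>' f g - kform \<gamma> \<eta> f g)) \<le>
    t * (kform \<gamma> \<eta>' f f - kform \<gamma> \<eta> f f) + (kform \<gamma> \<eta>' g g - kform \<gamma> \<eta> g g) / t" if s: "s = 1 \<or> s = -1" for s :: real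
  proof -
    have d: "(\<lambda>z. ?I a b \<eta>' z - ?I a b \<eta> z) integrable_on ?Q" if "a \<in> {f, g}" "b \<in> {f, g}" for a b
      using int[OF \<eta>(2) that] int[OF \<eta>0 that] by (rule integrable_diff)
    have "integral ?Q (\<lambda>z. s * (2 * (?I f g \<eta>' z - ?I f g \<eta> z))) \<le>
       integral ?Q (\<lambda>z. t * (?I f f \<eta>' z - ?I f f \<eta> z) + (?I g g \<eta>' z - ?I g g \<eta> z) / t)"
    proof (rule integral_le)
      show "(\<lambda>z. s * (2 * (?I f g \<eta>' z - ?I f g \<eta> z))) integrable_on ?Q"
        by (intro integrable_on_mult_right d) auto
      show "(\<lambda>z. t * (?I f f \<eta>' z - ?I f f \<eta> z) + (?I g g \<eta>' z - ?I g g \<eta> z) / t) integrable_on ?Q"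
        by (intro integrable_add integrable_on_mult_right integrable_on_divide d) auto
      fix z :: "real \<times> real"
      obtain u v where z: "z = (u, v)" by (cases z)
      let ?a = "f u - f v" and ?b = "g u - g v" and ?k = "kern \<gamma> \<eta>' u v - kern \<gamma> \<eta> u v"
      have k: "?k \<ge> 0" using kern_mono[OF \<eta>] by simp
      have "0 \<le> (t * ?a - s * ?b)\<^sup>2 / t" using \<open>t > 0\<close> by simp
      also have "\<dots> = t * ?a\<^sup>2 - s * (2 * (?a * ?b)) + ?b\<^sup>2 / t"
        using \<open>t > 0\<close> s by (auto simp: power2_eq_square field_simps)
      finally have "s * (2 * (?a * ?b)) * ?k \<le> (t * ?a\<^sup>2 + ?b\<^sup>2 / t) * ?k"
        using k by (intro mult_right_mono) auto
      then show "s * (2 * (?I f g \<eta>' z - ?I f g \<eta> z)) \<le> t * (?I f f \<eta>' z - ?I f f \<eta> z) + (?I g g \<eta>' z - ?I g g \<eta> z) / t"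
        by (simp add: z power2_eq_square algebra_simps add_divide_distrib diff_divide_distrib)
    qed
    also have "integral ?Q (\<lambda>z. s * (2 * (?I f g \<eta>' z - ?I f g \<eta> z))) = s * (2 * (kform \<gamma> \<eta>' f g - kform \<gamma> \<eta> f g))"
      by (simp add: eq)
    also have "integral ?Q (\<lambda>z. t * (?I f f \<eta>' z - ?I f f \<eta> z) + (?I g g \<eta>' z - ?I g g \<eta> z) / t)
       = t * (kform \<gamma> \<eta>' f f - kform \<gamma> \<eta> f f) + (kform \<gamma> \<eta>' g g - kform \<gamma> \<eta> g g) / t"
      by (subst integral_add, (intro integrable_on_mult_right integrable_on_divide d; simp)+) (simp add: eq)
    finally show ?thesis .
  qed
  from this[of 1] this[of "-1"] show ?thesis by (simp add: abs_if)
qed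

text \<open>The energy of \<open>w\<close> near the diagonal is small because \<open>kform \<gamma> \<eta> w w\<close> is monotone and bounded as
  \<open>\<eta> \<rightarrow> 0\<close>; by Young's inequality the limit \<open>\<eta> \<rightarrow> 0\<close> is then uniform in \<open>k\<close>.\<close>

lemma kform_weak_closure:
  assumes \<gamma>: "\<gamma> > 1" and w: "continuous_on {0..1} w" and A: "\<And>\<eta>. \<eta> \<in> {0<..1} \<Longrightarrow> kform \<gamma> \<eta> w w \<le> A"
    and g: "continuous_on {0..1} g" and gk: "\<And>k::nat. continuous_on {0..1} (gk k)"
    and lim: "uniform_limit {0..1} gk g sequentially"
    and B: "\<And>k \<eta>. \<eta> \<in> {0<..1} \<Longrightarrow> kform \<gamma> \<eta> (gk k) (gk k) \<le> B"
    and zero: "\<And>k. ((\<lambda>\<eta>. kform \<gamma> \<eta> w (gk k)) \<longlongrightarrow> 0) (at_right 0)"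
  shows "((\<lambda>\<eta>. kform \<gamma> \<eta> w g) \<longlongrightarrow> 0) (at_right 0)"
proof (rule tendstoI)
  fix e :: real assume "e > 0"
  define e' where "e' = e / 4"
  have e': "e' > 0" using \<open>e > 0\<close> by (simp add: e'_def)
  define B' where "B' = max B 1"
  have B': "B' > 0" "B \<le> B'" by (auto simp: B'_def)
  define \<epsilon> where "\<epsilon> = e'\<^sup>2 / B'"
  have \<epsilon>: "\<epsilon> > 0" using e' B' by (simp add: \<epsilon>_def)
  define S where "S = (SUP \<eta>\<in>{0<..1}. kform \<gamma> \<eta> w w)"
  have bdd: "bdd_above ((\<lambda>\<eta>. kform \<gamma> \<eta> w w) ` {0<..1})" using A by (intro bdd_aboveI2[of _ _ A])
  have "S - \<epsilon> < S" using \<epsilon> by simp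
  \<comment> \<open>The supremum \<open>S\<close> is nearly attained at \<open>\<eta>0\<close>; by
    monotonicity every smaller cap adds at most \<epsilon> to the energy of
    \<open>w\<close>.\<close>
  then obtain \<eta>0 where \<eta>0: "\<eta>0 \<in> {0<..1}" "S - \<epsilon> < kform \<gamma> \<eta>0 w w"
    unfolding S_def using bdd by (subst (asm) less_cSUP_iff) auto
  have wclose: "kform \<gamma> \<eta>' w w - kform \<gamma> \<eta> w w \<le> \<epsilon>" if "0 < \<eta>'" "\<eta>' \<le> \<eta>" "\<eta> \<le> \<eta>0" for \<eta> \<eta>'
  proof -
    have "kform \<gamma> \<eta>' w w \<le> S" unfolding S_def using that \<eta>0 by (intro cSUP_upper bdd) auto
    moreover have "kform \<gamma> \<eta>0 w w \<le> kform \<gamma> \<eta> w w" using that by (intro kform_mono w \<gamma>) auto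
    ultimately show ?thesis using \<eta>0(2) by simp
  qed
  have small: "\<bar>kform \<gamma> \<eta> w (gk k)\<bar> \<le> 2 * e'" if "0 < \<eta>" "\<eta> \<le> \<eta>0" for \<eta> k
  proof -
    have "\<forall>\<^sub>F \<eta>' in at_right 0. dist (kform \<gamma> \<eta>' w (gk k)) 0 < e'" using zero e' by (rule tendstoD)
    moreover have "\<forall>\<^sub>F \<eta>' in at_right 0. \<eta>' \<in> {0<..<\<eta>}"
      unfolding eventually_at_right_field using that(1) by (intro exI[of _ \<eta>]) auto
    ultimately have "\<forall>\<^sub>F \<eta>' in at_right 0. dist (kform \<gamma> \<eta>' w (gk k)) 0 < e' \<and> \<eta>' \<in> {0<..<\<eta>}"
      by (rule eventually_conj)
    then obtain \<eta>' where \<eta>': "\<bar>kform \<gamma> \<eta>' w (gk k)\<bar> < e'" "0 < \<eta>'" "\<eta>' \<le> \<eta>"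
      using eventually_happens[of _ "at_right (0::real)"] by (force simp: dist_real_def)
    \<comment> \<open>Balances the two terms of Young's inequality: with this choice of
      \<open>t\<close> and \<epsilon>, both \<open>t * \<epsilon>\<close> and \<open>B' / t\<close>
      equal \<open>e'\<close>.\<close>
    define t where "t = B' / e'"
    have t: "t > 0" using B' e' by (simp add: t_def)
    have "2 * \<bar>kform \<gamma> \<eta>' w (gk k) - kform \<gamma> \<eta> w (gk k)\<bar> \<le>
      t * (kform \<gamma> \<eta>' w w - kform \<gamma> \<eta> w w) + (kform \<gamma> \<eta>' (gk k) (gk k) - kform \<gamma> \<eta> (gk k) (gk k)) / t"
      by (rule kform_young[OF w gk \<gamma> \<eta>'(2,3) t])
    also have "\<dots> \<le> t * \<epsilon> + B' / t"
    proof (intro add_mono mult_left_mono divide_right_mono)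
      show "kform \<gamma> \<eta>' w w - kform \<gamma> \<eta> w w \<le> \<epsilon>" by (rule wclose) (use \<eta>' that in auto)
      have "kform \<gamma> \<eta>' (gk k) (gk k) \<le> B" by (rule B) (use \<eta>' that \<eta>0 in auto)
      moreover have "kform \<gamma> \<eta> (gk k) (gk k) \<ge> 0" by (rule kform_nonneg[OF gk that(1)])
      ultimately show "kform \<gamma> \<eta>' (gk k) (gk k) - kform \<gamma> \<eta> (gk k) (gk k) \<le> B'" using B'(2) by simp
    qed (use t in auto)
    also have "\<dots> = 2 * e'" using e' B'(1) by (simp add: t_def \<epsilon>_def power2_eq_square)
    finally show ?thesis using \<eta>'(1) by simp
  qed
  have "\<bar>kform \<gamma> \<eta> w g\<bar> \<le> 2 * e'" if \<eta>: "0 < \<eta>" "\<eta> \<le> \<eta>0" for \<eta>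
  proof (rule field_le_epsilon)
    fix d :: real assume "d > 0"
    obtain M where M: "M > 0" "\<And>u. u \<in> {0..1} \<Longrightarrow> \<bar>w u\<bar> \<le> M"
      using compact_imp_bounded[OF compact_continuous_image[OF w compact_Icc]]
      by (auto simp: bounded_pos)
    \<comment> \<open>The uniform distance at which \<open>kform_bound\<close>, at this fixed
      \<eta>, yields an error of at most \<open>d\<close>.\<close>
    define D where "D = d / (4 * M * \<eta> powr (- (1 + \<gamma>)))"
    have D: "D > 0" using M \<eta> \<open>d > 0\<close> by (simp add: D_def)
    obtain k where "\<forall>u\<in>{0..1}. dist (gk k u) (g u) < D"
      using eventually_happens[OF uniform_limitD[OF lim D]] by auto
    then have D': "\<bar>g u - gk k u\<bar> \<le> D" if "u \<in> {0..1}" for u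
      using that by (auto simp: dist_real_def abs_minus_commute intro: less_imp_le)
    have "\<bar>kform \<gamma> \<eta> w (\<lambda>u. g u - gk k u)\<bar> \<le> 4 * M * D * \<eta> powr (- (1 + \<gamma>))"
      using M D' by (intro kform_bound w continuous_intros g gk \<eta> \<gamma>) auto
    also have "\<dots> = d" using M \<eta> by (simp add: D_def)
    finally have "\<bar>kform \<gamma> \<eta> w g - kform \<gamma> \<eta> w (gk k)\<bar> \<le> d"
      using kform_diff_right[OF w g gk \<eta>(1)] by simp
    then show "\<bar>kform \<gamma> \<eta> w g\<bar> \<le> 2 * e' + d" using small[OF \<eta>, of k] by simp
  qed
  moreover have "2 * e' < e" using \<open>e > 0\<close> by (simp add: e'_def)
  ultimately have "dist (kform \<gamma> \<eta> w g) 0 < e" if "0 < \<eta>" "\<eta> \<le> \<eta>0" for \<eta>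
    using that by (force simp: dist_real_def)
  moreover have "\<forall>\<^sub>F \<eta> in at_right 0. 0 < \<eta> \<and> \<eta> < \<eta>0"
    unfolding eventually_at_right_field using \<eta>0(1) by (intro exI[of _ \<eta>0]) auto
  ultimately show "\<forall>\<^sub>F \<eta> in at_right 0. dist (kform \<gamma> \<eta> w g) 0 < e"
    by (elim eventually_mono) auto
qed

text \<open>The form increases as the cap decreases, so it vanishes already at \<eta> = 1. There the
  kernel is positive everywhere, and a nonnegative continuous integrand with zero integral
  vanishes.\<close>

lemma kform_self_tendsto_0_imp_constant:
  assumes \<gamma>: "\<gamma> > 1" and w: "continuous_on {0..1} w"
    and lim: "((\<lambda>\<eta>. kform \<gamma> \<eta> w w) \<longlongrightarrow> 0) (at_right 0)" and u: "u \<in> {0..1}" and v: "v \<in> {0..1}"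
  shows "w u = w v"
proof -
  have "\<forall>\<^sub>F \<eta> in at_right 0. kform \<gamma> 1 w w \<le> kform \<gamma> \<eta> w w"
    unfolding eventually_at_right_field by (intro exI[of _ 1]) (auto intro: kform_mono w \<gamma>)
  then have "kform \<gamma> 1 w w \<le> 0"
    by (rule tendsto_lowerbound[OF lim]) simp
  then have "kform \<gamma> 1 w w = 0" using kform_nonneg[OF w, of 1] by (simp add: order_antisym)
  then have "\<forall>z\<in>cbox (0, 0) (1, 1). (case z of (u, v) \<Rightarrow> (w u - w v) * (w u - w v) * kern \<gamma> 1 u v) = 0"
    unfolding kform_def
  proof (subst (asm) integral_cbox_eq_0_iff)
    have "(1 / 2, 1 / 2) \<in> box (0::real, 0::real) (1, 1)" by (auto simp: mem_box Basis_prod_def)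
    then show "box (0::real, 0::real) (1, 1) \<noteq> {}" by blast
  qed (use w in \<open>auto intro!: kform_continuous simp: kern_nonneg\<close>)
  moreover have "kern \<gamma> 1 u v > 0" by (simp add: kern_def)
  ultimately show ?thesis using u v by (force simp: cbox_Pair_eq)
qed

section \<open>Uniqueness for the stationary problem\<close>

text \<open>A class of kernels containing the bump and closed under differentiation, in the spirit
  of \<open>cutoff_alg\<close>; derivatives of a mollified function keep a kernel of this
  class.\<close>

inductive bump_alg :: "(real \<Rightarrow> real) \<Rightarrow> bool" where
  left: "bump_alg (\<lambda>t. exp_flat p (1 - t))"
| right: "bump_alg (\<lambda>t. exp_flat p (1 + t))"
| const: "bump_alg (\<lambda>t. c)"
| add: "bump_alg f \<Longrightarrow> bump_alg g \<Longrightarrow> bump_alg (\<lambda>t. f t + g t)"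
| mult: "bump_alg f \<Longrightarrow> bump_alg g \<Longrightarrow> bump_alg (\<lambda>t. f t * g t)"

lemma bump_alg_deriv:
  "bump_alg f \<Longrightarrow> \<exists>f'. bump_alg f' \<and> (\<forall>t. (f has_real_derivative f' t) (at t))"
proof (induction rule: bump_alg.induct)
  case (left p)
  have "((\<lambda>t. exp_flat p (1 - t)) has_real_derivative exp_flat (exp_flat_deriv p) (1 - t) * (- 1)) (at t)" for t
    by (rule DERIV_chain2[OF exp_flat_has_derivative]) (auto intro!: derivative_eq_intros)
  moreover have "bump_alg (\<lambda>t. exp_flat (exp_flat_deriv p) (1 - t) * (- 1))" by (intro bump_alg.intros)
  ultimately show ?case by blast
next
  case (right p)
  have "((\<lambda>t. exp_flat p (1 + t)) has_real_derivative exp_flat (exp_flat_deriv p) (1 + t) * 1) (at t)" for t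
    by (rule DERIV_chain2[OF exp_flat_has_derivative]) (auto intro!: derivative_eq_intros)
  moreover have "bump_alg (\<lambda>t. exp_flat (exp_flat_deriv p) (1 + t) * 1)" by (intro bump_alg.intros)
  ultimately show ?case by blast
next
  case (const c)
  show ?case by (intro exI[of _ "\<lambda>_. 0"]) (auto intro: bump_alg.const)
next
  case (add f g)
  then obtain f' g' where *: "bump_alg f'" "bump_alg g'" "\<And>t. (f has_real_derivative f' t) (at t)" "\<And>t. (g has_real_derivative g' t) (at t)"
    by blast
  have "((\<lambda>t. f t + g t) has_real_derivative f' t + g' t) (at t)" for t
    by (intro DERIV_add *)
  then show ?case using bump_alg.add[OF *(1,2)] by blast
next
  case (mult f g)
  then obtain f' g' where *: "bump_alg f'" "bump_alg g'" "\<And>t. (f has_real_derivative f' t) (at t)" "\<And>t. (g has_real_derivative g' t) (at t)"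
    by blast
  have "((\<lambda>t. f t * g t) has_real_derivative f' t * g t + g' t * f t) (at t)" for t
    by (intro DERIV_mult *)
  moreover have "bump_alg (\<lambda>t. f' t * g t + g' t * f t)" by (intro bump_alg.add bump_alg.mult * mult.hyps)
  ultimately show ?case by blast
qed

lemma bump_alg_continuous: "bump_alg f \<Longrightarrow> continuous_on A f"
  using bump_alg_deriv DERIV_continuous_on DERIV_subset by (metis top_greatest)

definition bump :: "real \<Rightarrow> real" where
  "bump t = exp_flat 1 (1 - t) * exp_flat 1 (1 + t)"

lemma bump_alg_bump: "bump_alg bump"
  unfolding bump_def[abs_def] by (intro bump_alg.intros)

lemma bump_nonneg: "0 \<le> bump t"
  by (simp add: bump_def exp_flat_1_nonneg)

lemma bump_eq_0: "\<not> (-1 < t \<and> t < 1) \<Longrightarrow> bump t = 0"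
  by (auto simp: bump_def exp_flat_eq_0)

lemma continuous_on_bump [continuous_intros]: "continuous_on A f \<Longrightarrow> continuous_on A (\<lambda>x. bump (f x))"
  by (rule continuous_on_compose2[OF bump_alg_continuous[OF bump_alg_bump, of UNIV]]) auto

definition bump_mass :: real where
  "bump_mass = integral {-1..1} bump"

lemma bump_integrable: "bump integrable_on {-1..1}"
  by (intro integrable_continuous_real bump_alg_continuous bump_alg_bump)

lemma bump_mass_pos: "bump_mass > 0"
proof -
  have "bump_mass \<ge> 0" unfolding bump_mass_def by (intro integral_nonneg bump_integrable) (simp add: bump_nonneg)
  moreover have "bump_mass \<noteq> 0"
  proof
    assume "bump_mass = 0"
    then have "bump 0 = 0" unfolding bump_mass_def
      by (subst (asm) integral_eq_0_iff) (auto simp: bump_nonneg intro!: bump_alg_continuous bump_alg_bump)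
    then show False by (simp add: bump_def exp_flat_def)
  qed
  ultimately show ?thesis by simp
qed

definition mollify :: "real \<Rightarrow> (real \<Rightarrow> real) \<Rightarrow> real \<Rightarrow> real" where
  "mollify h W u = integral {-1..1} (\<lambda>t. bump t * W (u - h * t)) / bump_mass"

lemma integral_eq_lebesgue_integral:
  fixes F :: "real \<Rightarrow> real"
  assumes "continuous_on {a..b} F" "\<And>x. x \<notin> {a..b} \<Longrightarrow> F x = 0"
  shows "integral {a..b} F = (\<integral>x. F x \<partial>lborel)"
proof -
  have "(\<integral>x. F x \<partial>lborel) = (LINT x:{a..b}|lborel. F x)"
    unfolding set_lebesgue_integral_def by (intro Bochner_Integration.integral_cong) (use assms(2) in \<open>auto simp: indicator_def\<close>)
  also have "\<dots> = integral {a..b} F"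
    by (intro set_borel_integral_eq_integral borel_integrable_atLeastAtMost' assms)
  finally show ?thesis by simp
qed

text \<open>The substitution s = u - h t moves the dependence on \<open>u\<close> from the merely
  continuous \<open>W\<close> into the smooth kernel, so that differentiation under the integral is
  possible.\<close>

lemma mollify_eq:
  assumes W: "continuous_on UNIV W" "\<And>x. x \<notin> {0..1} \<Longrightarrow> W x = 0" and h: "h > 0"
  shows "mollify h W u = integral {0..1} (\<lambda>s. (1 / (h * bump_mass) * bump ((u - s) / h)) * W s)"
proof -
  have Wc: "continuous_on A (\<lambda>x. W (f x))" if "continuous_on A f" for A and f :: "real \<Rightarrow> real"
    by (rule continuous_on_compose2[OF W(1) that]) auto
  have "integral {0..1} (\<lambda>s. bump ((u - s) / h) * W s) = (\<integral>s. bump ((u - s) / h) * W s \<partial>lborel)"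
    by (rule integral_eq_lebesgue_integral) (use W(2) h in \<open>auto intro!: continuous_intros Wc\<close>)
  also have "\<dots> = h * (\<integral>t. bump ((u - (u + - h * t)) / h) * W (u + - h * t) \<partial>lborel)"
    using lborel_integral_real_affine[of "- h" "\<lambda>s. bump ((u - s) / h) * W s" u] h by simp
  also have "(\<integral>t. bump ((u - (u + - h * t)) / h) * W (u + - h * t) \<partial>lborel) = (\<integral>t. bump t * W (u - h * t) \<partial>lborel)"
    using h by simp
  also have "\<dots> = integral {-1..1} (\<lambda>t. bump t * W (u - h * t))"
    by (rule integral_eq_lebesgue_integral[symmetric]) (auto intro!: continuous_intros Wc simp: bump_eq_0)
  finally have "integral {-1..1} (\<lambda>t. bump t * W (u - h * t)) = integral {0..1} (\<lambda>s. bump ((u - s) / h) * W s) / h"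
    using h by simp
  then show ?thesis
    unfolding mollify_def by (simp add: mult.assoc)
qed

text \<open>The closed class consists of the integrals of \<open>W\<close> against rescaled members
  of \<open>bump_alg\<close>; Leibniz' rule differentiates only the kernel.\<close>

lemma mollify_smooth:
  assumes W: "continuous_on UNIV W" "\<And>x. x \<notin> {0..1} \<Longrightarrow> W x = 0" and h: "h > 0"
  shows "(deriv ^^ k) (mollify h W) differentiable (at u)"
proof (rule smooth_if_in_closed_class)
  let ?S = "{F. \<exists>r. bump_alg r \<and> F = (\<lambda>u. integral {0..1} (\<lambda>s. r ((u - s) / h) * W s))}"
  have "bump_alg (\<lambda>t. 1 / (h * bump_mass) * bump t)" by (intro bump_alg.mult bump_alg.const bump_alg_bump)
  then show "mollify h W \<in> ?S" using mollify_eq[OF assms] by blast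
  fix F assume "F \<in> ?S"
  then obtain r where r: "bump_alg r" and F: "F = (\<lambda>u. integral {0..1} (\<lambda>s. r ((u - s) / h) * W s))" by blast
  obtain r' where r': "bump_alg r'" "\<And>t. (r has_real_derivative r' t) (at t)" using bump_alg_deriv[OF r] by blast
  have alg: "bump_alg (\<lambda>t. r' t * (1 / h))" by (intro bump_alg.mult bump_alg.const r')
  have D: "(F has_real_derivative integral {0..1} (\<lambda>s. (r' ((u - s) / h) * (1 / h)) * W s)) (at u)" for u
  proof -
    have "((\<lambda>u. integral (cbox 0 1) (\<lambda>s. r ((u - s) / h) * W s)) has_field_derivative
        integral (cbox 0 1) (\<lambda>s. (r' ((u - s) / h) * (1 / h)) * W s)) (at u within UNIV)"
    proof (rule leibniz_rule_field_derivative)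
      have "((\<lambda>x. (x - t) / h) has_real_derivative 1 / h) (at x)" for t x
        by (intro DERIV_cdivide) (auto intro!: derivative_eq_intros)
      from DERIV_cmult_right[OF DERIV_chain2[OF r'(2) this]]
      show "((\<lambda>x. r ((x - t) / h) * W t) has_field_derivative (r' ((x - t) / h) * (1 / h)) * W t) (at x within UNIV)" for t x .
      show "(\<lambda>s. r ((x - s) / h) * W s) integrable_on cbox 0 1" for x
        by (intro integrable_continuous continuous_intros continuous_on_compose2[OF bump_alg_continuous[OF r, of UNIV]] continuous_on_subset[OF W(1)])
           (use h in auto)
      show "continuous_on (UNIV \<times> cbox 0 1) (\<lambda>(x, t). (r' ((x - t) / h) * (1 / h)) * W t)"
        unfolding case_prod_beta'
        by (intro continuous_intros continuous_on_compose2[OF bump_alg_continuous[OF r'(1), of UNIV]] continuous_on_compose2[OF W(1)])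
           (use h in auto)
    qed auto
    then show ?thesis by (simp add: F)
  qed
  show "\<exists>h'\<in>?S. \<forall>u. (F has_real_derivative h' u) (at u)"
    using D alg by (intro bexI[of _ "\<lambda>u. integral {0..1} (\<lambda>s. (r' ((u - s) / h) * (1 / h)) * W s)"]) auto
qed

lemma mollify_test_unit:
  assumes W: "continuous_on UNIV W" "\<And>x. x \<notin> {a..1 - a} \<Longrightarrow> W x = 0" and h: "0 < h" "h < a"
  shows "mollify h W \<in> test_unit"
proof -
  have W': "W x = 0" if "x \<notin> {0..1}" for x using W(2)[of x] that h by auto
  have "mollify h W u = 0" if "u \<notin> {a - h..1 - a + h}" for u
  proof -
    have z: "W (u - h * t) = 0" if "t \<in> {-1..1}" for t
    proof (rule W(2))
      have "\<bar>h * t\<bar> \<le> h" using that h by (auto simp: abs_mult intro: mult_left_le)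
      then show "u - h * t \<notin> {a..1 - a}" using \<open>u \<notin> _\<close> by auto
    qed
    have "integral {-1..1} (\<lambda>t. bump t * W (u - h * t)) = integral {-1..1} (\<lambda>t::real. 0)"
      by (rule integral_cong) (use z in auto)
    then show ?thesis by (simp add: mollify_def)
  qed
  then have "{u. mollify h W u \<noteq> 0} \<subseteq> {a - h..1 - a + h}" by blast
  then have cl: "closure {u. mollify h W u \<noteq> 0} \<subseteq> {a - h..1 - a + h}"
    by (rule closure_minimal) simp
  have "compact (closure {u. mollify h W u \<noteq> 0})"
    unfolding compact_closure
    by (rule bounded_subset[OF bounded_closed_interval order_trans[OF closure_subset cl]])
  moreover have "closure {u. mollify h W u \<noteq> 0} \<subseteq> {0<..<1}" using cl h by force
  ultimately show ?thesis
    using mollify_smooth[OF W(1) W' h(1)] by (simp add: test_unit_def)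
qed

text \<open>Jensen's inequality for the probability density \<open>bump / bump_mass\<close>,
  obtained from the tangent line of the square at the mean \<open>x\<close>.\<close>

lemma bump_average_square_le:
  assumes D: "continuous_on {-1..1} D"
  shows "(integral {-1..1} (\<lambda>t. bump t * D t) / bump_mass)\<^sup>2 \<le> integral {-1..1} (\<lambda>t. bump t * (D t)\<^sup>2) / bump_mass"
proof -
  define x where "x = integral {-1..1} (\<lambda>t. bump t * D t) / bump_mass"
  have i: "(\<lambda>t. bump t * D t) integrable_on {-1..1}" "(\<lambda>t. bump t * (D t)\<^sup>2) integrable_on {-1..1}"
    by (intro integrable_continuous_real continuous_intros D)+
  have "integral {-1..1} (\<lambda>t. (2 * x) * (bump t * D t) - x\<^sup>2 * bump t) \<le> integral {-1..1} (\<lambda>t. bump t * (D t)\<^sup>2)"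
  proof (rule integral_le[OF _ i(2)])
    show "(\<lambda>t. (2 * x) * (bump t * D t) - x\<^sup>2 * bump t) integrable_on {-1..1}"
      by (intro integrable_diff integrable_on_mult_right i bump_integrable)
    fix t show "(2 * x) * (bump t * D t) - x\<^sup>2 * bump t \<le> bump t * (D t)\<^sup>2"
      using mult_left_mono[OF zero_le_power2[of "D t - x"] bump_nonneg[of t]] by (simp add: power2_eq_square algebra_simps)
  qed
  also have "integral {-1..1} (\<lambda>t. (2 * x) * (bump t * D t) - x\<^sup>2 * bump t) = (2 * x) * (x * bump_mass) - x\<^sup>2 * bump_mass"
    using bump_mass_pos
    by (subst integral_diff[OF integrable_on_mult_right[OF i(1)] integrable_on_mult_right[OF bump_integrable]])
       (simp add: x_def bump_mass_def)
  also have "\<dots> = x\<^sup>2 * bump_mass" by (simp add: power2_eq_square)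
  finally show ?thesis unfolding x_def[symmetric] using bump_mass_pos by (simp add: field_simps)
qed

text \<open>The kernel depends on u - v only, so the shift moves to the domain, and the shifted
  square lies in [-1,2]^2 of area 9. Outside the unit square, at least one point lies off [0,1]; the
  integrand is nonzero only if the other one lies in the support, hence at distance at least
  \<open>a\<close>.\<close>

lemma shifted_energy_bound:
  assumes \<gamma>: "\<gamma> > 1" and W: "continuous_on UNIV W" and supp: "\<And>x. x \<notin> {a..1 - a} \<Longrightarrow> W x = 0" and a: "a > 0"
    and M: "\<And>x. \<bar>W x\<bar> \<le> M" and c: "\<bar>c\<bar> \<le> 1" and \<eta>: "\<eta> > 0"
  shows "integral (cbox (0, 0) (1, 1)) (\<lambda>z. (W (fst z + c) - W (snd z + c))\<^sup>2 * kern \<gamma> \<eta> (fst z) (snd z))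
     \<le> kform \<gamma> \<eta> W W + 9 * (M\<^sup>2 * a powr (- (1 + \<gamma>)))"
proof -
  let ?F = "\<lambda>z. (W (fst z) - W (snd z))\<^sup>2 * kern \<gamma> \<eta> (fst z) (snd z)"
  let ?L = "M\<^sup>2 * a powr (- (1 + \<gamma>))"
  let ?Q = "cbox (0::real, 0::real) (1, 1)" and ?T = "cbox (-1::real, -1::real) (2, 2)"
  have QT: "?Q \<subseteq> ?T" by (auto simp: cbox_Pair_eq)
  have cont: "continuous_on A ?F" for A
    by (intro continuous_intros \<eta> continuous_on_compose2[OF W]) auto
  have int: "?F integrable_on cbox p q" for p q by (intro integrable_continuous cont)
  have "integral ?Q (\<lambda>z. (W (fst z + c) - W (snd z + c))\<^sup>2 * kern \<gamma> \<eta> (fst z) (snd z)) = integral ?Q (?F \<circ> ((+) (c, c)))"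
    by (intro integral_cong) (simp add: kern_def add.commute)
  also have "\<dots> = integral (cbox ((0, 0) + (c, c)) ((1, 1) + (c, c))) ?F"
    by (rule integral_shift_cbox_plus)
  also have "\<dots> \<le> integral ?T ?F"
    by (rule integral_subset_le[OF _ int int]) (use c in \<open>auto simp: cbox_Pair_eq kern_nonneg\<close>)
  also have "\<dots> \<le> integral ?T (\<lambda>z. (if z \<in> ?Q then ?F z else 0) + ?L)"
  proof (rule integral_le[OF int])
    have r: "(\<lambda>z. if z \<in> ?Q then ?F z else 0) integrable_on ?T"
    proof (rule has_integral_integrable)
      show "((\<lambda>z. if z \<in> ?Q then ?F z else 0) has_integral integral ?Q ?F) ?T"
        unfolding has_integral_restrict[OF QT] by (rule integrable_integral[OF int])
    qed
    then show "(\<lambda>z. (if z \<in> ?Q then ?F z else 0) + ?L) integrable_on ?T"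
      by (rule integrable_add) (rule integrable_const)
    fix z :: "real \<times> real"
    obtain u v where z: "z = (u, v)" by (cases z)
    have one: "(W u)\<^sup>2 * kern \<gamma> \<eta> u v \<le> ?L" if "v \<notin> {0..1}" for u v
    proof (cases "u \<in> {a..1 - a}")
      case True
      then have "\<bar>u - v\<bar> \<ge> a" using that by auto
      then have "kern \<gamma> \<eta> u v \<le> a powr (- (1 + \<gamma>))"
        unfolding kern_def using a \<gamma> by (intro powr_mono2') auto
      moreover have "(W u)\<^sup>2 \<le> M\<^sup>2" using M[of u] by (simp add: abs_le_square_iff[symmetric])
      ultimately show ?thesis by (intro mult_mono) (auto simp: kern_nonneg)
    qed (use supp in simp)
    show "?F z \<le> (if z \<in> ?Q then ?F z else 0) + ?L"
    proof (cases "z \<in> ?Q")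
      case False
      then consider "v \<notin> {0..1}" | "u \<notin> {0..1}" by (auto simp: z cbox_Pair_eq)
      then show ?thesis
      proof cases
        case 1
        then have "W v = 0" using supp a by auto
        then show ?thesis using one[OF 1, of u] False by (simp add: z)
      next
        case 2
        then have "W u = 0" using supp a by auto
        then show ?thesis using one[OF 2, of v] False by (simp add: z kern_commute)
      qed
    qed simp
  qed
  also have "\<dots> = integral ?Q ?F + 9 * ?L"
  proof -
    have r: "((\<lambda>z. if z \<in> ?Q then ?F z else 0) has_integral integral ?Q ?F) ?T"
      unfolding has_integral_restrict[OF QT] by (rule integrable_integral[OF int])
    have "((\<lambda>z. (if z \<in> ?Q then ?F z else 0) + ?L) has_integral integral ?Q ?F + measure lborel ?T *\<^sub>R ?L) ?T"
      by (intro has_integral_add r has_integral_const)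
    then show ?thesis by (simp add: integral_unique content_Pair)
  qed
  also have "integral ?Q ?F = kform \<gamma> \<eta> W W"
    unfolding kform_def by (intro integral_cong) (auto simp: power2_eq_square)
  finally show ?thesis .
qed

lemma continuous_on_mollify:
  assumes W: "continuous_on UNIV W"
  shows "continuous_on A (mollify h W)"
proof -
  have "continuous_on (A \<times> cbox (-1) 1) (\<lambda>z. bump (snd z) * W (fst z - h * snd z))"
    by (intro continuous_intros continuous_on_compose2[OF W]) auto
  then have "continuous_on A (\<lambda>u. integral (cbox (-1) 1) (\<lambda>t. bump t * W (u - h * t)))"
    by (intro integral_continuous_on_param) (simp add: case_prod_beta')
  then show ?thesis unfolding mollify_def[abs_def] by (intro continuous_intros) (use bump_mass_pos in auto)
qed

text \<open>A mollified function averages translates of \<open>W\<close>: Jensen's inequality is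
  applied pointwise, the integrals are exchanged, and each translate is estimated by
  \<open>shifted_energy_bound\<close>. The result depends neither on \<open>h\<close> nor, beyond
  the energy of \<open>W\<close>, on \<eta>.\<close>

lemma mollify_energy_bound:
  assumes \<gamma>: "\<gamma> > 1" and W: "continuous_on UNIV W" and supp: "\<And>x. x \<notin> {a..1 - a} \<Longrightarrow> W x = 0" and a: "a > 0"
    and M: "\<And>x. \<bar>W x\<bar> \<le> M" and h: "0 < h" "h \<le> 1" and \<eta>: "\<eta> > 0"
  shows "kform \<gamma> \<eta> (mollify h W) (mollify h W) \<le> kform \<gamma> \<eta> W W + 9 * (M\<^sup>2 * a powr (- (1 + \<gamma>)))"
proof -
  let ?Q = "cbox (0::real, 0::real) (1, 1)"
  let ?B = "kform \<gamma> \<eta> W W + 9 * (M\<^sup>2 * a powr (- (1 + \<gamma>)))"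
  let ?D = "\<lambda>z t. W (fst z - h * t) - W (snd z - h * t)"
  let ?f = "\<lambda>z t. bump t * (?D z t)\<^sup>2 * kern \<gamma> \<eta> (fst z) (snd z)"
  have Wc: "continuous_on A (\<lambda>x. W (f x))" if "continuous_on A f" for A :: "'b::topological_space set" and f
    by (rule continuous_on_compose2[OF W that]) auto
  have cont2: "continuous_on (cbox (((0, 0), -1) :: (real \<times> real) \<times> real) ((1, 1), 1)) (\<lambda>(z, t). ?f z t)"
    unfolding case_prod_beta' by (intro continuous_intros Wc \<eta>)
  have swap: "integral ?Q (\<lambda>z. integral {-1..1} (?f z)) = integral {-1..1} (\<lambda>t. integral ?Q (\<lambda>z. ?f z t))"
    using integral_swap_continuous[OF cont2] by simp
  have pt: "(mollify h W (fst z) - mollify h W (snd z)) * (mollify h W (fst z) - mollify h W (snd z)) * kern \<gamma> \<eta> (fst z) (snd z)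
      \<le> integral {-1..1} (?f z) / bump_mass" for z :: "real \<times> real"
  proof -
    have "mollify h W (fst z) - mollify h W (snd z) = integral {-1..1} (\<lambda>t. bump t * ?D z t) / bump_mass"
      unfolding mollify_def diff_divide_distrib[symmetric] right_diff_distrib
      by (subst integral_diff) (auto intro!: integrable_continuous_real continuous_intros Wc)
    then have "(mollify h W (fst z) - mollify h W (snd z))\<^sup>2 \<le> integral {-1..1} (\<lambda>t. bump t * (?D z t)\<^sup>2) / bump_mass"
    proof -
      assume *: "mollify h W (fst z) - mollify h W (snd z) = integral {-1..1} (\<lambda>t. bump t * ?D z t) / bump_mass"
      have "continuous_on {-1..1} (?D z)" by (intro continuous_intros Wc)
      from bump_average_square_le[OF this] show ?thesis unfolding * .
    qed
    from mult_right_mono[OF this kern_nonneg] show ?thesis by (simp add: power2_eq_square)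
  qed
  have "kform \<gamma> \<eta> (mollify h W) (mollify h W) \<le> integral ?Q (\<lambda>z. integral {-1..1} (?f z) / bump_mass)"
    unfolding kform_def
  proof (rule integral_le)
    show "(\<lambda>(u, v). (mollify h W u - mollify h W v) * (mollify h W u - mollify h W v) * kern \<gamma> \<eta> u v) integrable_on ?Q"
      by (intro kform_integrable continuous_on_mollify W \<eta>)
    have "continuous_on (?Q \<times> cbox (-1) 1) (\<lambda>(z, t). ?f z t)"
      unfolding case_prod_beta' by (intro continuous_intros Wc \<eta>)
    then have "continuous_on ?Q (\<lambda>z. integral {-1..1} (?f z) / bump_mass)"
      using integral_continuous_on_param[of ?Q "-1" 1 ?f] bump_mass_pos by (intro continuous_intros) auto
    then show "(\<lambda>z. integral {-1..1} (?f z) / bump_mass) integrable_on ?Q" by (rule integrable_continuous)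
  qed (use pt in \<open>auto simp: case_prod_beta'\<close>)
  also have "\<dots> = integral {-1..1} (\<lambda>t. integral ?Q (\<lambda>z. ?f z t)) / bump_mass"
    by (simp only: integral_divide swap)
  also have "\<dots> \<le> integral {-1..1} (\<lambda>t. bump t * ?B) / bump_mass"
  proof (rule divide_right_mono[OF integral_le])
    have "continuous_on ({-1..1} \<times> ?Q) (\<lambda>(t, z). ?f z t)"
      unfolding case_prod_beta' by (intro continuous_intros Wc \<eta>)
    then show "(\<lambda>t. integral ?Q (\<lambda>z. ?f z t)) integrable_on {-1..1}"
      by (intro integrable_continuous_real integral_continuous_on_param)
    show "(\<lambda>t. bump t * ?B) integrable_on {-1..1}" by (intro integrable_on_mult_left bump_integrable)
    fix t :: real assume t: "t \<in> {-1..1}"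
    have "integral ?Q (\<lambda>z. ?f z t) = bump t * integral ?Q (\<lambda>z. (W (fst z + - (h * t)) - W (snd z + - (h * t)))\<^sup>2 * kern \<gamma> \<eta> (fst z) (snd z))"
      by (simp add: mult.assoc)
    also have "\<dots> \<le> bump t * ?B"
    proof (intro mult_left_mono bump_nonneg shifted_energy_bound \<gamma> W supp a M \<eta>)
      show "\<bar>- (h * t)\<bar> \<le> 1" using t h by (auto simp: abs_mult intro!: mult_le_one)
    qed
    finally show "integral ?Q (\<lambda>z. ?f z t) \<le> bump t * ?B" .
  qed (use bump_mass_pos in auto)
  also have "\<dots> = ?B" using bump_mass_pos by (simp add: bump_mass_def)
  finally show ?thesis .
qed

lemma mollify_close:
  assumes W: "continuous_on UNIV W" and close: "\<And>t. t \<in> {-1..1} \<Longrightarrow> \<bar>W (u - h * t) - W u\<bar> \<le> e"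
  shows "\<bar>mollify h W u - W u\<bar> \<le> e"
proof -
  have Wc: "continuous_on A (\<lambda>x. W (f x))" if "continuous_on A f" for A and f :: "real \<Rightarrow> real"
    by (rule continuous_on_compose2[OF W that]) auto
  have i: "(\<lambda>t. bump t * W (u - h * t)) integrable_on {-1..1}"
    by (intro integrable_continuous_real continuous_intros Wc)
  have up: "integral {-1..1} (\<lambda>t. bump t * W (u - h * t)) \<le> integral {-1..1} (\<lambda>t. bump t * (W u + e))"
    using close by (intro integral_le i integrable_on_mult_left bump_integrable mult_left_mono bump_nonneg) (auto simp: abs_le_iff algebra_simps)
  have lo: "integral {-1..1} (\<lambda>t. bump t * (W u - e)) \<le> integral {-1..1} (\<lambda>t. bump t * W (u - h * t))"
    using close by (intro integral_le i integrable_on_mult_left bump_integrable mult_left_mono bump_nonneg) (auto simp: abs_le_iff algebra_simps)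
  have "bump_mass * (W u - e) \<le> integral {-1..1} (\<lambda>t. bump t * W (u - h * t))"
    "integral {-1..1} (\<lambda>t. bump t * W (u - h * t)) \<le> bump_mass * (W u + e)"
    using up lo by (simp_all add: bump_mass_def)
  then have "W u - e \<le> mollify h W u" "mollify h W u \<le> W u + e"
    using bump_mass_pos by (auto simp: mollify_def field_simps)
  then show ?thesis by (simp add: abs_le_iff)
qed

section \<open>Truncation and the uniqueness argument\<close>

text \<open>The argument minus its clamp to [-e, e]. This truncation is 1-Lipschitz, hence does not
  raise the energy, and it turns a continuous function with zero boundary values into one supported
  away from the end points.\<close>

definition soft_threshold :: "real \<Rightarrow> real \<Rightarrow> real" where
  "soft_threshold e t = t - max (- e) (min e t)"

lemma soft_threshold_diff_square_le: "(soft_threshold e x - soft_threshold e y)\<^sup>2 \<le> (x - y)\<^sup>2"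
  unfolding abs_le_square_iff[symmetric] soft_threshold_def by (auto simp: max_def min_def)

lemma soft_threshold_close: "0 \<le> e \<Longrightarrow> \<bar>soft_threshold e t - t\<bar> \<le> e"
  by (auto simp: soft_threshold_def)

lemma soft_threshold_eq_0: "\<bar>t\<bar> \<le> e \<Longrightarrow> soft_threshold e t = 0"
  by (auto simp: soft_threshold_def)

text \<open>The closure property \<open>kform_weak_closure\<close> is used twice: mollification
  extends the hypothesis to compactly supported functions, and soft thresholding extends it to
  \<open>w\<close>. Then \<open>w\<close> is tested against itself, which forces it to be
  constant.\<close>

lemma kform_uniqueness:
  assumes \<gamma>: "\<gamma> > 1" and w: "continuous_on {0..1} w" and w0: "w 0 = 0" "w 1 = 0"
    and A: "\<And>\<eta>. \<eta> \<in> {0<..1} \<Longrightarrow> kform \<gamma> \<eta> w w \<le> A"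
    and test: "\<And>g. g \<in> test_unit \<Longrightarrow> ((\<lambda>\<eta>. kform \<gamma> \<eta> w g) \<longlongrightarrow> 0) (at_right 0)"
    and u: "u \<in> {0..1}"
  shows "w u = 0"
proof -
  have compact_case: "((\<lambda>\<eta>. kform \<gamma> \<eta> w W) \<longlongrightarrow> 0) (at_right 0)"
    if W: "continuous_on UNIV W" and supp: "\<And>x. x \<notin> {a..1 - a} \<Longrightarrow> W x = 0" and a: "0 < a" "a \<le> 1"
      and AW: "\<And>\<eta>. \<eta> \<in> {0<..1} \<Longrightarrow> kform \<gamma> \<eta> W W \<le> A" for W a
  proof -
    \<comment> \<open>The offset 2 keeps \<open>h k\<close> strictly below \<open>a\<close>, so that
      the support of the mollified function stays inside (0,1).\<close>
    define h where "h k = a / real (k + 2)" for k :: nat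
    have h: "0 < h k" "h k < a" "h k \<le> 1" for k
    proof -
      have "a * real k \<ge> 0" using a by simp
      then have "a < a * (real k + 2)" "a \<le> real k + 2" using a unfolding distrib_left by linarith+
      then show "0 < h k" "h k < a" "h k \<le> 1" using a by (auto simp: h_def divide_less_eq divide_le_eq add.commute)
    qed
    have hlim: "h \<longlonglongrightarrow> 0"
      using LIMSEQ_ignore_initial_segment[OF lim_const_over_n[of a], of 2] by (simp add: h_def[abs_def])
    obtain M where M: "\<And>x. x \<in> {a..1 - a} \<Longrightarrow> \<bar>W x\<bar> \<le> M"
      using compact_imp_bounded[OF compact_continuous_image[OF continuous_on_subset[OF W] compact_Icc[of a "1 - a"]]]
      unfolding bounded_iff real_norm_def by blast
    have M': "\<bar>W x\<bar> \<le> \<bar>M\<bar>" for x using M[of x] supp[of x] by (cases "x \<in> {a..1 - a}") auto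
    show ?thesis
    proof (rule kform_weak_closure[OF \<gamma> w A, where gk = "\<lambda>k. mollify (h k) W"])
      show "continuous_on {0..1} W" using W continuous_on_subset by blast
      show "continuous_on {0..1} (mollify (h k) W)" for k by (rule continuous_on_mollify[OF W])
      show "kform \<gamma> \<eta> (mollify (h k) W) (mollify (h k) W) \<le> A + 9 * (\<bar>M\<bar>\<^sup>2 * a powr (- (1 + \<gamma>)))"
        if "\<eta> \<in> {0<..1}" for k \<eta>
        using mollify_energy_bound[OF \<gamma> W supp a(1) M' h(1,3), of \<eta> k] AW[OF that] that by auto
      show "((\<lambda>\<eta>. kform \<gamma> \<eta> w (mollify (h k) W)) \<longlongrightarrow> 0) (at_right 0)" for k
        by (rule test[OF mollify_test_unit[OF W supp h(1,2)]])
      show "uniform_limit {0..1} (\<lambda>k. mollify (h k) W) W sequentially"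
      proof (rule uniform_limitI)
        fix e :: real assume e: "e > 0"
        have "uniformly_continuous_on {-1..2} W"
          by (rule compact_uniformly_continuous[OF continuous_on_subset[OF W]]) auto
        then obtain d where d: "d > 0" "\<And>x y. x \<in> {-1..2} \<Longrightarrow> y \<in> {-1..2} \<Longrightarrow> dist y x < d \<Longrightarrow> dist (W y) (W x) < e / 2"
          using e unfolding uniformly_continuous_on_def by (metis half_gt_zero)
        have "\<forall>\<^sub>F k in sequentially. dist (h k) 0 < d" using hlim d(1) by (rule tendstoD)
        then show "\<forall>\<^sub>F k in sequentially. \<forall>x\<in>{0..1}. dist (mollify (h k) W x) (W x) < e"
        proof eventually_elim
          case (elim k)
          have "\<bar>mollify (h k) W x - W x\<bar> \<le> e / 2" if x: "x \<in> {0..1}" for x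
          proof (rule mollify_close[OF W])
            fix t :: real assume t: "t \<in> {-1..1}"
            have ht: "\<bar>h k * t\<bar> \<le> h k" using t h(1)[of k] by (auto simp: abs_mult intro: mult_left_le)
            have "dist (W (x - h k * t)) (W x) < e / 2"
            proof (rule d(2))
              show "x \<in> {-1..2}" "x - h k * t \<in> {-1..2}" using x ht h(3)[of k] by (auto simp: abs_le_iff)
              show "dist (x - h k * t) x < d" using elim ht h(1)[of k] by (simp add: dist_real_def)
            qed
            then show "\<bar>W (x - h k * t) - W x\<bar> \<le> e / 2" by (simp add: dist_real_def)
          qed
          then show ?case using e by (fastforce simp: dist_real_def)
        qed
      qed
    qed
  qed
  \<comment> \<open>Clamping the argument extends \<open>w\<close> continuously to the line; by the
    zero boundary values this is the extension by zero.\<close>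
  define wc where "wc x = w (max 0 (min 1 x))" for x
  have wc: "continuous_on UNIV wc" unfolding wc_def[abs_def]
    by (rule continuous_on_compose2[OF w]) (auto intro!: continuous_intros)
  have wc_eq: "wc x = w x" if "x \<in> {0..1}" for x using that by (auto simp: wc_def max_def min_def)
  have wc_out: "wc x = 0" if "x \<notin> {0<..<1}" for x using that w0 by (auto simp: wc_def max_def min_def)
  have "((\<lambda>\<eta>. kform \<gamma> \<eta> w w) \<longlongrightarrow> 0) (at_right 0)"
  proof (rule kform_weak_closure[OF \<gamma> w A w, where gk = "\<lambda>k x. soft_threshold (1 / real (Suc k)) (wc x)" and B = A])
    fix k :: nat
    define e where "e = 1 / real (Suc k)"
    have e: "e > 0" by (simp add: e_def)
    let ?g = "\<lambda>x. soft_threshold e (wc x)"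
    have c: "continuous_on S ?g" for S
      unfolding soft_threshold_def by (intro continuous_intros continuous_on_subset[OF wc]) auto
    show "continuous_on {0..1} (\<lambda>x. soft_threshold (1 / real (Suc k)) (wc x))" using c by (simp add: e_def)
    have AW: "kform \<gamma> \<eta> ?g ?g \<le> A" if \<eta>: "\<eta> \<in> {0<..1}" for \<eta>
    proof -
      have "kform \<gamma> \<eta> ?g ?g \<le> kform \<gamma> \<eta> w w"
        unfolding kform_def
      proof (rule integral_le)
        fix z :: "real \<times> real" assume "z \<in> cbox (0, 0) (1, 1)"
        then obtain x y where z: "z = (x, y)" "x \<in> {0..1}" "y \<in> {0..1}" by (cases z) (auto simp: cbox_Pair_eq)
        show "(case z of (x, y) \<Rightarrow> (?g x - ?g y) * (?g x - ?g y) * kern \<gamma> \<eta> x y) \<le> (case z of (x, y) \<Rightarrow> (w x - w y) * (w x - w y) * kern \<gamma> \<eta> x y)"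
          using mult_right_mono[OF soft_threshold_diff_square_le[of e "w x" "w y"] kern_nonneg] z
          by (simp add: wc_eq power2_eq_square)
      qed (use \<eta> w c in \<open>auto intro!: kform_integrable\<close>)
      then show ?thesis using A[OF \<eta>] by simp
    qed
    then show "kform \<gamma> \<eta> (\<lambda>x. soft_threshold (1 / real (Suc k)) (wc x)) (\<lambda>x. soft_threshold (1 / real (Suc k)) (wc x)) \<le> A"
      if "\<eta> \<in> {0<..1}" for \<eta> using that by (simp add: e_def)
    have "isCont wc 0" "isCont wc 1" using wc by (auto simp: continuous_on_eq_continuous_at)
    then have ev: "\<exists>d>0. \<forall>x. \<bar>x - y\<bar> < d \<longrightarrow> \<bar>wc x\<bar> < e" if "y = 0 \<or> y = 1" for y
      unfolding continuous_at_eps_delta using e wc_out[of 0] wc_out[of 1] that by (auto simp: dist_real_def)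
    obtain d0 d1 where d: "d0 > 0" "\<And>x. \<bar>x\<bar> < d0 \<Longrightarrow> \<bar>wc x\<bar> < e" "d1 > 0" "\<And>x. \<bar>x - 1\<bar> < d1 \<Longrightarrow> \<bar>wc x\<bar> < e"
      using ev[of 0] ev[of 1] by auto
    \<comment> \<open>Within this distance of either end point \<open>wc\<close> is below the
      threshold, so the truncated function vanishes there.\<close>
    define a where "a = min 1 (min d0 d1) / 2"
    have a: "0 < a" "a \<le> 1" "a < d0" "a < d1" using d by (auto simp: a_def)
    have "?g x = 0" if "x \<notin> {a..1 - a}" for x
    proof (rule soft_threshold_eq_0)
      show "\<bar>wc x\<bar> \<le> e"
      proof (cases "x \<in> {0<..<1}")
        case True
        then have "\<bar>x\<bar> < d0 \<or> \<bar>x - 1\<bar> < d1" using that a by auto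
        then show ?thesis using d by (auto intro: less_imp_le)
      qed (use wc_out e in auto)
    qed
    from compact_case[OF c this a(1,2) AW]
    show "((\<lambda>\<eta>. kform \<gamma> \<eta> w (\<lambda>x. soft_threshold (1 / real (Suc k)) (wc x))) \<longlongrightarrow> 0) (at_right 0)"
      by (simp add: e_def)
  next
    show "uniform_limit {0..1} (\<lambda>k x. soft_threshold (1 / real (Suc k)) (wc x)) w sequentially"
    proof (rule uniform_limitI)
      fix e :: real assume e: "e > 0"
      have "\<forall>\<^sub>F k in sequentially. dist (1 / real (Suc k)) 0 < e"
        using LIMSEQ_Suc[OF lim_const_over_n[of 1]] e by (rule tendstoD)
      then show "\<forall>\<^sub>F k in sequentially. \<forall>x\<in>{0..1}. dist (soft_threshold (1 / real (Suc k)) (wc x)) (w x) < e"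
      proof eventually_elim
        case (elim k)
        have "\<bar>soft_threshold (1 / real (Suc k)) (w x) - w x\<bar> < e" for x
          using soft_threshold_close[of "1 / real (Suc k)" "w x"] elim by (simp add: dist_real_def)
        then show ?case by (simp add: dist_real_def wc_eq)
      qed
    qed
  qed
  then have "w u = w 0"
    by (rule kform_self_tendsto_0_imp_constant[OF \<gamma> w]) (use u in auto)
  then show ?thesis using w0 by simp
qed

section \<open>Weak solutions\<close>

text \<open>The capped kernel lies below the singular one, and on the diagonal both integrands are
  0. Finiteness of the seminorm therefore bounds all capped energies at once.\<close>

lemma frac_seminorm_kform_bound:
  assumes \<gamma>: "\<gamma> > 1" and c: "c_norm \<gamma> > 0" and F: "continuous_on {0..1} F" and fin: "frac_seminorm_sq \<gamma> F < \<infinity>"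
  obtains A where "\<And>\<eta>. \<eta> \<in> {0<..1} \<Longrightarrow> kform \<gamma> \<eta> F F \<le> A"
proof -
  let ?Q = "cbox (0::real, 0::real) (1, 1)"
  let ?N = "\<integral>\<^sup>+z. ennreal (case z of (u, v) \<Rightarrow> (F v - F u)\<^sup>2 / \<bar>u - v\<bar> powr (1 + \<gamma>)) * indicator ({0..1} \<times> {0..1}) z \<partial>(lborel :: (real \<times> real) measure)"
  have Q: "?Q = {0..1} \<times> {0..1}" by (auto simp: cbox_Pair_eq)
  have "ennreal (c_norm \<gamma> / 2) * ?N < \<infinity>"
    using fin by (simp add: frac_seminorm_sq_def lborel_prod case_prod_beta')
  then have N: "?N < \<infinity>" using c by (auto simp: ennreal_mult_less_top)
  have "kform \<gamma> \<eta> F F \<le> enn2real ?N" if \<eta>: "\<eta> \<in> {0<..1}" for \<eta>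
  proof -
    let ?f = "\<lambda>z. case z of (u, v) \<Rightarrow> (F u - F v) * (F u - F v) * kern \<gamma> \<eta> u v"
    have cont: "continuous_on ?Q ?f" using \<eta> by (intro kform_continuous F) auto
    have f0: "0 \<le> ?f z" for z by (cases z) (simp add: kern_nonneg)
    have int: "integrable lborel (\<lambda>z. indicator ?Q z *\<^sub>R ?f z)"
      by (rule borel_integrable_compact[OF compact_cbox cont])
    have "kform \<gamma> \<eta> F F = (\<integral>z. indicator ?Q z *\<^sub>R ?f z \<partial>lborel)"
      using set_borel_integral_eq_integral(2)[of ?Q ?f] int
      unfolding kform_def set_integrable_def set_lebesgue_integral_def by simp
    then have "ennreal (kform \<gamma> \<eta> F F) = (\<integral>\<^sup>+z. ennreal (indicator ?Q z *\<^sub>R ?f z) \<partial>lborel)"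
      using int f0 by (subst nn_integral_eq_integral) auto
    also have "\<dots> \<le> ?N"
    proof (rule nn_integral_mono)
      fix z :: "real \<times> real"
      obtain u v where z: "z = (u, v)" by (cases z)
      have "?f z \<le> (F v - F u)\<^sup>2 / \<bar>u - v\<bar> powr (1 + \<gamma>)"
      proof (cases "u = v")
        case False
        have "(F u - F v) * (F u - F v) * kern \<gamma> \<eta> u v \<le> (F u - F v) * (F u - F v) * \<bar>u - v\<bar> powr (- (1 + \<gamma>))"
          by (intro mult_left_mono kern_le_powr \<gamma> False) simp
        also have "\<dots> = (F v - F u)\<^sup>2 / \<bar>u - v\<bar> powr (1 + \<gamma>)"
        proof -
          have "(F u - F v) * (F u - F v) = (F v - F u)\<^sup>2" by (simp add: power2_eq_square algebra_simps)
          then show ?thesis unfolding powr_minus_divide by simp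
        qed
        finally show ?thesis by (simp add: z)
      qed (simp add: z)
      then show "ennreal (indicator ?Q z *\<^sub>R ?f z) \<le> ennreal (case z of (u, v) \<Rightarrow> (F v - F u)\<^sup>2 / \<bar>u - v\<bar> powr (1 + \<gamma>)) * indicator ({0..1} \<times> {0..1}) z"
        unfolding Q by (auto simp: z indicator_def intro: ennreal_leI)
    qed
    finally have "ennreal (kform \<gamma> \<eta> F F) \<le> ?N" .
    then have "enn2real (ennreal (kform \<gamma> \<eta> F F)) \<le> enn2real ?N" using N by (intro enn2real_mono) auto
    then show ?thesis using kform_nonneg[OF F, of \<eta> \<gamma>] \<eta> by simp
  qed
  then show ?thesis using that by blast
qed

text \<open>Integrable majorant of the compensated integrand of the principal value.\<close>

definition near_weight :: "real \<Rightarrow> real \<Rightarrow> real" where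
  "near_weight \<gamma> z = indicator {-1..1} z * \<bar>z\<bar> powr (1 - \<gamma>)"

lemma near_weight_nonneg: "0 \<le> near_weight \<gamma> z"
  by (simp add: near_weight_def)

lemma near_weight_integrable:
  assumes "\<gamma> < 2"
  shows "integrable lborel (near_weight \<gamma>)"
proof -
  let ?p = "\<lambda>z. indicator {0..1} z * z powr (1 - \<gamma>)"
  have "((\<lambda>x::real. x powr (1 - \<gamma>)) has_integral (1 powr (1 - \<gamma> + 1) / (1 - \<gamma> + 1))) {0..1}"
    using assms by (intro has_integral_powr_from_0) auto
  from nn_integral_has_integral_lebesgue[OF _ this]
  have "(\<integral>\<^sup>+z. ennreal (?p z) \<partial>lborel) = ennreal (1 / (2 - \<gamma>))"
    using assms by simp
  then have p: "integrable lborel ?p"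
    by (intro integrableI_nn_integral_finite) auto
  then have m: "integrable lborel (\<lambda>z. ?p (0 + (- 1) * z))"
    by (rule lborel_integrable_real_affine) simp
  show ?thesis
  proof (rule Bochner_Integration.integrable_bound[OF Bochner_Integration.integrable_add[OF p m]])
    show "near_weight \<gamma> \<in> borel_measurable lborel" unfolding near_weight_def[abs_def] by measurable
    show "AE z in lborel. norm (near_weight \<gamma> z) \<le> norm (?p z + ?p (0 + - 1 * z))"
      by (intro AE_I2) (auto simp: near_weight_def indicator_def)
  qed
qed

lemma near_weight_shift:
  assumes "\<gamma> < 2"
  shows "integrable lborel (\<lambda>v. near_weight \<gamma> (v - u))" "(\<integral>v. near_weight \<gamma> (v - u) \<partial>lborel) = (\<integral>v. near_weight \<gamma> v \<partial>lborel)"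
  using lborel_integrable_real_affine[OF near_weight_integrable[OF assms], of 1 "- u"]
    lborel_integral_real_affine[of 1 "near_weight \<gamma>" "- u"]
  by (simp_all add: algebra_simps)

lemma odd_integral_zero:
  fixes f :: "real \<Rightarrow> real"
  assumes "\<And>v. f (2 * u - v) = - f v"
  shows "(\<integral>v. f v \<partial>lborel) = 0"
  using lborel_integral_real_affine[of "- 1" f "2 * u"] assms by simp

section \<open>The fractional operator on test functions\<close>

locale test_function =
  fixes \<gamma> :: real and g :: "real \<Rightarrow> real"
  assumes \<gamma>: "1 < \<gamma>" "\<gamma> < 2" and g: "g \<in> test_unit"
begin

lemma g_deriv: "(g has_real_derivative deriv g x) (at x)"
  using g DERIV_deriv_iff_real_differentiable by (auto simp: test_unit_def dest: spec[of _ 0])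

lemma g_deriv2: "(deriv g has_real_derivative deriv (deriv g) x) (at x)"
  using g DERIV_deriv_iff_real_differentiable by (auto simp: test_unit_def dest: spec[of _ "Suc 0"])

lemma g_deriv3: "isCont (deriv (deriv g)) x"
proof -
  have "(deriv ^^ 2) g differentiable (at x)" using g by (simp add: test_unit_def)
  then show ?thesis
    by (simp add: eval_nat_numeral differentiable_imp_continuous_within)
qed

lemma g_continuous: "continuous_on A g"
  using DERIV_continuous_on[of A g "deriv g"] g_deriv by (blast intro: DERIV_subset)

lemma dg_continuous: "continuous_on A (deriv g)"
  using DERIV_continuous_on[of A "deriv g" "deriv (deriv g)"] g_deriv2 by (blast intro: DERIV_subset)

lemma support:
  obtains d where "d > 0" "\<And>x. x \<notin> {d..1 - d} \<Longrightarrow> g x = 0 \<and> deriv g x = 0"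
proof -
  let ?S = "closure {u. g u \<noteq> 0}"
  have S: "compact ?S" "?S \<subseteq> {0<..<1}" using g by (auto simp: test_unit_def)
  have "\<exists>d>0. \<forall>x. x \<notin> {d..1 - d} \<longrightarrow> x \<notin> ?S"
  proof (cases "?S = {}")
    case False
    obtain a b where a: "a \<in> ?S" "\<And>x. x \<in> ?S \<Longrightarrow> a \<le> x" and b: "b \<in> ?S" "\<And>x. x \<in> ?S \<Longrightarrow> x \<le> b"
      using compact_attains_inf[OF S(1) False] compact_attains_sup[OF S(1) False] by blast
    have "a > 0" "b < 1" using a(1) b(1) S(2) by auto
    then show ?thesis
      using a(2) b(2) by (intro exI[of _ "min a (1 - b)"]) fastforce
  qed (auto intro: exI[of _ 1])
  then obtain d where d: "d > 0" "\<And>x. x \<notin> {d..1 - d} \<Longrightarrow> x \<notin> ?S" by blast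
  have 0: "g x = 0" if "x \<notin> {d..1 - d}" for x
    using d(2)[OF that] closure_subset[of "{u. g u \<noteq> 0}"] by auto
  have "deriv g x = 0" if x: "x \<notin> {d..1 - d}" for x
  proof -
    have "\<forall>\<^sub>F y in nhds x. y \<in> - {d..1 - d}"
      by (rule eventually_nhds_in_open) (use x in auto)
    then have "\<forall>\<^sub>F y in nhds x. g y = 0" by eventually_elim (use 0 in auto)
    then have "deriv g x = deriv (\<lambda>_. 0) x" by (intro deriv_cong_ev) auto
    then show ?thesis by simp
  qed
  then show ?thesis using that[OF d(1)] 0 by blast
qed

lemma taylor_bound:
  obtains M where "M \<ge> 0" "\<And>u v. u \<in> {0..1} \<Longrightarrow> v \<in> {0..1} \<Longrightarrow> \<bar>g v - g u - deriv g u * (v - u)\<bar> \<le> M * (v - u)\<^sup>2"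
    "\<And>u v. u \<in> {0..1} \<Longrightarrow> v \<in> {0..1} \<Longrightarrow> \<bar>g v - g u\<bar> \<le> M * \<bar>v - u\<bar>" "\<And>u. u \<in> {0..1} \<Longrightarrow> \<bar>g u\<bar> \<le> M"
proof -
  have bd: "\<exists>B. \<forall>x\<in>{0..1}. \<bar>f x\<bar> \<le> B" if "continuous_on {0..1} f" for f :: "real \<Rightarrow> real"
    using compact_imp_bounded[OF compact_continuous_image[OF that compact_Icc]] unfolding bounded_iff real_norm_def by blast
  have "continuous_on {0..1} (deriv (deriv g))" using g_deriv3 by (simp add: continuous_at_imp_continuous_on)
  then obtain M2 where M2: "\<And>x. x \<in> {0..1} \<Longrightarrow> \<bar>deriv (deriv g) x\<bar> \<le> M2" using bd by blast
  obtain M1 where M1: "\<And>x. x \<in> {0..1} \<Longrightarrow> \<bar>deriv g x\<bar> \<le> M1" using bd[OF dg_continuous] by blast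
  obtain M0 where M0: "\<And>x. x \<in> {0..1} \<Longrightarrow> \<bar>g x\<bar> \<le> M0" using bd[OF g_continuous] by blast
  define M where "M = max M0 (max M1 M2)"
  have M: "M2 \<le> M" "M1 \<le> M" "M0 \<le> M" by (auto simp: M_def)
  have lip1: "\<bar>deriv g x - deriv g y\<bar> \<le> M * \<bar>x - y\<bar>" if "x \<in> {0..1}" "y \<in> {0..1}" for x y
    using field_differentiable_bound[of "{0..1}" "deriv g" "deriv (deriv g)" M x y] that M2 M g_deriv2
    by (auto intro: has_field_derivative_at_within order_trans)
  have lip0: "\<bar>g x - g y\<bar> \<le> M * \<bar>x - y\<bar>" if "x \<in> {0..1}" "y \<in> {0..1}" for x y
    using field_differentiable_bound[of "{0..1}" "g" "deriv g" M x y] that M1 M g_deriv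
    by (auto intro: has_field_derivative_at_within order_trans)
  have M_nonneg: "M \<ge> 0" using M0[of 0] M by auto
  have "\<bar>g v - g u - deriv g u * (v - u)\<bar> \<le> M * (v - u)\<^sup>2" if uv: "u \<in> {0..1}" "v \<in> {0..1}" for u v
  proof -
    have sub: "closed_segment u v \<subseteq> {0..1}" using uv by (auto simp: closed_segment_eq_real_ivl split: if_splits)
    have "norm ((g v - deriv g u * v) - (g u - deriv g u * u)) \<le> (M * \<bar>v - u\<bar>) * norm (v - u)"
    proof (rule field_differentiable_bound[of "closed_segment u v" _ "\<lambda>x. deriv g x - deriv g u"])
      show "((\<lambda>x. g x - deriv g u * x) has_field_derivative deriv g z - deriv g u) (at z within closed_segment u v)" for z
        using DERIV_diff[OF g_deriv DERIV_cmult_Id[of "deriv g u"]] by (rule has_field_derivative_at_within)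
      fix z assume z: "z \<in> closed_segment u v"
      have "\<bar>deriv g z - deriv g u\<bar> \<le> M * \<bar>z - u\<bar>" using lip1[of z u] z sub uv by auto
      also have "\<dots> \<le> M * \<bar>v - u\<bar>"
        using z M_nonneg by (intro mult_left_mono) (auto simp: closed_segment_eq_real_ivl split: if_splits)
      finally show "norm (deriv g z - deriv g u) \<le> M * \<bar>v - u\<bar>" by simp
    qed auto
    then show ?thesis by (simp add: power2_eq_square algebra_simps)
  qed
  moreover have "\<bar>g u\<bar> \<le> M" if "u \<in> {0..1}" for u using M0[OF that] M(3) by simp
  ultimately show ?thesis using that[OF M_nonneg] lip0 by blast
qed

text \<open>The increment of \<open>g\<close> minus its first-order part in a window of radius
  \<open>d\<close> around \<open>u\<close>. What remains is of order (v - u)^2, hence integrable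
  against the singular kernel.\<close>

definition comp :: "real \<Rightarrow> real \<Rightarrow> real \<Rightarrow> real" where
  "comp d u v = g v - g u - deriv g u * ((v - u) * of_bool (\<bar>v - u\<bar> < d))"

lemma comp_measurable [measurable]: "comp d u \<in> borel_measurable borel"
proof -
  have [measurable]: "g \<in> borel_measurable borel"
    by (rule borel_measurable_continuous_onI[OF g_continuous])
  show ?thesis unfolding comp_def[abs_def] by measurable
qed

lemma comp_bound:
  assumes d: "d > 0"
  obtains B where "B \<ge> 0" "\<And>u v. u \<in> {0..1} \<Longrightarrow> v \<in> {0..1} \<Longrightarrow> \<bar>comp d u v\<bar> \<le> B * (v - u)\<^sup>2"
proof -
  obtain M where M: "M \<ge> 0" "\<And>u v. u \<in> {0..1} \<Longrightarrow> v \<in> {0..1} \<Longrightarrow> \<bar>g v - g u - deriv g u * (v - u)\<bar> \<le> M * (v - u)\<^sup>2"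
    "\<And>u v. u \<in> {0..1} \<Longrightarrow> v \<in> {0..1} \<Longrightarrow> \<bar>g v - g u\<bar> \<le> M * \<bar>v - u\<bar>"
    using taylor_bound by metis
  show ?thesis
  proof (rule that[of "M + M / d"])
    fix u v :: real assume uv: "u \<in> {0..1}" "v \<in> {0..1}"
    show "\<bar>comp d u v\<bar> \<le> (M + M / d) * (v - u)\<^sup>2"
    proof (cases "\<bar>v - u\<bar> < d")
      case True
      then have "\<bar>comp d u v\<bar> \<le> M * (v - u)\<^sup>2" using M(2)[OF uv] by (simp add: comp_def)
      also have "\<dots> \<le> (M + M / d) * (v - u)\<^sup>2" using M(1) d by (intro mult_right_mono) auto
      finally show ?thesis .
    next
      case False
      then have "\<bar>comp d u v\<bar> \<le> M * \<bar>v - u\<bar>" using M(3)[OF uv] by (simp add: comp_def)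
      \<comment> \<open>Outside the window the Lipschitz bound becomes quadratic at the price of a
        factor 1/d.\<close>
      also have "\<dots> \<le> M * (\<bar>v - u\<bar> / d * \<bar>v - u\<bar>)"
        using False M(1) d mult_right_mono[of 1 "\<bar>v - u\<bar> / d" "\<bar>v - u\<bar>"] by (intro mult_left_mono) auto
      also have "\<dots> = M / d * (v - u)\<^sup>2" by (simp add: power2_eq_square)
      also have "\<dots> \<le> (M + M / d) * (v - u)\<^sup>2" using M(1) by (intro mult_right_mono) auto
      finally show ?thesis .
    qed
  qed (use M(1) d in auto)
qed

lemma compensated_integral:
  assumes d: "\<And>x. x \<notin> {d..1 - d} \<Longrightarrow> g x = 0 \<and> deriv g x = 0" "d > 0" and u: "u \<in> {0..1}"
    and k: "k \<in> borel_measurable borel" "\<And>r. 0 \<le> k r" "\<And>r. k r \<le> K"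
  shows "(LBINT v:{0..1}. (g v - g u) * k \<bar>v - u\<bar>) = (LBINT v:{0..1}. comp d u v * k \<bar>v - u\<bar>)"
proof -
  let ?o = "\<lambda>v. deriv g u * ((v - u) * of_bool (\<bar>v - u\<bar> < d)) * k \<bar>v - u\<bar>"
  note [measurable] = k(1)
  have K: "K \<ge> 0" using k(2)[of 0] k(3)[of 0] by simp
  have "(LBINT v:{0..1}. ?o v) = 0"
  \<comment> \<open>For such \<open>u\<close> the window lies inside [0,1], so the first-order part
    is odd about \<open>u\<close> and integrates to 0 against a kernel depending on |v - u|. For any
    other \<open>u\<close> in [0,1] it is 0, because \<open>deriv g u = 0\<close>.\<close>
  proof (cases "u \<in> {d..1 - d}")
    case True
    have "(LBINT v:{0..1}. ?o v) = (\<integral>v. ?o v \<partial>lborel)"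
      unfolding set_lebesgue_integral_def
      by (intro Bochner_Integration.integral_cong) (use True in \<open>auto simp: indicator_def\<close>)
    also have "\<dots> = 0"
    proof (rule odd_integral_zero[of _ u])
      fix v
      have "\<bar>2 * u - v - u\<bar> = \<bar>v - u\<bar>" by simp
      then show "?o (2 * u - v) = - ?o v" by (simp only:) (simp add: algebra_simps)
    qed
    finally show ?thesis .
  next
    case False
    then show ?thesis using d(1) by simp
  qed
  moreover have "set_integrable lborel {0..1} ?o"
  proof -
    have "integrable lborel (\<lambda>v. indicator {0..1} v *\<^sub>R ?o v)"
    proof (rule Bochner_Integration.integrable_bound)
      show "integrable lborel (\<lambda>v::real. indicator {0..1} v *\<^sub>R (\<bar>deriv g u\<bar> * K))"
        using integrable_real_indicator[of "{0..1::real}" lborel] by simp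
      have "\<bar>?o v\<bar> \<le> \<bar>deriv g u\<bar> * K" if "v \<in> {0..1}" for v
      proof -
        have "\<bar>(v - u) * of_bool (\<bar>v - u\<bar> < d)\<bar> * \<bar>k \<bar>v - u\<bar>\<bar> \<le> 1 * K"
          using that u k K by (intro mult_mono) auto
        then show ?thesis using mult_left_mono[of _ _ "\<bar>deriv g u\<bar>"] by (fastforce simp: abs_mult mult.assoc)
      qed
      then show "AE v in lborel. norm (indicator {0..1} v *\<^sub>R ?o v) \<le> norm (indicator {0..1} v *\<^sub>R (\<bar>deriv g u\<bar> * K))"
        using K by (intro AE_I2) (auto simp: indicator_def)
    qed measurable
    then show ?thesis by (simp add: set_integrable_def)
  qed
  moreover have "set_integrable lborel {0..1} (\<lambda>v. comp d u v * k \<bar>v - u\<bar>)"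
  proof -
    obtain B where B: "B \<ge> 0" "\<And>u v. u \<in> {0..1} \<Longrightarrow> v \<in> {0..1} \<Longrightarrow> \<bar>comp d u v\<bar> \<le> B * (v - u)\<^sup>2"
      using comp_bound[OF d(2)] by metis
    have "integrable lborel (\<lambda>v. indicator {0..1} v *\<^sub>R (comp d u v * k \<bar>v - u\<bar>))"
    proof (rule Bochner_Integration.integrable_bound)
      show "integrable lborel (\<lambda>v::real. indicator {0..1} v *\<^sub>R (B * K))"
        using integrable_real_indicator[of "{0..1::real}" lborel] by simp
      have "\<bar>comp d u v * k \<bar>v - u\<bar>\<bar> \<le> B * K" if "v \<in> {0..1}" for v
      proof -
        have "\<bar>comp d u v\<bar> \<le> B * (v - u)\<^sup>2" by (rule B(2)[OF u that])
        also have "\<dots> \<le> B * 1" using u that B(1) by (intro mult_left_mono) (auto simp: abs_square_le_1)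
        finally show ?thesis unfolding abs_mult using k B(1) by (intro mult_mono) auto
      qed
      then show "AE v in lborel. norm (indicator {0..1} v *\<^sub>R (comp d u v * k \<bar>v - u\<bar>)) \<le> norm (indicator {0..1} v *\<^sub>R (B * K))"
        using K B(1) by (intro AE_I2) (auto simp: indicator_def)
    qed measurable
    then show ?thesis by (simp add: set_integrable_def)
  qed
  moreover have "(g v - g u) * k \<bar>v - u\<bar> = comp d u v * k \<bar>v - u\<bar> + ?o v" for v
    by (simp add: comp_def algebra_simps)
  ultimately show ?thesis by (simp add: set_integral_add)
qed

text \<open>One limit theorem for two regularisations, the sharp truncation in
  \<open>frac_op\<close> and the cap in \<open>kform\<close>. After compensation both are dominated
  by a multiple of \<open>near_weight\<close> and share the same limit.\<close>

lemma compensated_limit: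
  assumes d: "\<And>x. x \<notin> {d..1 - d} \<Longrightarrow> g x = 0 \<and> deriv g x = 0" "d > 0" and u: "u \<in> {0..1}"
    and k: "\<And>n::nat. k n \<in> borel_measurable borel" "\<And>n r. 0 \<le> k n r" "\<And>n r. k n r \<le> K n" "\<And>n r. 0 < r \<Longrightarrow> k n r \<le> r powr (- (1 + \<gamma>))"
    and lim: "\<And>r. 0 < r \<Longrightarrow> (\<lambda>n. k n r) \<longlonglongrightarrow> r powr (- (1 + \<gamma>))"
    and B: "B \<ge> 0" "\<And>u v. u \<in> {0..1} \<Longrightarrow> v \<in> {0..1} \<Longrightarrow> \<bar>comp d u v\<bar> \<le> B * (v - u)\<^sup>2"
  shows "(\<lambda>n. LBINT v:{0..1}. (g v - g u) * k n \<bar>v - u\<bar>) \<longlonglongrightarrow> (LBINT v:{0..1}. comp d u v * \<bar>v - u\<bar> powr (- (1 + \<gamma>)))"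
    and "\<bar>LBINT v:{0..1}. (g v - g u) * k n \<bar>v - u\<bar>\<bar> \<le> B * (\<integral>v. near_weight \<gamma> v \<partial>lborel)"
proof -
  note [measurable] = k(1)
  have bound: "norm (indicator {0..1} v *\<^sub>R (comp d u v * k n \<bar>v - u\<bar>)) \<le> B * near_weight \<gamma> (v - u)" for n v
  proof (cases "v \<in> {0..1} \<and> v \<noteq> u")
    case True
    have "\<bar>comp d u v\<bar> * k n \<bar>v - u\<bar> \<le> (B * (v - u)\<^sup>2) * \<bar>v - u\<bar> powr (- (1 + \<gamma>))"
      using True B(1) by (intro mult_mono B(2) u k(4) k(2)) auto
    also have "(v - u)\<^sup>2 = \<bar>v - u\<bar> powr 2" using True by simp
    also have "(B * \<bar>v - u\<bar> powr 2) * \<bar>v - u\<bar> powr (- (1 + \<gamma>)) = B * \<bar>v - u\<bar> powr (1 - \<gamma>)"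
      by (simp only: mult.assoc powr_add[symmetric]) simp
    also have "\<dots> = B * near_weight \<gamma> (v - u)" using True u by (auto simp: near_weight_def)
    finally show ?thesis using True k(2)[of n "\<bar>v - u\<bar>"] by (simp add: abs_mult)
  next
    case False
    then have z: "indicator {0..1} v *\<^sub>R (comp d u v * k n \<bar>v - u\<bar>) = 0" by (auto simp: comp_def)
    show ?thesis unfolding z norm_zero by (rule mult_nonneg_nonneg[OF B(1) near_weight_nonneg])
  qed
  have w: "integrable lborel (\<lambda>v. B * near_weight \<gamma> (v - u))"
    using near_weight_shift(1)[OF \<gamma>(2)] by simp
  have "(\<lambda>n. \<integral>v. indicator {0..1} v *\<^sub>R (comp d u v * k n \<bar>v - u\<bar>) \<partial>lborel) \<longlonglongrightarrow>
      (\<integral>v. indicator {0..1} v *\<^sub>R (comp d u v * \<bar>v - u\<bar> powr (- (1 + \<gamma>))) \<partial>lborel)"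
  proof (rule integral_dominated_convergence[OF _ _ w])
    show "AE v in lborel. (\<lambda>n. indicator {0..1} v *\<^sub>R (comp d u v * k n \<bar>v - u\<bar>)) \<longlonglongrightarrow>
      indicator {0..1} v *\<^sub>R (comp d u v * \<bar>v - u\<bar> powr (- (1 + \<gamma>)))"
    proof (intro AE_I2)
      fix v
      show "(\<lambda>n. indicator {0..1} v *\<^sub>R (comp d u v * k n \<bar>v - u\<bar>)) \<longlonglongrightarrow> indicator {0..1} v *\<^sub>R (comp d u v * \<bar>v - u\<bar> powr (- (1 + \<gamma>)))"
      proof (cases "v = u")
        case False
        then show ?thesis by (intro tendsto_intros lim) simp
      qed (simp add: comp_def)
    qed
  qed (use bound in auto)
  then show "(\<lambda>n. LBINT v:{0..1}. (g v - g u) * k n \<bar>v - u\<bar>) \<longlonglongrightarrow> (LBINT v:{0..1}. comp d u v * \<bar>v - u\<bar> powr (- (1 + \<gamma>)))"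
    using compensated_integral[OF d u k(1-3)] by (simp add: set_lebesgue_integral_def)
  have "\<bar>LBINT v:{0..1}. (g v - g u) * k n \<bar>v - u\<bar>\<bar> = norm (\<integral>v. indicator {0..1} v *\<^sub>R (comp d u v * k n \<bar>v - u\<bar>) \<partial>lborel)"
    using compensated_integral[OF d u k(1-3)] by (simp add: set_lebesgue_integral_def)
  also have "\<dots> \<le> (\<integral>v. B * near_weight \<gamma> (v - u) \<partial>lborel)"
    by (rule Bochner_Integration.integral_norm_bound_integral[OF _ w])
       (use bound in \<open>auto intro!: Bochner_Integration.integrable_bound[OF w] simp: near_weight_nonneg B(1)\<close>)
  also have "\<dots> = B * (\<integral>v. near_weight \<gamma> v \<partial>lborel)"
    using near_weight_shift[OF \<gamma>(2)] by simp
  finally show "\<bar>LBINT v:{0..1}. (g v - g u) * k n \<bar>v - u\<bar>\<bar> \<le> B * (\<integral>v. near_weight \<gamma> v \<partial>lborel)" .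
qed

text \<open>\<open>Lim\<close> has an unspecified value unless the limit exists. This lemma provides
  the existence of the principal value and expresses it by an absolutely convergent
  integral.\<close>

lemma frac_op_eq:
  assumes d: "\<And>x. x \<notin> {d..1 - d} \<Longrightarrow> g x = 0 \<and> deriv g x = 0" "d > 0" and u: "u \<in> {0..1}"
  shows "frac_op \<gamma> g u = c_norm \<gamma> * (LBINT v:{0..1}. comp d u v * \<bar>v - u\<bar> powr (- (1 + \<gamma>)))"
proof -
  obtain B where B: "B \<ge> 0" "\<And>u v. u \<in> {0..1} \<Longrightarrow> v \<in> {0..1} \<Longrightarrow> \<bar>comp d u v\<bar> \<le> B * (v - u)\<^sup>2"
    using comp_bound[OF d(2)] by metis
  have "((\<lambda>\<epsilon>. LBINT v:{0..1}. indicator {v. \<bar>u - v\<bar> \<ge> \<epsilon>} v * ((g v - g u) / \<bar>v - u\<bar> powr (1 + \<gamma>)))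
     \<longlongrightarrow> (LBINT v:{0..1}. comp d u v * \<bar>v - u\<bar> powr (- (1 + \<gamma>)))) (at_right 0)"
  proof (rule tendsto_at_right_sequentially[of 0 1])
    fix S :: "nat \<Rightarrow> real" assume S: "\<And>n. 0 < S n" "S \<longlonglongrightarrow> 0"
    define k where "k n r = indicator {S n..} r * r powr (- (1 + \<gamma>))" for n r
    have eq: "indicator {v. \<bar>u - v\<bar> \<ge> S n} v * ((g v - g u) / \<bar>v - u\<bar> powr (1 + \<gamma>)) = (g v - g u) * k n \<bar>v - u\<bar>" for n v
      by (simp only: k_def powr_minus_divide) (simp add: indicator_def abs_minus_commute)
    show "(\<lambda>n. LBINT v:{0..1}. indicator {v. \<bar>u - v\<bar> \<ge> S n} v * ((g v - g u) / \<bar>v - u\<bar> powr (1 + \<gamma>))) \<longlonglongrightarrow>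
      (LBINT v:{0..1}. comp d u v * \<bar>v - u\<bar> powr (- (1 + \<gamma>)))"
      unfolding eq
    proof (rule compensated_limit(1)[OF d u _ _ _ _ _ B])
      show "k n \<in> borel_measurable borel" for n unfolding k_def[abs_def] by measurable
      show "k n r \<le> S n powr (- (1 + \<gamma>))" for n r
        using S(1)[of n] \<gamma> by (auto simp: k_def indicator_def intro: powr_mono2')
      show "(\<lambda>n. k n r) \<longlonglongrightarrow> r powr (- (1 + \<gamma>))" if "0 < r" for r
      proof (rule tendsto_eventually)
        have "\<forall>\<^sub>F n in sequentially. S n < r" using S(2) that by (rule order_tendstoD)
        then show "\<forall>\<^sub>F n in sequentially. k n r = r powr (- (1 + \<gamma>))" by eventually_elim (simp add: k_def)
      qed
    qed (auto simp: k_def indicator_def)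
  qed simp
  then show ?thesis unfolding frac_op_def by (subst tendsto_Lim) auto
qed

text \<open>Summation by parts: the product of increments splits into two terms that the exchange of
  \<open>u\<close> and \<open>v\<close> maps to each other. The cap makes the separate integrals
  meaningful.\<close>

lemma kform_eq:
  assumes \<Phi>: "continuous_on {0..1} \<Phi>" and \<eta>: "\<eta> > 0"
  shows "kform \<gamma> \<eta> \<Phi> g = - 2 * (LBINT u:{0..1}. \<Phi> u * (LBINT v:{0..1}. (g v - g u) * max \<bar>v - u\<bar> \<eta> powr (- (1 + \<gamma>))))"
    and "continuous_on {0..1} (\<lambda>u. LBINT v:{0..1}. (g v - g u) * max \<bar>v - u\<bar> \<eta> powr (- (1 + \<gamma>)))"
proof -
  let ?k = "\<lambda>u v. max \<bar>v - u\<bar> \<eta> powr (- (1 + \<gamma>))"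
  have gc: "continuous_on A (\<lambda>x. g (f x))" if "continuous_on A f" for A :: "'a::topological_space set" and f
    by (rule continuous_on_compose2[OF g_continuous[of UNIV] that]) auto
  have kc: "continuous_on A (\<lambda>x. ?k (f x) (h x))" if "continuous_on A f" "continuous_on A h" for A :: "'a::topological_space set" and f h
    using that \<eta> by (intro continuous_intros) auto
  have inner: "(LBINT v:{0..1}. (g v - g u) * ?k u v) = integral {0..1} (\<lambda>v. (g v - g u) * ?k u v)" for u
    by (intro set_borel_integral_eq_integral borel_integrable_atLeastAtMost' continuous_intros gc kc)
  have "continuous_on ({0..1} \<times> cbox 0 1) (\<lambda>(u, v). (g v - g u) * ?k u v)"
    unfolding case_prod_beta' by (intro continuous_intros gc kc)
  from integral_continuous_on_param[OF this]
  show cont: "continuous_on {0..1} (\<lambda>u. LBINT v:{0..1}. (g v - g u) * ?k u v)"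
    unfolding inner by simp
  have outer: "(LBINT u:{0..1}. \<Phi> u * (LBINT v:{0..1}. (g v - g u) * ?k u v)) =
      integral {0..1} (\<lambda>u. \<Phi> u * (LBINT v:{0..1}. (g v - g u) * ?k u v))"
    by (intro set_borel_integral_eq_integral(2) borel_integrable_atLeastAtMost' continuous_intros \<Phi> cont)
  let ?Q = "cbox (0::real, 0::real) (1, 1)"
  let ?H = "\<lambda>u v. \<Phi> u * ((g v - g u) * ?k u v)"
  have H: "continuous_on ?Q (\<lambda>(u, v). ?H u v)" "continuous_on ?Q (\<lambda>(u, v). ?H v u)"
    unfolding case_prod_beta' by (intro continuous_intros gc kc continuous_on_fst_snd \<Phi>)+
  have one: "integral ?Q (\<lambda>(u, v). ?H u v) = integral {0..1} (\<lambda>u. \<Phi> u * integral {0..1} (\<lambda>v. (g v - g u) * ?k u v))"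
    using integral_prod_continuous[OF H(1)] by simp
  have two: "integral ?Q (\<lambda>(u, v). ?H v u) = integral ?Q (\<lambda>(u, v). ?H u v)"
    using integral_prod_continuous[OF H(2)] integral_prod_continuous[OF H(1)] integral_swap_continuous[OF H(1)] by simp
  have "kform \<gamma> \<eta> \<Phi> g = integral ?Q (\<lambda>z. - (case z of (u, v) \<Rightarrow> ?H u v) - (case z of (u, v) \<Rightarrow> ?H v u))"
    unfolding kform_def kern_def
  proof (intro integral_cong)
    fix z :: "real \<times> real"
    obtain u v where z: "z = (u, v)" by (cases z)
    have e: "max \<bar>u - v\<bar> \<eta> = max \<bar>v - u\<bar> \<eta>" by (simp add: abs_minus_commute)
    show "(case z of (u, v) \<Rightarrow> (\<Phi> u - \<Phi> v) * (g u - g v) * max \<bar>u - v\<bar> \<eta> powr (- (1 + \<gamma>))) =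
        - (case z of (u, v) \<Rightarrow> ?H u v) - (case z of (u, v) \<Rightarrow> ?H v u)"
      unfolding z prod.case e by (simp add: algebra_simps)
  qed
  also have "\<dots> = - integral ?Q (\<lambda>(u, v). ?H u v) - integral ?Q (\<lambda>(u, v). ?H v u)"
    using integrable_continuous[OF H(1)] integrable_continuous[OF H(2)]
    by (subst integral_diff[OF integrable_neg]) (auto simp: integral_neg)
  finally show "kform \<gamma> \<eta> \<Phi> g = - 2 * (LBINT u:{0..1}. \<Phi> u * (LBINT v:{0..1}. (g v - g u) * ?k u v))"
    unfolding outer two one by (simp only: inner)
qed

text \<open>Translates the weak equation into the language of \<open>kform\<close>: after
  \<open>kform_eq\<close> the inner integral converges boundedly to
  \<open>frac_op \<gamma> g / c_norm \<gamma>\<close>.\<close>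

lemma kform_tendsto_0:
  assumes \<Phi>: "continuous_on {0..1} \<Phi>" and weak: "(LBINT u:{0..1}. \<Phi> u * frac_op \<gamma> g u) = 0" and c: "c_norm \<gamma> > 0"
  shows "((\<lambda>\<eta>. kform \<gamma> \<eta> \<Phi> g) \<longlongrightarrow> 0) (at_right 0)"
proof (rule tendsto_at_right_sequentially[of 0 1])
  fix S :: "nat \<Rightarrow> real" assume S: "\<And>n. 0 < S n" "S \<longlonglongrightarrow> 0"
  obtain d where d: "d > 0" "\<And>x. x \<notin> {d..1 - d} \<Longrightarrow> g x = 0 \<and> deriv g x = 0" using support by blast
  obtain B where B: "B \<ge> 0" "\<And>u v. u \<in> {0..1} \<Longrightarrow> v \<in> {0..1} \<Longrightarrow> \<bar>comp d u v\<bar> \<le> B * (v - u)\<^sup>2"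
    using comp_bound[OF d(1)] by metis
  define k where "k n r = max r (S n) powr (- (1 + \<gamma>))" for n r
  let ?L = "\<lambda>n u. LBINT v:{0..1}. (g v - g u) * k n \<bar>v - u\<bar>"
  let ?l = "\<lambda>u. LBINT v:{0..1}. comp d u v * \<bar>v - u\<bar> powr (- (1 + \<gamma>))"
  have klim: "(\<lambda>n. k n r) \<longlonglongrightarrow> r powr (- (1 + \<gamma>))" if "0 < r" for r
  proof (rule tendsto_eventually)
    have "\<forall>\<^sub>F n in sequentially. S n < r" using S(2) that by (rule order_tendstoD)
    then show "\<forall>\<^sub>F n in sequentially. k n r = r powr (- (1 + \<gamma>))" by eventually_elim (simp add: k_def max_def)
  qed
  have km: "k n \<in> borel_measurable borel" for n unfolding k_def[abs_def] by measurable
  have kK: "k n r \<le> S n powr (- (1 + \<gamma>))" for n r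
    unfolding k_def using S(1)[of n] \<gamma> by (intro powr_mono2') auto
  have kr: "k n r \<le> r powr (- (1 + \<gamma>))" if "0 < r" for n r
    unfolding k_def using that \<gamma> by (intro powr_mono2') auto
  have k0: "0 \<le> k n r" for n r by (simp add: k_def)
  have L: "(\<lambda>n. ?L n u) \<longlonglongrightarrow> ?l u" "\<bar>?L n u\<bar> \<le> B * (\<integral>v. near_weight \<gamma> v \<partial>lborel)" if "u \<in> {0..1}" for n u
    by (rule compensated_limit[OF d(2,1) that km k0 kK kr klim B]; assumption)+
  let ?N = "\<integral>v. near_weight \<gamma> v \<partial>lborel"
  obtain M where M: "\<And>u. u \<in> {0..1} \<Longrightarrow> \<bar>\<Phi> u\<bar> \<le> M"
    using compact_imp_bounded[OF compact_continuous_image[OF \<Phi> compact_Icc]] unfolding bounded_iff real_norm_def by blast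
  have M0: "M \<ge> 0" using M[of 0] by simp
  have meas: "(\<lambda>u. indicator {0..1} u *\<^sub>R (\<Phi> u * ?L n u)) \<in> borel_measurable lborel" for n
  proof -
    have "continuous_on {0..1} (\<lambda>u. \<Phi> u * ?L n u)"
      using kform_eq(2)[OF \<Phi> S(1)[of n]] by (intro continuous_intros \<Phi>) (simp add: k_def)
    then have "set_integrable lborel {0..1} (\<lambda>u. \<Phi> u * ?L n u)" by (rule borel_integrable_atLeastAtMost')
    then show ?thesis by (simp add: set_integrable_def borel_measurable_integrable)
  qed
  have lim: "(\<lambda>n. indicator {0..1} u *\<^sub>R (\<Phi> u * ?L n u)) \<longlonglongrightarrow> indicator {0..1} u *\<^sub>R (\<Phi> u * ?l u)" for u
  proof (cases "u \<in> {0..1}")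
    case True
    then show ?thesis using tendsto_mult[OF tendsto_const L(1)[OF True], of "\<Phi> u"] by simp
  qed simp
  have "(\<lambda>n. LBINT u:{0..1}. \<Phi> u * ?L n u) \<longlonglongrightarrow> (LBINT u:{0..1}. \<Phi> u * ?l u)"
    unfolding set_lebesgue_integral_def[of lborel "{0..1}" "\<lambda>u. \<Phi> u * _ u"]
  proof (rule integral_dominated_convergence[where w = "\<lambda>u. indicator {0..1} u *\<^sub>R (M * (B * ?N))"])
    show "(\<lambda>u. indicator {0..1} u *\<^sub>R (\<Phi> u * ?l u)) \<in> borel_measurable lborel"
      by (rule borel_measurable_LIMSEQ_real[OF lim meas])
    show "integrable lborel (\<lambda>u::real. indicator {0..1} u *\<^sub>R (M * (B * ?N)))"
      using integrable_real_indicator[of "{0..1::real}" lborel] by simp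
    show "AE u in lborel. norm (indicator {0..1} u *\<^sub>R (\<Phi> u * ?L n u)) \<le> indicator {0..1} u *\<^sub>R (M * (B * ?N))" for n
    proof (intro AE_I2)
      fix u
      show "norm (indicator {0..1} u *\<^sub>R (\<Phi> u * ?L n u)) \<le> indicator {0..1} u *\<^sub>R (M * (B * ?N))"
      proof (cases "u \<in> {0..1}")
        case True
        have "\<bar>\<Phi> u\<bar> * \<bar>?L n u\<bar> \<le> M * (B * ?N)"
          using True M0 by (intro mult_mono M L(2)) auto
        then show ?thesis using True by (simp add: abs_mult)
      qed simp
    qed
  qed (use lim meas in auto)
  moreover have "(LBINT u:{0..1}. \<Phi> u * ?l u) = 0"
  proof -
    have "(LBINT u:{0..1}. \<Phi> u * frac_op \<gamma> g u) = (LBINT u:{0..1}. c_norm \<gamma> * (\<Phi> u * ?l u))"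
    proof (rule set_lebesgue_integral_cong)
      have "\<Phi> u * frac_op \<gamma> g u = c_norm \<gamma> * (\<Phi> u * ?l u)" if "u \<in> {0..1}" for u
      proof -
        have "frac_op \<gamma> g u = c_norm \<gamma> * ?l u" by (rule frac_op_eq[OF d(2,1) that])
        then show ?thesis by (simp only: mult.left_commute)
      qed
      then show "\<forall>u. u \<in> {0..1} \<longrightarrow> \<Phi> u * frac_op \<gamma> g u = c_norm \<gamma> * (\<Phi> u * ?l u)" by blast
    qed simp
    then show ?thesis using weak c by simp
  qed
  moreover have "kform \<gamma> (S n) \<Phi> g = - 2 * (LBINT u:{0..1}. \<Phi> u * ?L n u)" for n
    using kform_eq(1)[OF \<Phi> S(1)[of n]] by (simp add: k_def)
  ultimately show "(\<lambda>n. kform \<gamma> (S n) \<Phi> g) \<longlonglongrightarrow> 0"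
    using tendsto_mult[OF tendsto_const[of "- 2"], of "\<lambda>n. LBINT u:{0..1}. \<Phi> u * ?L n u" 0] by simp
qed simp

end

section \<open>Riemann sums\<close>

lemma riemann_sum_error:
  fixes h :: "real \<Rightarrow> real"
  assumes n: "n > 0" and h: "continuous_on {0..1} h"
    and osc: "\<And>s t. s \<in> {0..1} \<Longrightarrow> t \<in> {0..1} \<Longrightarrow> \<bar>s - t\<bar> \<le> 1 / real n \<Longrightarrow> \<bar>h s - h t\<bar> \<le> e"
  shows "\<bar>(\<Sum>x<n. h (real x / real n)) / real n - integral {0..1} h\<bar> \<le> e"
proof -
  have part: "\<bar>(\<Sum>x<k. h (real x / real n)) / real n - integral {0..real k / real n} h\<bar> \<le> e * (real k / real n)" if "k \<le> n" for k
    using that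
  proof (induction k)
    case (Suc k)
    let ?a = "real k / real n" and ?b = "real (Suc k) / real n"
    have ab: "0 \<le> ?a" "?a \<le> ?b" "?b \<le> 1" "?b - ?a = 1 / real n"
      using n Suc.prems by (auto simp: field_simps)
    have sub: "{0..?b} \<subseteq> {0..1}" "{?a..?b} \<subseteq> {0..1}"
      unfolding atLeastatMost_subset_iff using ab(1-3) by linarith+
    have i: "h integrable_on {0..?b}" "h integrable_on {?a..?b}"
      by (intro integrable_continuous_real continuous_on_subset[OF h] sub)+
    have split: "integral {0..?b} h = integral {0..?a} h + integral {?a..?b} h"
      using Henstock_Kurzweil_Integration.integral_combine[OF ab(1,2) i(1)] by simp
    have "\<bar>integral {?a..?b} (\<lambda>t. h ?a - h t)\<bar> \<le> e * (?b - ?a)"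
    proof -
      have "norm (integral {?a..?b} (\<lambda>t. h ?a - h t)) \<le> e * (?b - ?a)"
      proof (rule integral_bound[OF ab(2)])
        show "continuous_on {?a..?b} (\<lambda>t. h ?a - h t)" by (intro continuous_intros continuous_on_subset[OF h] sub)
        fix t assume t: "t \<in> {?a..?b}"
        have "?a \<in> {?a..?b}" using ab(2) by simp
        then have "?a \<in> {0..1}" "t \<in> {0..1}" using t sub(2) by blast+
        moreover have "\<bar>?a - t\<bar> \<le> 1 / real n" using t unfolding ab(4)[symmetric] by (simp only: atLeastAtMost_iff) linarith
        ultimately show "norm (h ?a - h t) \<le> e" using osc by simp
      qed
      then show ?thesis by simp
    qed
    also have "integral {?a..?b} (\<lambda>t. h ?a - h t) = h ?a / real n - integral {?a..?b} h"
      using ab by (subst Henstock_Kurzweil_Integration.integral_diff[OF _ i(2)]) auto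
    finally have "\<bar>h ?a / real n - integral {?a..?b} h\<bar> \<le> e * (?b - ?a)" .
    moreover have "\<bar>(\<Sum>x<k. h (real x / real n)) / real n - integral {0..?a} h\<bar> \<le> e * ?a" using Suc by simp
    ultimately show ?case unfolding split by (simp add: add_divide_distrib algebra_simps)
  qed simp
  from part[of n] n show ?thesis by simp
qed

lemma uniform_oscillation:
  fixes h :: "'a::euclidean_space \<Rightarrow> real"
  assumes "compact S" "continuous_on S h" "e > 0"
  obtains d where "d > 0" "\<And>s t. s \<in> S \<Longrightarrow> t \<in> S \<Longrightarrow> dist s t < d \<Longrightarrow> \<bar>h s - h t\<bar> \<le> e"
  using compact_uniformly_continuous[OF assms(2,1)] assms(3)
  unfolding uniformly_continuous_on_def by (metis dist_real_def less_imp_le)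

lemma sum_lessThan_eq_sites:
  "n \<ge> 1 \<Longrightarrow> (\<Sum>x<n. f x) = f 0 + (\<Sum>x\<in>sites n. f x)"
proof -
  assume "n \<ge> 1"
  then have "{..<n} = insert 0 (sites n)" by (auto simp: sites_def)
  then show ?thesis by (simp add: sites_def)
qed

lemma riemann_sum_sites:
  assumes h: "continuous_on {0..1} h"
  shows "(\<lambda>n. (\<Sum>x\<in>sites n. h (real x / real n)) / real n) \<longlonglongrightarrow> integral {0..1} h"
proof -
  have "(\<lambda>n. (\<Sum>x<n. h (real x / real n)) / real n) \<longlonglongrightarrow> integral {0..1} h"
  proof (rule LIMSEQ_I)
    fix r :: real assume r: "r > 0"
    obtain d where d: "d > 0" "\<And>s t. s \<in> {0..1} \<Longrightarrow> t \<in> {0..1} \<Longrightarrow> dist s t < d \<Longrightarrow> \<bar>h s - h t\<bar> \<le> r / 2"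
      using uniform_oscillation[OF compact_Icc h, of "r / 2"] r by auto
    have "\<forall>\<^sub>F n in sequentially. 1 / real n < d \<and> n > 0"
      using order_tendstoD(2)[OF lim_const_over_n[of 1] d(1)] eventually_gt_at_top[of 0] by (rule eventually_conj)
    then obtain N where N: "\<And>n. n \<ge> N \<Longrightarrow> 1 / real n < d \<and> n > 0" by (auto simp: eventually_sequentially)
    have "norm ((\<Sum>x<n. h (real x / real n)) / real n - integral {0..1} h) < r" if "n \<ge> N" for n
    proof -
      have "\<bar>(\<Sum>x<n. h (real x / real n)) / real n - integral {0..1} h\<bar> \<le> r / 2"
        using N[OF that] d(2) by (intro riemann_sum_error h) (auto simp: dist_real_def)
      then show ?thesis using r by simp
    qed
    then show "\<exists>no. \<forall>n\<ge>no. norm ((\<Sum>x<n. h (real x / real n)) / real n - integral {0..1} h) < r" by blast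
  qed
  \<comment> \<open>The sum over \<open>sites n\<close> lacks the left end point 0 of the Riemann
    sum; the missing term is of order 1/n.\<close>
  moreover have "(\<lambda>n. h 0 / real n) \<longlonglongrightarrow> 0" by (rule lim_const_over_n)
  ultimately have "(\<lambda>n. (\<Sum>x<n. h (real x / real n)) / real n - h 0 / real n) \<longlonglongrightarrow> integral {0..1} h - 0"
    by (rule tendsto_diff)
  then have "(\<lambda>n. (\<Sum>x<n. h (real x / real n)) / real n - h 0 / real n) \<longlonglongrightarrow> integral {0..1} h" by simp
  then show ?thesis
    by (rule Lim_transform_eventually)
       (auto simp: eventually_sequentially sum_lessThan_eq_sites diff_divide_distrib[symmetric] intro!: exI[of _ 1])
qed

text \<open>Reduction to one dimension: the inner sums approximate \<open>J\<close> uniformly in the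
  first variable, and the outer sum is then a Riemann sum of \<open>J\<close>.\<close>

lemma riemann_sum_sites_2:
  assumes H: "continuous_on (cbox (0, 0) (1, 1)) (\<lambda>(u, v). H u v)"
  shows "(\<lambda>n. (\<Sum>x\<in>sites n. \<Sum>y\<in>sites n. H (real x / real n) (real y / real n)) / (real n)\<^sup>2)
    \<longlonglongrightarrow> integral (cbox (0, 0) (1, 1)) (\<lambda>(u, v). H u v)"
proof -
  let ?Q = "cbox (0::real, 0::real) (1, 1)"
  have H': "continuous_on ({0..1} \<times> cbox 0 1) (\<lambda>(u, v). H u v)" using H by (simp add: cbox_Pair_eq)
  define J where "J u = integral {0..1} (H u)" for u
  have J: "continuous_on {0..1} J" using integral_continuous_on_param[OF H'] by (simp add: J_def[abs_def])
  have eq: "integral ?Q (\<lambda>(u, v). H u v) = integral {0..1} J"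
    using integral_prod_continuous[OF H] by (simp add: J_def[abs_def])
  have Hu: "continuous_on {0..1} (H u)" if "u \<in> {0..1}" for u
    by (rule continuous_on_compose2[OF H', of _ "\<lambda>v. (u, v)", simplified]) (use that in \<open>auto intro!: continuous_intros\<close>)
  obtain M where M: "\<And>z. z \<in> ?Q \<Longrightarrow> \<bar>case z of (u, v) \<Rightarrow> H u v\<bar> \<le> M"
    using compact_imp_bounded[OF compact_continuous_image[OF H compact_cbox]] unfolding bounded_iff real_norm_def by blast
  have M': "\<bar>H u v\<bar> \<le> M" if "u \<in> {0..1}" "v \<in> {0..1}" for u v using M[of "(u, v)"] that by (simp add: cbox_Pair_eq)
  have M0: "M \<ge> 0" using M'[of 0 0] by simp
  have in01: "real x / real n \<in> {0..1}" if "x \<in> sites n" for x n using that by (auto simp: sites_def field_simps)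
  show ?thesis unfolding eq
  proof (rule LIMSEQ_I)
    fix r :: real assume r: "r > 0"
    obtain d where d: "d > 0" "\<And>s t. s \<in> ?Q \<Longrightarrow> t \<in> ?Q \<Longrightarrow> dist s t < d \<Longrightarrow> \<bar>(case s of (u, v) \<Rightarrow> H u v) - (case t of (u, v) \<Rightarrow> H u v)\<bar> \<le> r / 4"
      using uniform_oscillation[OF compact_cbox H, of "r / 4"] r by auto
    have "\<forall>\<^sub>F n in sequentially. 1 / real n < d \<and> M / real n < r / 4 \<and> n > 0 \<and> norm ((\<Sum>x\<in>sites n. J (real x / real n)) / real n - integral {0..1} J) < r / 4"
      using order_tendstoD(2)[OF lim_const_over_n[of 1] d(1)] order_tendstoD(2)[OF lim_const_over_n[of M], of "r / 4"] eventually_gt_at_top[of 0]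
        tendstoD[OF riemann_sum_sites[OF J], of "r / 4"] r
      by (intro eventually_conj) (auto simp: dist_norm)
    then obtain N where N: "\<And>n. n \<ge> N \<Longrightarrow> 1 / real n < d \<and> M / real n < r / 4 \<and> n > 0 \<and> norm ((\<Sum>x\<in>sites n. J (real x / real n)) / real n - integral {0..1} J) < r / 4"
      unfolding eventually_sequentially by blast
    have "norm ((\<Sum>x\<in>sites n. \<Sum>y\<in>sites n. H (real x / real n) (real y / real n)) / (real n)\<^sup>2 - integral {0..1} J) < r" if "n \<ge> N" for n
    proof -
      have n: "1 / real n < d" "M / real n < r / 4" "n > 0" "\<bar>(\<Sum>x\<in>sites n. J (real x / real n)) / real n - integral {0..1} J\<bar> < r / 4"
        using N[OF that] by auto
      have inner: "\<bar>(\<Sum>y\<in>sites n. H u (real y / real n)) / real n - J u\<bar> \<le> r / 2" if u: "u \<in> {0..1}" for u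
      proof -
        have "\<bar>(\<Sum>y<n. H u (real y / real n)) / real n - J u\<bar> \<le> r / 4"
          unfolding J_def
        proof (rule riemann_sum_error[OF n(3) Hu[OF u]])
          fix s t :: real assume st: "s \<in> {0..1}" "t \<in> {0..1}" "\<bar>s - t\<bar> \<le> 1 / real n"
          then have "dist (u, s) (u, t) < d" using n(1) by (simp add: dist_Pair_Pair dist_real_def)
          then show "\<bar>H u s - H u t\<bar> \<le> r / 4" using d(2)[of "(u, s)" "(u, t)"] st u by (simp add: cbox_Pair_eq)
        qed
        moreover have "(\<Sum>y<n. H u (real y / real n)) / real n = H u 0 / real n + (\<Sum>y\<in>sites n. H u (real y / real n)) / real n"
          using n(3) by (simp add: sum_lessThan_eq_sites add_divide_distrib)
        moreover have "\<bar>H u 0 / real n\<bar> \<le> M / real n" using M'[OF u, of 0] n(3) by (simp add: divide_right_mono)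
        ultimately show ?thesis using n(2) by linarith
      qed
      have "(\<Sum>x\<in>sites n. \<Sum>y\<in>sites n. H (real x / real n) (real y / real n)) / (real n)\<^sup>2 - (\<Sum>x\<in>sites n. J (real x / real n)) / real n
        = (\<Sum>x\<in>sites n. (\<Sum>y\<in>sites n. H (real x / real n) (real y / real n)) / real n - J (real x / real n)) / real n"
        using n(3) by (simp add: sum_subtractf diff_divide_distrib power2_eq_square flip: sum_divide_distrib)
      also have "\<bar>\<dots>\<bar> \<le> (\<Sum>x\<in>sites n. r / 2) / real n"
      proof -
        have "\<bar>\<Sum>x\<in>sites n. (\<Sum>y\<in>sites n. H (real x / real n) (real y / real n)) / real n - J (real x / real n)\<bar> \<le> (\<Sum>x\<in>sites n. r / 2)"
          by (rule order_trans[OF sum_abs sum_mono]) (rule inner[OF in01])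
        from divide_right_mono[OF this, of "real n"] show ?thesis by (simp add: abs_divide)
      qed
      also have "\<dots> \<le> r / 2"
        using n(3) r by (simp add: card_sites field_simps)
      finally show ?thesis using n(4) r unfolding real_norm_def by linarith
    qed
    then show "\<exists>no. \<forall>n\<ge>no. norm ((\<Sum>x\<in>sites n. \<Sum>y\<in>sites n. H (real x / real n) (real y / real n)) / (real n)\<^sup>2 - integral {0..1} J) < r" by blast
  qed
qed

text \<open>At a fixed cap the kernel is bounded, so uniformly small errors of the two profiles
  change the normalised double sum only slightly, and the rest is a Riemann sum. The map
  \<open>r\<close> allows for subsequences of lattice sizes.\<close>

lemma discrete_form_tendsto:
  assumes \<eta>: "\<eta> > 0" and f: "continuous_on {0..1} f" and g: "continuous_on {0..1} g"
    and mf: "\<And>e. e > 0 \<Longrightarrow> \<forall>\<^sub>F n in sequentially. \<forall>x\<in>sites (r n). \<bar>m n x - f (real x / real (r n))\<bar> \<le> e"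
    and mg: "\<And>e. e > 0 \<Longrightarrow> \<forall>\<^sub>F n in sequentially. \<forall>x\<in>sites (r n). \<bar>k n x - g (real x / real (r n))\<bar> \<le> e"
    and r: "filterlim r at_top sequentially"
  shows "(\<lambda>n. (\<Sum>x\<in>sites (r n). \<Sum>y\<in>sites (r n). (m n x - m n y) * (k n x - k n y) * kern \<gamma> \<eta> (real x / real (r n)) (real y / real (r n))) / (real (r n))\<^sup>2)
    \<longlonglongrightarrow> kform \<gamma> \<eta> f g"
proof -
  let ?K = "\<lambda>n x y. kern \<gamma> \<eta> (real x / real (r n)) (real y / real (r n))"
  let ?f = "\<lambda>n x. f (real x / real (r n))" and ?g = "\<lambda>n x. g (real x / real (r n))"
  let ?S = "\<lambda>n. (\<Sum>x\<in>sites (r n). \<Sum>y\<in>sites (r n). (m n x - m n y) * (k n x - k n y) * ?K n x y) / (real (r n))\<^sup>2"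
  let ?T = "\<lambda>n. (\<Sum>x\<in>sites (r n). \<Sum>y\<in>sites (r n). (?f n x - ?f n y) * (?g n x - ?g n y) * ?K n x y) / (real (r n))\<^sup>2"
  have T: "?T \<longlonglongrightarrow> kform \<gamma> \<eta> f g"
    using filterlim_compose[OF riemann_sum_sites_2[OF kform_continuous[OF f g \<eta>]] r] by (simp add: kform_def)
  have bd: "\<exists>M. \<forall>x\<in>{0..1}. \<bar>h x\<bar> \<le> M" if "continuous_on {0..1} h" for h :: "real \<Rightarrow> real"
    using compact_imp_bounded[OF compact_continuous_image[OF that compact_Icc]] unfolding bounded_iff real_norm_def by blast
  obtain A where A: "\<And>x. x \<in> {0..1} \<Longrightarrow> \<bar>f x\<bar> \<le> A" using bd[OF f] by blast
  obtain B where B: "\<And>x. x \<in> {0..1} \<Longrightarrow> \<bar>g x\<bar> \<le> B" using bd[OF g] by blast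
  have AB: "A \<ge> 0" "B \<ge> 0" using A[of 0] B[of 0] by auto
  have "(\<lambda>n. ?S n - ?T n) \<longlonglongrightarrow> 0"
  proof (rule LIMSEQ_I)
    fix c :: real assume c: "c > 0"
    obtain W where W: "\<And>u v. u \<in> {0..1} \<Longrightarrow> v \<in> {0..1} \<Longrightarrow> kern \<gamma> \<eta> u v \<le> W" "W > 0"
    proof -
      have K: "continuous_on (cbox (0::real, 0::real) (1, 1)) (\<lambda>z. kern \<gamma> \<eta> (fst z) (snd z))" by (intro continuous_intros \<eta>)
      obtain W where W: "\<And>z. z \<in> cbox (0::real, 0::real) (1, 1) \<Longrightarrow> \<bar>kern \<gamma> \<eta> (fst z) (snd z)\<bar> \<le> W"
        using compact_imp_bounded[OF compact_continuous_image[OF K compact_cbox]] unfolding bounded_iff real_norm_def by blast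
      have "kern \<gamma> \<eta> u v \<le> \<bar>W\<bar> + 1" if "u \<in> {0..1}" "v \<in> {0..1}" for u v
        using W[of "(u, v)"] that by (auto simp: cbox_Pair_eq)
      then show ?thesis using that[of "\<bar>W\<bar> + 1"] by auto
    qed
    \<comment> \<open>With errors \<open>s\<close>, \<open>t\<close> of size at most
      \<open>2 * e\<close>, \<open>e \<le> 1\<close>, and increments bounded by \<open>2 * A\<close>
      and \<open>2 * B\<close>, the product changes by at most
      \<open>(4 * A + 4 * B + 4) * e\<close>; \<open>W\<close> bounds the kernel.\<close>
    define e where "e = min 1 (c / (2 * ((4 * A + 4 * B + 4) * W)))"
    have D: "(4 * A + 4 * B + 4) * W > 0" using AB W(2) by simp
    have e: "e > 0" "e \<le> 1" "(4 * A + 4 * B + 4) * W * e \<le> c / 2"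
    proof -
      show "e > 0" "e \<le> 1" using c D by (auto simp: e_def)
      have "(4 * A + 4 * B + 4) * W * e \<le> (4 * A + 4 * B + 4) * W * (c / (2 * ((4 * A + 4 * B + 4) * W)))"
        using D by (intro mult_left_mono) (auto simp: e_def)
      also have "\<dots> = c / 2"
      proof -
        have "Z * (c / (2 * Z)) = c / 2" if "Z > 0" for Z :: real using that by simp
        from this[OF D] show ?thesis .
      qed
      finally show "(4 * A + 4 * B + 4) * W * e \<le> c / 2" .
    qed
    have "\<forall>\<^sub>F n in sequentially. 1 \<le> r n" using r by (simp add: filterlim_at_top)
    then have "\<forall>\<^sub>F n in sequentially. r n > 0" by eventually_elim simp
    with mf[OF e(1)] mg[OF e(1)] have "\<forall>\<^sub>F n in sequentially. norm (?S n - ?T n - 0) < c"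
    proof eventually_elim
      case (elim n)
      let ?N = "real (r n)"
      have in01: "real x / ?N \<in> {0..1}" if "x \<in> sites (r n)" for x using that by (auto simp: sites_def field_simps)
      have summand: "\<bar>(m n x - m n y) * (k n x - k n y) * ?K n x y - (?f n x - ?f n y) * (?g n x - ?g n y) * ?K n x y\<bar> \<le> c / 2"
        if xy: "x \<in> sites (r n)" "y \<in> sites (r n)" for x y
      proof -
        define a where "a = ?f n x - ?f n y"
        define b where "b = ?g n x - ?g n y"
        define s where "s = (m n x - m n y) - a"
        define t where "t = (k n x - k n y) - b"
        have "\<bar>m n x - ?f n x\<bar> \<le> e" "\<bar>m n y - ?f n y\<bar> \<le> e" "\<bar>k n x - ?g n x\<bar> \<le> e" "\<bar>k n y - ?g n y\<bar> \<le> e"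
          using elim xy by auto
        then have st: "\<bar>s\<bar> \<le> 2 * e" "\<bar>t\<bar> \<le> 2 * e" unfolding s_def t_def a_def b_def by linarith+
        have ab: "\<bar>a\<bar> \<le> 2 * A" "\<bar>b\<bar> \<le> 2 * B"
          using A[OF in01[OF xy(1)]] A[OF in01[OF xy(2)]] B[OF in01[OF xy(1)]] B[OF in01[OF xy(2)]] unfolding a_def b_def by linarith+
        have "(a + s) * (b + t) - a * b = s * b + a * t + s * t" by (simp add: algebra_simps)
        also have "\<bar>\<dots>\<bar> \<le> (2 * e) * (2 * B) + (2 * A) * (2 * e) + (2 * e) * 2"
        proof (intro order_trans[OF abs_triangle_ineq] add_mono)
          show "\<bar>s * b\<bar> \<le> (2 * e) * (2 * B)" unfolding abs_mult using st ab e by (intro mult_mono) auto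
          show "\<bar>a * t\<bar> \<le> (2 * A) * (2 * e)" unfolding abs_mult using st ab AB by (intro mult_mono) auto
          show "\<bar>s * t\<bar> \<le> (2 * e) * 2" unfolding abs_mult using st e by (intro mult_mono) auto
        qed
        also have "\<dots> = (4 * A + 4 * B + 4) * e" by (simp add: algebra_simps)
        finally have "\<bar>(a + s) * (b + t) - a * b\<bar> * ?K n x y \<le> ((4 * A + 4 * B + 4) * e) * W"
          using W(1)[OF in01[OF xy(1)] in01[OF xy(2)]] AB e by (intro mult_mono) (auto simp: kern_nonneg)
        also have "\<dots> \<le> c / 2" using e(3) by (simp add: mult_ac)
        finally have "\<bar>((a + s) * (b + t) - a * b) * ?K n x y\<bar> \<le> c / 2" by (simp add: abs_mult kern_nonneg)
        moreover have "a + s = m n x - m n y" "b + t = k n x - k n y" by (auto simp: s_def t_def)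
        ultimately show ?thesis by (simp add: a_def b_def left_diff_distrib)
      qed
      define D where "D x y = (m n x - m n y) * (k n x - k n y) * ?K n x y - (?f n x - ?f n y) * (?g n x - ?g n y) * ?K n x y" for x y
      have eq: "?S n - ?T n = (\<Sum>x\<in>sites (r n). \<Sum>y\<in>sites (r n). D x y) / ?N\<^sup>2"
        unfolding D_def by (simp only: sum_subtractf diff_divide_distrib)
      have "\<bar>\<Sum>x\<in>sites (r n). \<Sum>y\<in>sites (r n). D x y\<bar> \<le> (\<Sum>x\<in>sites (r n). \<Sum>y\<in>sites (r n). c / 2)"
        unfolding D_def by (rule order_trans[OF sum_abs sum_mono], rule order_trans[OF sum_abs sum_mono]) (rule summand)
      also have "\<dots> = real (r n - 1) * (real (r n - 1) * (c / 2))" by (simp add: card_sites)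
      also have "\<dots> \<le> ?N * (?N * (c / 2))" using c by (intro mult_mono) auto
      finally have "\<bar>?S n - ?T n\<bar> \<le> c / 2"
        unfolding eq abs_divide using elim by (simp add: divide_le_eq power2_eq_square mult_ac)
      then show ?case using c by simp
    qed
    then show "\<exists>no. \<forall>n\<ge>no. norm (?S n - ?T n - 0) < c" by (simp add: eventually_sequentially)
  qed
  from tendsto_add[OF this T] show ?thesis by simp
qed

section \<open>Convergence of the profiles\<close>

text \<open>After dividing by \<open>a + b\<close> this is \<open>x \<le> x powr \<alpha>\<close> on
  [0,1]. It is the triangle inequality behind the Hoelder extension.\<close>

lemma powr_subadditive:
  fixes a b :: real
  assumes "0 \<le> a" "0 \<le> b" "0 < \<alpha>" "\<alpha> \<le> 1"
  shows "(a + b) powr \<alpha> \<le> a powr \<alpha> + b powr \<alpha>"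
proof (cases "a + b = 0")
  case True
  then show ?thesis using assms by simp
next
  case False
  then have s: "a + b > 0" using assms by simp
  have frac: "x \<le> x powr \<alpha>" if "0 \<le> x" "x \<le> 1" for x :: real
    using powr_mono'[of \<alpha> 1 x] that assms by (cases "x = 0") auto
  have "1 = a / (a + b) + b / (a + b)" using s by (simp add: add_divide_distrib[symmetric])
  also have "\<dots> \<le> (a / (a + b)) powr \<alpha> + (b / (a + b)) powr \<alpha>"
    using assms s by (intro add_mono frac) auto
  also have "\<dots> = (a powr \<alpha> + b powr \<alpha>) / (a + b) powr \<alpha>"
    using assms s by (simp add: powr_divide add_divide_distrib)
  finally show ?thesis using s by (simp add: field_simps)
qed

text \<open>McShane's extension formula.\<close>

definition holder_ext :: "real \<Rightarrow> real \<Rightarrow> nat set \<Rightarrow> (nat \<Rightarrow> real) \<Rightarrow> (nat \<Rightarrow> real) \<Rightarrow> real \<Rightarrow> real" where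
  "holder_ext C \<alpha> S p m u = (MIN x\<in>S. m x + C * \<bar>u - p x\<bar> powr \<alpha>)"

lemma holder_ext_eq:
  assumes S: "finite S" "x \<in> S" and \<alpha>: "0 < \<alpha>"
    and m: "\<And>x y. x \<in> S \<Longrightarrow> y \<in> S \<Longrightarrow> \<bar>m x - m y\<bar> \<le> C * \<bar>p x - p y\<bar> powr \<alpha>"
  shows "holder_ext C \<alpha> S p m (p x) = m x"
  unfolding holder_ext_def
proof (rule Min_eqI)
  show "m x \<in> (\<lambda>y. m y + C * \<bar>p x - p y\<bar> powr \<alpha>) ` S"
    using S(2) \<alpha> by (intro image_eqI[of _ _ x]) auto
  fix z assume "z \<in> (\<lambda>y. m y + C * \<bar>p x - p y\<bar> powr \<alpha>) ` S"
  then obtain y where y: "y \<in> S" "z = m y + C * \<bar>p x - p y\<bar> powr \<alpha>" by blast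
  then show "m x \<le> z" using m[OF S(2) y(1)] by simp
qed (use S in auto)

lemma holder_ext_holder:
  assumes S: "finite S" "S \<noteq> {}" and \<alpha>: "0 < \<alpha>" "\<alpha> \<le> 1" and C: "C \<ge> 0"
  shows "\<bar>holder_ext C \<alpha> S p m u - holder_ext C \<alpha> S p m v\<bar> \<le> C * \<bar>u - v\<bar> powr \<alpha>"
proof -
  have le: "holder_ext C \<alpha> S p m u \<le> holder_ext C \<alpha> S p m v + C * \<bar>u - v\<bar> powr \<alpha>" for u v
  proof -
    have "holder_ext C \<alpha> S p m v \<in> (\<lambda>x. m x + C * \<bar>v - p x\<bar> powr \<alpha>) ` S"
      unfolding holder_ext_def using S by (intro Min_in) auto
    then obtain x where x: "x \<in> S" "holder_ext C \<alpha> S p m v = m x + C * \<bar>v - p x\<bar> powr \<alpha>" by blast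
    have "holder_ext C \<alpha> S p m u \<le> m x + C * \<bar>u - p x\<bar> powr \<alpha>"
      unfolding holder_ext_def using S x(1) by (intro Min_le) auto
    also have "\<bar>u - p x\<bar> powr \<alpha> \<le> (\<bar>u - v\<bar> + \<bar>v - p x\<bar>) powr \<alpha>"
      using \<alpha> by (intro powr_mono2) auto
    also have "\<dots> \<le> \<bar>u - v\<bar> powr \<alpha> + \<bar>v - p x\<bar> powr \<alpha>"
      using \<alpha> by (intro powr_subadditive) auto
    finally show ?thesis using C x(2) by (simp add: mult_left_mono distrib_left)
  qed
  show ?thesis using le[of u v] le[of v u] by (simp add: abs_minus_commute abs_le_iff)
qed

lemma sites_in_unit: "x \<in> sites n \<Longrightarrow> real x / real n \<in> {0..1}"
  by (auto simp: sites_def field_simps)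

text \<open>The powers of \<open>n\<close> cancel: rescaling the kernel gives
  \<open>n powr (1 + \<gamma>)\<close>, the energy bound \<open>n powr (1 - \<gamma>)\<close>, and
  the normalisation removes \<open>n\<^sup>2\<close>. The bound is uniform in \<open>n\<close> and
  \<eta>.\<close>

lemma discrete_energy_le:
  assumes \<gamma>: "\<gamma> > 1" and n: "n \<ge> 2" and E: "dist_energy (1 + \<gamma>) (sites n) m \<le> E * real n powr (1 - \<gamma>)" and \<eta>: "\<eta> > 0"
  shows "(\<Sum>x\<in>sites n. \<Sum>y\<in>sites n. (m x - m y) * (m x - m y) * kern \<gamma> \<eta> (real x / real n) (real y / real n)) / (real n)\<^sup>2 \<le> E"
proof -
  have "(m x - m y) * (m x - m y) * kern \<gamma> \<eta> (real x / real n) (real y / real n)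
      \<le> real n powr (1 + \<gamma>) * ((m x - m y)\<^sup>2 * \<bar>real x - real y\<bar> powr (- (1 + \<gamma>)))" for x y
  proof (cases "x = y")
    case False
    have "kern \<gamma> \<eta> (real x / real n) (real y / real n) \<le> \<bar>real x / real n - real y / real n\<bar> powr (- (1 + \<gamma>))"
      using False n by (intro kern_le_powr \<gamma>) auto
    also have "\<dots> = real n powr (1 + \<gamma>) * \<bar>real x - real y\<bar> powr (- (1 + \<gamma>))"
      using scaled_powr[of n x y "- (1 + \<gamma>)"] n by (simp only: minus_minus)
    finally have "(m x - m y)\<^sup>2 * kern \<gamma> \<eta> (real x / real n) (real y / real n) \<le> (m x - m y)\<^sup>2 * (real n powr (1 + \<gamma>) * \<bar>real x - real y\<bar> powr (- (1 + \<gamma>)))"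
      by (intro mult_left_mono) auto
    then show ?thesis by (simp only: power2_eq_square mult_ac)
  qed simp
  then have "(\<Sum>x\<in>sites n. \<Sum>y\<in>sites n. (m x - m y) * (m x - m y) * kern \<gamma> \<eta> (real x / real n) (real y / real n))
      \<le> real n powr (1 + \<gamma>) * dist_energy (1 + \<gamma>) (sites n) m"
    unfolding dist_energy_def sum_distrib_left by (intro sum_mono)
  also have "\<dots> \<le> real n powr (1 + \<gamma>) * (E * real n powr (1 - \<gamma>))" using E by (intro mult_left_mono) auto
  also have "\<dots> = E * (real n powr (1 + \<gamma>) * real n powr (1 - \<gamma>))" by simp
  also have "\<dots> = E * (real n)\<^sup>2" using n by (simp flip: powr_add)
  finally show ?thesis using n by (simp add: divide_le_eq)
qed

text \<open>Both \<open>f\<close> and \<Phi> satisfy the weak equation in the form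
  \<open>kform \<gamma> \<eta> _ g\<close> tending to 0: for \<open>f\<close> by letting
  \<open>n\<close> tend to infinity before \<eta> tends to 0, for \<Phi> by
  \<open>kform_tendsto_0\<close>. Uniqueness applies to the difference.\<close>

lemma limit_profile_unique:
  assumes \<gamma>: "1 < \<gamma>" "\<gamma> < 2" and weak: "weak_solution \<gamma> \<Phi>l \<Phi>r \<Phi>"
    and m: "\<And>n. discrete_harmonic \<gamma> \<Phi>l \<Phi>r (r n) (m n)" and r: "\<And>n::nat. r n \<ge> 2" "filterlim r at_top sequentially"
    and f: "continuous_on {0..1} f" "f 0 = \<Phi>l" "f 1 = \<Phi>r"
    and mf: "\<And>e. e > 0 \<Longrightarrow> \<forall>\<^sub>F n in sequentially. \<forall>x\<in>sites (r n). \<bar>m n x - f (real x / real (r n))\<bar> \<le> e"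
    and u: "u \<in> {0..1}"
  shows "f u = \<Phi> u"
proof -
  have \<Phi>: "continuous_on {0..1} \<Phi>" "frac_seminorm_sq \<gamma> \<Phi> < \<infinity>" "\<Phi> 0 = \<Phi>l" "\<Phi> 1 = \<Phi>r"
    "\<And>g. g \<in> test_unit \<Longrightarrow> (LBINT u:{0..1}. \<Phi> u * frac_op \<gamma> g u) = 0"
    using weak by (auto simp: weak_solution_def frac_sobolev_def)
  note c = c_norm_pos[OF \<gamma>(1)]
  obtain A where A: "\<And>\<eta>. \<eta> \<in> {0<..1} \<Longrightarrow> kform \<gamma> \<eta> \<Phi> \<Phi> \<le> A"
    using frac_seminorm_kform_bound[OF \<gamma>(1) c \<Phi>(1,2)] by blast
  obtain E where E: "\<And>n m. n \<ge> 2 \<Longrightarrow> discrete_harmonic \<gamma> \<Phi>l \<Phi>r n m \<Longrightarrow>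
     dist_energy (1 + \<gamma>) (sites n) m \<le> E * real n powr (1 - \<gamma>)"
    using discrete_harmonic_energy[OF \<gamma>, of \<Phi>l \<Phi>r] by metis
  have ff: "kform \<gamma> \<eta> f f \<le> E" if "\<eta> > 0" for \<eta>
    by (rule LIMSEQ_le_const2[OF discrete_form_tendsto[OF that f(1) f(1) mf mf r(2)]])
       (use discrete_energy_le[OF \<gamma>(1) r(1) E[OF r(1) m] that] in auto)
  have test_f: "((\<lambda>\<eta>. kform \<gamma> \<eta> f g) \<longlongrightarrow> 0) (at_right 0)" if "g \<in> test_unit" for g
  proof -
    interpret test_function \<gamma> g by unfold_locales (use \<gamma> that in auto)
    obtain d where d: "d > 0" "\<And>x. x \<notin> {d..1 - d} \<Longrightarrow> g x = 0 \<and> deriv g x = 0" using support by blast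
    obtain M where M: "M \<ge> 0" "\<And>u v. u \<in> {0..1} \<Longrightarrow> v \<in> {0..1} \<Longrightarrow> \<bar>g v - g u\<bar> \<le> M * \<bar>v - u\<bar>"
      using taylor_bound by metis
    obtain C where C: "C > 0" "\<And>n m g \<eta> M. n \<ge> 2 \<Longrightarrow> discrete_harmonic \<gamma> \<Phi>l \<Phi>r n m \<Longrightarrow> 0 < \<eta> \<Longrightarrow> M \<ge> 0 \<Longrightarrow> g 1 = 0 \<Longrightarrow> g (n - 1) = 0 \<Longrightarrow>
      (\<And>x y. x \<in> sites n \<Longrightarrow> y \<in> sites n \<Longrightarrow> \<bar>g x - g y\<bar> \<le> M * \<bar>real x / real n - real y / real n\<bar>) \<Longrightarrow>
      \<bar>(\<Sum>x\<in>sites n. \<Sum>y\<in>sites n. (m x - m y) * (g x - g y) * kern \<gamma> \<eta> (real x / real n) (real y / real n)) / (real n)\<^sup>2\<bar>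
       \<le> C * M * sqrt (\<eta> powr (2 - \<gamma>))"
      by (fact discrete_weak_form_bound[OF \<gamma>, of \<Phi>l \<Phi>r])
    \<comment> \<open>Once the lattice step is below \<open>d\<close>, the sites 1 and
      \<open>r n - 1\<close> lie outside the support of \<open>g\<close>, so the boundary terms of
      \<open>dform\<close> drop out.\<close>
    have small: "\<forall>\<^sub>F n in sequentially. 1 / real (r n) < d"
      using filterlim_compose[OF lim_const_over_n[of 1] r(2)] d(1) by (rule order_tendstoD(2))
    have bound: "\<bar>kform \<gamma> \<eta> f g\<bar> \<le> C * M * sqrt (\<eta> powr (2 - \<gamma>))" if \<eta>: "\<eta> > 0" for \<eta>
    proof (rule tendsto_upperbound[OF tendsto_rabs[OF discrete_form_tendsto[OF \<eta> f(1) g_continuous mf _ r(2)]]])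
      show "\<forall>\<^sub>F n in sequentially. \<forall>x\<in>sites (r n). \<bar>g (real x / real (r n)) - g (real x / real (r n))\<bar> \<le> e" if "e > 0" for e
        using that by simp
      show "\<forall>\<^sub>F n in sequentially. \<bar>(\<Sum>x\<in>sites (r n). \<Sum>y\<in>sites (r n). (m n x - m n y) * (g (real x / real (r n)) - g (real y / real (r n))) *
          kern \<gamma> \<eta> (real x / real (r n)) (real y / real (r n))) / (real (r n))\<^sup>2\<bar> \<le> C * M * sqrt (\<eta> powr (2 - \<gamma>))"
        using small
      proof eventually_elim
        case (elim n)
        have n0: "real (r n) > 0" using r(1)[of n] by simp
        show ?case
        proof (rule C(2)[OF r(1) m \<eta> M(1)])
          show "g (real 1 / real (r n)) = 0" using elim d(2)[of "1 / real (r n)"] by auto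
          have "real (r n - 1) / real (r n) = 1 - 1 / real (r n)" using r(1)[of n] by (simp add: of_nat_diff field_simps)
          then show "g (real (r n - 1) / real (r n)) = 0" using elim d(2)[of "1 - 1 / real (r n)"] by auto
          show "\<bar>g (real x / real (r n)) - g (real y / real (r n))\<bar> \<le> M * \<bar>real x / real (r n) - real y / real (r n)\<bar>"
            if "x \<in> sites (r n)" "y \<in> sites (r n)" for x y
            by (rule M(2)[OF sites_in_unit[OF that(2)] sites_in_unit[OF that(1)]])
        qed
      qed
    qed auto
    \<comment> \<open>The exponent 2 - \<gamma> is positive, so the error left after
      \<open>n\<close> has gone to infinity vanishes with \<eta>.\<close>
    have "((\<lambda>\<eta>::real. C * M * sqrt (\<eta> powr (2 - \<gamma>))) \<longlongrightarrow> C * M * sqrt (0 powr (2 - \<gamma>))) (at_right 0)"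
      by (rule tendsto_mult[OF tendsto_const tendsto_real_sqrt[OF tendsto_powr'[OF tendsto_ident_at tendsto_const]]])
         (use \<gamma> in \<open>auto simp: eventually_at_right_field intro!: exI[of _ 1]\<close>)
    then have "((\<lambda>\<eta>::real. C * M * sqrt (\<eta> powr (2 - \<gamma>))) \<longlongrightarrow> 0) (at_right 0)" by simp
    then show ?thesis
      by (rule Lim_null_comparison[rotated]) (use bound in \<open>auto simp: eventually_at_right_field intro!: exI[of _ 1]\<close>)
  qed
  have "f u - \<Phi> u = 0"
  proof (rule kform_uniqueness[OF \<gamma>(1), of "\<lambda>u. f u - \<Phi> u" "2 * E + 2 * A"])
    show "continuous_on {0..1} (\<lambda>u. f u - \<Phi> u)" by (intro continuous_intros f \<Phi>)
    show "f 0 - \<Phi> 0 = 0" "f 1 - \<Phi> 1 = 0" using f \<Phi> by auto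
    show "kform \<gamma> \<eta> (\<lambda>u. f u - \<Phi> u) (\<lambda>u. f u - \<Phi> u) \<le> 2 * E + 2 * A" if "\<eta> \<in> {0<..1}" for \<eta>
      using kform_diff_self_le[OF f(1) \<Phi>(1), of \<eta> \<gamma>] ff[of \<eta>] A[OF that] that by simp
    fix g assume g: "g \<in> test_unit"
    interpret test_function \<gamma> g by unfold_locales (use \<gamma> g in auto)
    have "((\<lambda>\<eta>. kform \<gamma> \<eta> f g - kform \<gamma> \<eta> \<Phi> g) \<longlongrightarrow> 0 - 0) (at_right 0)"
      by (intro tendsto_diff test_f g kform_tendsto_0 \<Phi>(1,5) c)
    then have "((\<lambda>\<eta>. kform \<gamma> \<eta> f g - kform \<gamma> \<eta> \<Phi> g) \<longlongrightarrow> 0) (at_right 0)" by simp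
    then show "((\<lambda>\<eta>. kform \<gamma> \<eta> (\<lambda>u. f u - \<Phi> u) g) \<longlongrightarrow> 0) (at_right 0)"
    proof (rule Lim_transform_eventually)
      have "kform \<gamma> \<eta> f g - kform \<gamma> \<eta> \<Phi> g = kform \<gamma> \<eta> (\<lambda>u. f u - \<Phi> u) g" if "\<eta> > 0" for \<eta>
        using kform_diff_right[OF g_continuous f(1) \<Phi>(1) that, of \<gamma>] by (simp only: kform_commute[of \<gamma> \<eta> _ g])
      then show "\<forall>\<^sub>F \<eta> in at_right 0. kform \<gamma> \<eta> f g - kform \<gamma> \<eta> \<Phi> g = kform \<gamma> \<eta> (\<lambda>u. f u - \<Phi> u) g"
        by (auto simp: eventually_at_right_field intro!: exI[of _ 1])
    qed
  qed (rule u)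
  then show ?thesis by simp
qed

text \<open>Compactness and contradiction: infinitely many bad lattice sizes would have a uniformly
  convergent subsequence of extended profiles, and its limit is identified with \<Phi> by
  \<open>limit_profile_unique\<close>.\<close>

theorem discrete_profile_converges:
  assumes \<gamma>: "1 < \<gamma>" "\<gamma> < 2" and weak: "weak_solution \<gamma> \<Phi>l \<Phi>r \<Phi>"
    and m: "\<And>n. n \<ge> 2 \<Longrightarrow> discrete_harmonic \<gamma> \<Phi>l \<Phi>r n (m n)" and e: "e > 0"
  shows "\<forall>\<^sub>F n in sequentially. \<forall>x\<in>sites n. \<bar>m n x - \<Phi> (real x / real n)\<bar> \<le> e"
proof (rule ccontr)
  assume neg: "\<not> ?thesis"
  define bad where "bad = {n. n \<ge> 2 \<and> (\<exists>x\<in>sites n. \<bar>m n x - \<Phi> (real x / real n)\<bar> > e)}"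
  have "infinite bad"
    unfolding infinite_nat_iff_unbounded_le
  proof
    fix N
    have "\<not> (\<forall>n\<ge>max N 2. \<forall>x\<in>sites n. \<bar>m n x - \<Phi> (real x / real n)\<bar> \<le> e)"
      using neg unfolding eventually_sequentially by blast
    then show "\<exists>n\<ge>N. n \<in> bad" by (auto simp: bad_def not_le)
  qed
  then obtain s :: "nat \<Rightarrow> nat" where s: "strict_mono s" "\<And>n. s n \<in> bad"
    using infinite_enumerate by blast
  have s2: "s n \<ge> 2" for n using s(2)[of n] by (simp add: bad_def)
  define \<alpha> where "\<alpha> = (\<gamma> - 1) / 2"
  have \<alpha>: "0 < \<alpha>" "\<alpha> \<le> 1" using \<gamma> by (auto simp: \<alpha>_def)
  obtain C where C: "C > 0" "\<And>n m x y. n \<ge> 2 \<Longrightarrow> discrete_harmonic \<gamma> \<Phi>l \<Phi>r n m \<Longrightarrow> x \<in> sites n \<Longrightarrow> y \<in> sites n \<Longrightarrow>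
     \<bar>m x - m y\<bar> \<le> C * \<bar>real x / real n - real y / real n\<bar> powr \<alpha>"
    unfolding \<alpha>_def by (fact discrete_harmonic_holder[OF \<gamma>, of \<Phi>l \<Phi>r])
  obtain E where E: "E > 0" "\<And>n m. n \<ge> 2 \<Longrightarrow> discrete_harmonic \<gamma> \<Phi>l \<Phi>r n m \<Longrightarrow>
     dist_energy (1 + \<gamma>) (sites n) m \<le> E * real n powr (1 - \<gamma>) \<and>
     (m 1 - \<Phi>l)\<^sup>2 \<le> E * real n powr (1 - \<gamma>) \<and> (m (n - 1) - \<Phi>r)\<^sup>2 \<le> E * real n powr (1 - \<gamma>)"
    by (fact discrete_harmonic_energy[OF \<gamma>, of \<Phi>l \<Phi>r])
  \<comment> \<open>The profiles live on different lattices. Extending them with the same constant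
    and exponent gives functions on one common interval, equicontinuous and equal to
    \<open>m n\<close> at the sites.\<close>
  define F where "F n = holder_ext C \<alpha> (sites n) (\<lambda>x. real x / real n) (m n)" for n
  have ends: "1 \<in> sites n" "n - 1 \<in> sites n" if "n \<ge> 2" for n using that by (auto simp: sites_def)
  have F_eq: "F n (real x / real n) = m n x" if "n \<ge> 2" "x \<in> sites n" for n x
    unfolding F_def using holder_ext_eq[OF finite_sites that(2) \<alpha>(1) C(2)[OF that(1) m[OF that(1)]]] .
  have F_holder: "\<bar>F n u - F n v\<bar> \<le> C * \<bar>u - v\<bar> powr \<alpha>" if "n \<ge> 2" for n u v
    unfolding F_def using ends(1)[OF that] C(1) by (intro holder_ext_holder \<alpha>) auto
  have n_powr: "(\<lambda>n. E * real n powr (1 - \<gamma>)) \<longlonglongrightarrow> 0"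
  proof -
    have "((\<lambda>x::real. x powr (1 - \<gamma>)) \<longlongrightarrow> 0) at_top" by (rule tendsto_neg_powr) (use \<gamma> in \<open>auto intro: filterlim_ident\<close>)
    from tendsto_mult[OF tendsto_const filterlim_compose[OF this filterlim_real_sequentially], of E] show ?thesis by simp
  qed
  \<comment> \<open>The value at an end point \<open>z\<close> is compared with that at the nearest
    site, at distance 1/n, by the Hoelder bound; the energy bound forces the value at that site to
    the boundary datum.\<close>
  have bdry: "(\<lambda>n. F (q n) z) \<longlonglongrightarrow> b"
    if q: "\<And>n::nat. q n \<ge> 2" "filterlim q at_top sequentially"
      and y: "\<And>n. n \<ge> 2 \<Longrightarrow> y n \<in> sites n \<and> \<bar>z - real (y n) / real n\<bar> \<le> 1 / real n"
      and b: "\<And>n. n \<ge> 2 \<Longrightarrow> (m n (y n) - b)\<^sup>2 \<le> E * real n powr (1 - \<gamma>)" for q z b and y :: "nat \<Rightarrow> nat"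
  proof -
    have bd: "\<bar>F (q n) z - b\<bar> \<le> C * (1 / real (q n)) powr \<alpha> + sqrt (E * real (q n) powr (1 - \<gamma>))" for n
    proof -
      have "\<bar>F (q n) z - m (q n) (y (q n))\<bar> \<le> C * \<bar>z - real (y (q n)) / real (q n)\<bar> powr \<alpha>"
        using F_holder[OF q(1), of n z "real (y (q n)) / real (q n)"] F_eq[OF q(1)] y[OF q(1)] by simp
      also have "\<dots> \<le> C * (1 / real (q n)) powr \<alpha>"
        using C(1) \<alpha> y[OF q(1)[of n]] by (intro mult_left_mono powr_mono2) auto
      finally have 1: "\<bar>F (q n) z - m (q n) (y (q n))\<bar> \<le> C * (1 / real (q n)) powr \<alpha>" .
      have "\<bar>m (q n) (y (q n)) - b\<bar> \<le> sqrt (E * real (q n) powr (1 - \<gamma>))"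
        using b[OF q(1)[of n]] by (intro real_le_rsqrt) simp
      with 1 show ?thesis by linarith
    qed
    have "(\<lambda>n. C * (1 / real (q n)) powr \<alpha>) \<longlonglongrightarrow> C * 0 powr \<alpha>"
      using filterlim_compose[OF lim_const_over_n[of 1] q(2)] \<alpha>
      by (intro tendsto_mult tendsto_const tendsto_powr') auto
    moreover have "(\<lambda>n. sqrt (E * real (q n) powr (1 - \<gamma>))) \<longlonglongrightarrow> sqrt 0"
      by (intro tendsto_real_sqrt filterlim_compose[OF n_powr q(2)])
    ultimately have "(\<lambda>n. C * (1 / real (q n)) powr \<alpha> + sqrt (E * real (q n) powr (1 - \<gamma>))) \<longlonglongrightarrow> 0"
      using tendsto_add by force
    then have "(\<lambda>n. F (q n) z - b) \<longlonglongrightarrow> 0"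
      by (rule Lim_null_comparison[rotated]) (use bd in simp)
    then show ?thesis using Lim_null by blast
  qed
  \<comment> \<open>The three terms are the boundary datum, the misfit at site 1, whose square is at
    most \<open>E\<close> since \<open>n powr (1 - \<gamma>) \<le> 1\<close>, and the oscillation
    over a distance of at most 1.\<close>
  have F_bd: "norm (F (s n) u) \<le> \<bar>\<Phi>l\<bar> + sqrt E + C" if "u \<in> {0..1}" for n u
  proof -
    let ?n = "s n"
    have "\<bar>F ?n u - m ?n 1\<bar> \<le> C * \<bar>u - real 1 / real ?n\<bar> powr \<alpha>"
      using F_holder[OF s2, of n u "real 1 / real (s n)"] F_eq[OF s2 ends(1)[OF s2], of n] by simp
    also have "\<dots> \<le> C * 1"
    proof (intro mult_left_mono)
      have "\<bar>u - real 1 / real ?n\<bar> \<le> 1" using that sites_in_unit[OF ends(1)[OF s2], of n]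
        unfolding abs_le_iff atLeastAtMost_iff by linarith
      then show "\<bar>u - real 1 / real ?n\<bar> powr \<alpha> \<le> 1" using \<alpha> by (intro powr_le1) auto
    qed (use C in auto)
    finally have 1: "\<bar>F ?n u - m ?n 1\<bar> \<le> C" by simp
    have "(m ?n 1 - \<Phi>l)\<^sup>2 \<le> E * real ?n powr (1 - \<gamma>)" using E(2)[OF s2 m[OF s2]] by blast
    also have "\<dots> \<le> E * 1"
      using E(1) \<gamma> s2[of n] powr_mono[of "1 - \<gamma>" 0 "real ?n"] by (intro mult_left_mono) auto
    finally have "\<bar>m ?n 1 - \<Phi>l\<bar> \<le> sqrt E" by (intro real_le_rsqrt) simp
    with 1 show ?thesis unfolding real_norm_def by linarith
  qed
  have equicont: "\<exists>d. 0 < d \<and> (\<forall>n v. v \<in> {0..1} \<and> norm (u - v) < d \<longrightarrow> norm (F (s n) u - F (s n) v) < t)" if "t > 0" for u t :: real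
  proof (intro exI conjI allI impI)
    \<comment> \<open>The solution of \<open>C * d powr \<alpha> = t\<close>.\<close>
    let ?d = "(t / C) powr (1 / \<alpha>)"
    show "0 < ?d" using that C(1) by simp
    fix n v assume v: "v \<in> {0..1} \<and> norm (u - v) < ?d"
    have "norm (F (s n) u - F (s n) v) \<le> C * \<bar>u - v\<bar> powr \<alpha>" using F_holder[OF s2] by simp
    also have "\<dots> < C * ?d powr \<alpha>" using v C(1) \<alpha> by (intro mult_strict_left_mono powr_less_mono2) auto
    also have "\<dots> = t" using \<alpha> C(1) that by (simp add: powr_powr)
    finally show "norm (F (s n) u - F (s n) v) < t" .
  qed
  obtain f k where f: "continuous_on {0..1} f" and k: "strict_mono (k :: nat \<Rightarrow> nat)"
    and lim: "\<And>e. 0 < e \<Longrightarrow> \<exists>N. \<forall>n x. n \<ge> N \<and> x \<in> {0..1} \<longrightarrow> norm (F (s (k n)) x - f x) < e"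
    using Arzela_Ascoli[OF compact_Icc, of 0 1 "\<lambda>n. F (s n)" "\<bar>\<Phi>l\<bar> + sqrt E + C"] F_bd equicont by (metis (no_types, lifting))
  define q where "q n = s (k n)" for n
  have q: "q n \<ge> 2" for n using s2 by (simp add: q_def)
  have "strict_mono q" using strict_mono_compose[OF s(1) k] by (simp add: q_def[abs_def])
  then have q_lim: "filterlim q at_top sequentially" by (rule filterlim_subseq)
  have pt: "(\<lambda>n. F (q n) z) \<longlonglongrightarrow> f z" if "z \<in> {0..1}" for z
    using lim that unfolding q_def by (intro LIMSEQ_I) blast
  have close: "\<forall>\<^sub>F n in sequentially. \<forall>x\<in>sites (q n). \<bar>m (q n) x - f (real x / real (q n))\<bar> \<le> t" if t: "t > 0" for t
  proof -
    obtain N where N: "\<And>n x. n \<ge> N \<Longrightarrow> x \<in> {0..1} \<Longrightarrow> norm (F (q n) x - f x) < t" using lim[OF t] unfolding q_def by blast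
    have "\<bar>m (q n) x - f (real x / real (q n))\<bar> \<le> t" if "n \<ge> N" "x \<in> sites (q n)" for n x
      using N[OF that(1) sites_in_unit[OF that(2)]] F_eq[OF q that(2)] by simp
    then show ?thesis unfolding eventually_sequentially by blast
  qed
  have f0: "f 0 = \<Phi>l"
  proof (rule LIMSEQ_unique[OF pt[of 0] bdry[OF q q_lim, of "\<lambda>_. 1"]])
    show "1 \<in> sites n \<and> \<bar>0 - real 1 / real n\<bar> \<le> 1 / real n" if "n \<ge> 2" for n using ends(1)[OF that] by simp
    show "(m n 1 - \<Phi>l)\<^sup>2 \<le> E * real n powr (1 - \<gamma>)" if "n \<ge> 2" for n using E(2)[OF that m[OF that]] by blast
  qed simp
  have f1: "f 1 = \<Phi>r"
  proof (rule LIMSEQ_unique[OF pt[of 1] bdry[OF q q_lim, of "\<lambda>n. n - 1"]])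
    show "n - 1 \<in> sites n \<and> \<bar>1 - real (n - 1) / real n\<bar> \<le> 1 / real n" if "n \<ge> 2" for n
      using ends(2)[OF that] that by (simp add: of_nat_diff diff_divide_distrib)
    show "(m n (n - 1) - \<Phi>r)\<^sup>2 \<le> E * real n powr (1 - \<gamma>)" if "n \<ge> 2" for n using E(2)[OF that m[OF that]] by blast
  qed simp
  have eq: "f u = \<Phi> u" if "u \<in> {0..1}" for u
    by (rule limit_profile_unique[OF \<gamma> weak m[OF q] q q_lim f f0 f1 close that])
  obtain n where n: "\<forall>x\<in>sites (q n). \<bar>m (q n) x - f (real x / real (q n))\<bar> \<le> e"
    using eventually_happens[OF close[OF e]] by auto
  obtain x where x: "x \<in> sites (q n)" "\<bar>m (q n) x - \<Phi> (real x / real (q n))\<bar> > e"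
    using s(2)[of "k n"] by (auto simp: bad_def q_def)
  show False using n x eq[OF sites_in_unit[OF x(1)]] by fastforce
qed

text \<open>The pairing is a linear functional of the configuration: its mean is a Riemann sum of
  \<open>G\<close> times the discrete profile, and its variance is the sum of the squared weights.
  One half of \<delta> pays for the convergence of the mean, the other half for Chebyshev's
  inequality.\<close>

theorem theorem2p11:
  fixes \<gamma> \<Phi>l \<Phi>r \<delta> :: real
    and P :: "nat \<Rightarrow> real \<Rightarrow> config \<Rightarrow> config measure"
    and \<mu>ss :: "nat \<Rightarrow> config measure"
    and \<Phi>ss G :: "real \<Rightarrow> real"
  assumes "1 < \<gamma>" and "\<gamma> < 2"
    and "\<And>n. n \<ge> 2 \<Longrightarrow> process_with_generator n (gen \<gamma> \<Phi>l \<Phi>r n) (P n)"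
    and "\<And>n. n \<ge> 2 \<Longrightarrow> invariant_prob n (P n) (\<mu>ss n)"
    and "weak_solution \<gamma> \<Phi>l \<Phi>r \<Phi>ss"
    and "continuous_on {0..1} G"
    and "\<delta> > 0"
  shows "(\<lambda>n. measure (\<mu>ss n)
            {\<phi> \<in> space (\<mu>ss n). \<bar>emp_pairing n \<phi> G - (LBINT u:{0..1}. G u * \<Phi>ss u)\<bar> > \<delta>})
          \<longlonglongrightarrow> 0"
proof -
  have chain: "invariant_chain \<gamma> \<Phi>l \<Phi>r n (P n) (\<mu>ss n)" if "n \<ge> 2" for n
    by unfold_locales (use assms that in auto)
  define m where "m n = invariant_chain.mean (\<mu>ss n)" for n
  have harm: "discrete_harmonic \<gamma> \<Phi>l \<Phi>r n (m n)" if "n \<ge> 2" for n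
    unfolding discrete_harmonic_def m_def using invariant_chain.mean_equation[OF chain[OF that]] by blast
  have \<Phi>: "continuous_on {0..1} \<Phi>ss" using assms(5) by (simp add: weak_solution_def frac_sobolev_def)
  note G = assms(6)
  obtain M where M: "\<And>u. u \<in> {0..1} \<Longrightarrow> \<bar>G u\<bar> \<le> M"
    using compact_imp_bounded[OF compact_continuous_image[OF G compact_Icc]] unfolding bounded_iff real_norm_def by blast
  have M0: "M \<ge> 0" using M[of 0] by simp
  let ?I = "LBINT u:{0..1}. G u * \<Phi>ss u"
  have I: "?I = integral {0..1} (\<lambda>u. G u * \<Phi>ss u)"
    by (intro set_borel_integral_eq_integral borel_integrable_atLeastAtMost' continuous_intros G \<Phi>)
  define h where "h n x = G (real x / real n) / real (n - 1)" for n x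
  have emp: "emp_pairing n \<phi> G = (\<Sum>x\<in>sites n. h n x * \<phi> x)" for n \<phi>
    by (simp add: emp_pairing_def h_def card_sites sum_divide_distrib mult.commute)
  \<comment> \<open>The empirical measure is normalised by the number n - 1 of sites, a Riemann sum
    by n.\<close>
  have ratio: "(\<lambda>n. real n / real (n - 1)) \<longlonglongrightarrow> 1"
  proof -
    have "(\<lambda>n. 1 + 1 / real n) \<longlonglongrightarrow> 1 + 0" by (intro tendsto_intros lim_const_over_n)
    moreover have "real (Suc n) / real (Suc n - 1) = 1 + 1 / real n" if "n > 0" for n using that by (simp add: field_simps)
    ultimately have "(\<lambda>n. real (Suc n) / real (Suc n - 1)) \<longlonglongrightarrow> 1 + 0"
      by (elim Lim_transform_eventually) (auto simp: eventually_sequentially intro!: exI[of _ 1])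
    then show ?thesis using LIMSEQ_imp_Suc[of "\<lambda>n. real n / real (n - 1)"] by simp
  qed
  have mean_lim: "(\<lambda>n. \<Sum>x\<in>sites n. h n x * m n x) \<longlonglongrightarrow> ?I"
  proof -
    have sum_h: "(\<Sum>x\<in>sites n. h n x * \<Phi>ss (real x / real n)) = (\<Sum>x\<in>sites n. G (real x / real n) * \<Phi>ss (real x / real n)) / real (n - 1)" for n
      by (simp add: h_def sum_divide_distrib)
    have "(\<lambda>n. real n / real (n - 1) * ((\<Sum>x\<in>sites n. G (real x / real n) * \<Phi>ss (real x / real n)) / real n)) \<longlonglongrightarrow> 1 * ?I"
      unfolding I by (intro tendsto_mult ratio riemann_sum_sites continuous_intros G \<Phi>)
    then have "(\<lambda>n. real n / real (n - 1) * ((\<Sum>x\<in>sites n. G (real x / real n) * \<Phi>ss (real x / real n)) / real n)) \<longlonglongrightarrow> ?I"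
      by simp
    then have a: "(\<lambda>n. \<Sum>x\<in>sites n. h n x * \<Phi>ss (real x / real n)) \<longlonglongrightarrow> ?I"
      by (rule Lim_transform_eventually)
         (auto simp: eventually_sequentially sum_h simp del: of_nat_diff intro!: exI[of _ 1])
    have "(\<lambda>n. (\<Sum>x\<in>sites n. h n x * m n x) - (\<Sum>x\<in>sites n. h n x * \<Phi>ss (real x / real n))) \<longlonglongrightarrow> 0"
    proof (rule LIMSEQ_I)
      fix e :: real assume e: "e > 0"
      define e' where "e' = e / (2 * (M + 1))"
      have e': "e' > 0" "M * e' < e"
      proof -
        show "e' > 0" using e M0 by (simp add: e'_def)
        then have "M * e' \<le> (M + 1) * e'" by simp
        also have "\<dots> = e / 2"
        proof -
          have "Z * (e / (2 * Z)) = e / 2" if "Z > 0" for Z :: real using that by simp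
          from this[of "M + 1"] show ?thesis using M0 unfolding e'_def by linarith
        qed
        finally show "M * e' < e" using e by simp
      qed
      have "\<forall>\<^sub>F n in sequentially. (\<forall>x\<in>sites n. \<bar>m n x - \<Phi>ss (real x / real n)\<bar> \<le> e') \<and> n \<ge> 2"
        by (intro eventually_conj discrete_profile_converges[OF assms(1,2,5) harm e'(1)] eventually_ge_at_top)
      then have "\<forall>\<^sub>F n in sequentially. norm ((\<Sum>x\<in>sites n. h n x * m n x) - (\<Sum>x\<in>sites n. h n x * \<Phi>ss (real x / real n)) - 0) < e"
      proof eventually_elim
        case (elim n)
        have n1: "real (n - 1) > 0" using elim by simp
        have "\<bar>(\<Sum>x\<in>sites n. h n x * m n x) - (\<Sum>x\<in>sites n. h n x * \<Phi>ss (real x / real n))\<bar>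
          = \<bar>\<Sum>x\<in>sites n. h n x * (m n x - \<Phi>ss (real x / real n))\<bar>"
          by (simp add: sum_subtractf right_diff_distrib)
        also have "\<dots> \<le> (\<Sum>x\<in>sites n. M / real (n - 1) * e')"
        proof (rule order_trans[OF sum_abs sum_mono])
          fix x assume x: "x \<in> sites n"
          have "\<bar>h n x\<bar> \<le> M / real (n - 1)"
            using M[OF sites_in_unit[OF x]] n1 by (simp add: h_def divide_right_mono)
          then show "\<bar>h n x * (m n x - \<Phi>ss (real x / real n))\<bar> \<le> M / real (n - 1) * e'"
            unfolding abs_mult using elim x M0 n1 by (intro mult_mono) auto
        qed
        also have "\<dots> = M * e'" using n1 by (simp add: card_sites)
        finally show ?case using e'(2) by simp
      qed
      then show "\<exists>no. \<forall>n\<ge>no. norm ((\<Sum>x\<in>sites n. h n x * m n x) - (\<Sum>x\<in>sites n. h n x * \<Phi>ss (real x / real n)) - 0) < e"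
        by (simp add: eventually_sequentially)
    qed
    from tendsto_add[OF this a] show ?thesis by simp
  qed
  \<comment> \<open>There are n - 1 weights, each of order 1/(n - 1); with the identity as
    covariance the variance is of order 1/n.\<close>
  have var: "(\<Sum>x\<in>sites n. (h n x)\<^sup>2) \<le> M\<^sup>2 / real (n - 1)" if n: "n \<ge> 2" for n
  proof -
    have n1: "real (n - 1) > 0" using n by simp
    have "(h n x)\<^sup>2 \<le> M\<^sup>2 / (real (n - 1))\<^sup>2" if "x \<in> sites n" for x
      unfolding h_def power_divide using M[OF sites_in_unit[OF that]] M0
      by (intro divide_right_mono) (auto simp: abs_le_square_iff[symmetric])
    then have "(\<Sum>x\<in>sites n. (h n x)\<^sup>2) \<le> (\<Sum>x\<in>sites n. M\<^sup>2 / (real (n - 1))\<^sup>2)" by (rule sum_mono)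
    also have "\<dots> = M\<^sup>2 / real (n - 1)" using n1 by (simp add: card_sites power2_eq_square)
    finally show ?thesis .
  qed
  have "(\<lambda>n. M\<^sup>2 / real (n - 1) / (\<delta> / 2)\<^sup>2) \<longlonglongrightarrow> 0 / (\<delta> / 2)\<^sup>2"
  proof (intro tendsto_divide tendsto_const)
    have "(\<lambda>n. M\<^sup>2 / real (Suc n - 1)) \<longlonglongrightarrow> 0" using lim_const_over_n[of "M\<^sup>2"] by simp
    then show "(\<lambda>n. M\<^sup>2 / real (n - 1)) \<longlonglongrightarrow> 0" by (rule LIMSEQ_imp_Suc)
  qed (use assms(7) in auto)
  then have bound_lim: "(\<lambda>n. M\<^sup>2 / real (n - 1) / (\<delta> / 2)\<^sup>2) \<longlonglongrightarrow> 0" by simp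
  have "\<forall>\<^sub>F n in sequentially. dist (\<Sum>x\<in>sites n. h n x * m n x) ?I < \<delta> / 2 \<and> n \<ge> 2"
    using mean_lim assms(7) by (intro eventually_conj tendstoD eventually_ge_at_top) auto
  then have "\<forall>\<^sub>F n in sequentially. norm (measure (\<mu>ss n) {\<phi> \<in> space (\<mu>ss n). \<bar>emp_pairing n \<phi> G - ?I\<bar> > \<delta>})
      \<le> M\<^sup>2 / real (n - 1) / (\<delta> / 2)\<^sup>2"
  proof eventually_elim
    case (elim n)
    then have n: "n \<ge> 2" by simp
    interpret invariant_chain \<gamma> \<Phi>l \<Phi>r n "P n" "\<mu>ss n" by (rule chain[OF n])
    \<comment> \<open>If the pairing is off by more than \<delta> and its mean by less than
      \<delta>/2, then the pairing deviates from its mean by at least \<delta>/2.\<close>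
    let ?A = "{\<phi> \<in> space (\<mu>ss n). \<bar>lin (h n) \<phi> - lin (h n) mean\<bar> \<ge> \<delta> / 2}"
    have "measure (\<mu>ss n) {\<phi> \<in> space (\<mu>ss n). \<bar>emp_pairing n \<phi> G - ?I\<bar> > \<delta>} \<le> measure (\<mu>ss n) ?A"
    proof (rule finite_measure_mono)
      show "{\<phi> \<in> space (\<mu>ss n). \<bar>emp_pairing n \<phi> G - ?I\<bar> > \<delta>} \<subseteq> ?A"
      proof (intro subsetI CollectI conjI)
        fix \<phi> assume \<phi>: "\<phi> \<in> {\<phi> \<in> space (\<mu>ss n). \<bar>emp_pairing n \<phi> G - ?I\<bar> > \<delta>}"
        then show "\<phi> \<in> space (\<mu>ss n)" by simp
        have "\<bar>lin (h n) mean - ?I\<bar> < \<delta> / 2" using elim by (simp add: m_def dist_real_def)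
        moreover have "\<bar>lin (h n) \<phi> - ?I\<bar> > \<delta>" using \<phi> by (simp add: emp)
        ultimately show "\<delta> / 2 \<le> \<bar>lin (h n) \<phi> - lin (h n) mean\<bar>" by linarith
      qed
      have [measurable]: "lin (h n) \<in> borel_measurable (\<mu>ss n)" by measurable
      show "?A \<in> sets (\<mu>ss n)" by measurable
    qed
    also have "\<dots> \<le> (\<Sum>x\<in>sites n. (h n x)\<^sup>2) / (\<delta> / 2)\<^sup>2" using assms(7) by (intro lin_concentration) simp
    also have "\<dots> \<le> M\<^sup>2 / real (n - 1) / (\<delta> / 2)\<^sup>2" using var[OF n] by (intro divide_right_mono) auto
    finally show ?case by simp
  qed
  then show ?thesis using bound_lim by (rule Lim_null_comparison)
qed

end
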